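(* For $g\ge 3$ we have $$\dim H_1(\mathcal{BI}_{2g+1};\mathbb{Q})\ \ge\ \frac16\left(20g^4+12g^3-5g^2+9g\right).$$
   Context: The braid Torelli group $\mathcal{BI}_n$ is the kernel of the integral Burau representation $B_n\to GL_n(\mathbb{Z}[t,t^{-1}])\to GL_n(\mathbb{Z})$, the composition of the unreduced Burau representation of the braid group $B_n$ with evaluation at $t=-1$. *)

theory Defs
  imports
    "Jordan_Normal_Form.VS_Connect"
    "HOL-Algebra.AbelCoset"
    "HOL-Library.Poly_Mapping"
    "HOL-Library.Extended_Real"
begin

section \<open>The braid group\<close>

text \<open>
  The pair \<open>(i, True)\<close> stands for the Artin generator \<open>\<sigma>\<^sub>i\<close>, the pair
  \<open>(i, False)\<close> for its inverse.
\<close>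

type_synonym braid_word = "(nat \<times> bool) list"

definition braid_words :: "nat \<Rightarrow> braid_word set" where
  "braid_words n = lists ({1..<n} \<times> UNIV)"

inductive braid_eq :: "nat \<Rightarrow> braid_word \<Rightarrow> braid_word \<Rightarrow> bool" for n where
  refl: "w \<in> braid_words n \<Longrightarrow> braid_eq n w w"
| sym: "braid_eq n u v \<Longrightarrow> braid_eq n v u"
| trans: "braid_eq n u v \<Longrightarrow> braid_eq n v w \<Longrightarrow> braid_eq n u w"
| append: "braid_eq n u u' \<Longrightarrow> braid_eq n v v' \<Longrightarrow> braid_eq n (u @ v) (u' @ v')"
| cancel: "i \<in> {1..<n} \<Longrightarrow> braid_eq n [(i, b), (i, \<not> b)] []"
| far_commute: "i \<in> {1..<n} \<Longrightarrow> j \<in> {1..<n} \<Longrightarrow> i + 2 \<le> j \<Longrightarrow>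
    braid_eq n [(i, True), (j, True)] [(j, True), (i, True)]"
| braid_relation: "i \<in> {1..<n} \<Longrightarrow> i + 1 \<in> {1..<n} \<Longrightarrow>
    braid_eq n [(i, True), (i + 1, True), (i, True)] [(i + 1, True), (i, True), (i + 1, True)]"

definition braid_rel :: "nat \<Rightarrow> (braid_word \<times> braid_word) set" where
  "braid_rel n = {(u, v). braid_eq n u v}"

definition braid_group :: "nat \<Rightarrow> braid_word set monoid" where
  "braid_group n =
    \<lparr>carrier = braid_words n // braid_rel n,
     mult = (\<lambda>X Y. \<Union>u\<in>X. \<Union>v\<in>Y. braid_rel n `` {u @ v}),
     one = braid_rel n `` {[]}\<rparr>"

lemma braid_eq_words: "braid_eq n u v \<Longrightarrow> u \<in> braid_words n \<and> v \<in> braid_words n"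
  by (induction rule: braid_eq.induct) (auto simp: braid_words_def)

lemma equiv_braid_rel: "equiv (braid_words n) (braid_rel n)"
proof (rule equivI)
  show "braid_rel n \<subseteq> braid_words n \<times> braid_words n"
    by (auto simp: braid_rel_def dest: braid_eq_words)
  show "refl_on (braid_words n) (braid_rel n)"
    by (simp add: refl_on_def braid_rel_def braid_eq.refl)
  show "Relation.sym (braid_rel n)"
    using braid_eq.sym[of n] by (simp add: Relation.sym_def braid_rel_def)
  show "Relation.trans (braid_rel n)"
    unfolding Relation.trans_def braid_rel_def mem_Collect_eq prod.case
    by (intro allI impI) (rule braid_eq.trans)
qed

lemma braid_mult_class:
  assumes "u \<in> braid_words n" "v \<in> braid_words n"
  shows "braid_rel n `` {u} \<otimes>\<^bsub>braid_group n\<^esub> braid_rel n `` {v} = braid_rel n `` {u @ v}"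
proof -
  have c: "congruent2 (braid_rel n) (braid_rel n) (\<lambda>u v. braid_rel n `` {u @ v})"
  proof (rule congruent2I')
    fix u u' v v' assume "(u, u') \<in> braid_rel n" "(v, v') \<in> braid_rel n"
    then have "(u @ v, u' @ v') \<in> braid_rel n"
      using braid_eq.append[of n u u' v v'] by (simp add: braid_rel_def)
    then show "braid_rel n `` {u @ v} = braid_rel n `` {u' @ v'}"
      by (rule equiv_class_eq[OF equiv_braid_rel])
  qed
  show ?thesis
    using UN_equiv_class2[OF equiv_braid_rel equiv_braid_rel c assms]
    by (simp add: braid_group_def)
qed

lemma braid_group_cases:
  assumes "X \<in> carrier (braid_group n)"
  obtains w where "w \<in> braid_words n" "X = braid_rel n `` {w}"
  using assms unfolding braid_group_def by (auto elim: quotientE)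

lemma braid_class_carrier:
  "w \<in> braid_words n \<Longrightarrow> braid_rel n `` {w} \<in> carrier (braid_group n)"
  by (auto simp: braid_group_def intro: quotientI)

lemma braid_eq_inverse_word:
  "w \<in> braid_words n \<Longrightarrow> braid_eq n (rev (map (\<lambda>(i, b). (i, \<not> b)) w) @ w) []"
proof (induction w)
  case Nil
  then show ?case by (simp add: braid_eq.refl)
next
  case (Cons a w)
  obtain i b where a: "a = (i, b)" by (cases a)
  let ?w' = "rev (map (\<lambda>(i, b). (i, \<not> b)) w)"
  have w: "w \<in> braid_words n" and i: "i \<in> {1..<n}"
    using Cons.prems by (auto simp: braid_words_def a)
  have w': "?w' \<in> braid_words n"
    using w by (auto simp: braid_words_def in_lists_conv_set)
  have "braid_eq n (?w' @ [(i, \<not> b), (i, \<not> \<not> b)] @ w) (?w' @ [] @ w)"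
    by (rule braid_eq.append[OF braid_eq.refl[OF w']
          braid_eq.append[OF braid_eq.cancel[OF i] braid_eq.refl[OF w]]])
  then have "braid_eq n (?w' @ [(i, \<not> b), (i, b)] @ w) (?w' @ w)"
    by simp
  from braid_eq.trans[OF this Cons.IH[OF w]] show ?case
    by (simp add: a)
qed

lemma group_braid_group: "group (braid_group n)"
proof (rule groupI)
  have nil: "[] \<in> braid_words n" by (simp add: braid_words_def)
  have app: "u @ v \<in> braid_words n" if "u \<in> braid_words n" "v \<in> braid_words n" for u v
    using that by (auto simp: braid_words_def)
  have one: "\<one>\<^bsub>braid_group n\<^esub> = braid_rel n `` {[]}" by (simp add: braid_group_def)
  show "\<one>\<^bsub>braid_group n\<^esub> \<in> carrier (braid_group n)"
    unfolding one by (rule braid_class_carrier[OF nil])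
  fix X assume "X \<in> carrier (braid_group n)"
  then obtain u where u: "u \<in> braid_words n" "X = braid_rel n `` {u}"
    by (rule braid_group_cases)
  show "\<one>\<^bsub>braid_group n\<^esub> \<otimes>\<^bsub>braid_group n\<^esub> X = X"
    using u nil by (simp add: one braid_mult_class)
  let ?u' = "rev (map (\<lambda>(i, b). (i, \<not> b)) u)"
  have u': "?u' \<in> braid_words n"
    using u by (auto simp: braid_words_def in_lists_conv_set)
  have "braid_rel n `` {?u' @ u} = braid_rel n `` {[]}"
    using braid_eq_inverse_word[OF u(1)]
    by (intro equiv_class_eq[OF equiv_braid_rel]) (simp add: braid_rel_def)
  then have "braid_rel n `` {?u'} \<otimes>\<^bsub>braid_group n\<^esub> X = \<one>\<^bsub>braid_group n\<^esub>"
    unfolding u(2) one braid_mult_class[OF u' u(1)] .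
  then show "\<exists>Y\<in>carrier (braid_group n). Y \<otimes>\<^bsub>braid_group n\<^esub> X = \<one>\<^bsub>braid_group n\<^esub>"
    using braid_class_carrier[OF u'] by (rule bexI)
  fix Y assume "Y \<in> carrier (braid_group n)"
  then obtain v where v: "v \<in> braid_words n" "Y = braid_rel n `` {v}"
    by (rule braid_group_cases)
  show "X \<otimes>\<^bsub>braid_group n\<^esub> Y \<in> carrier (braid_group n)"
    unfolding u(2) v(2) braid_mult_class[OF u(1) v(1)]
    by (rule braid_class_carrier[OF app[OF u(1) v(1)]])
  fix Z assume "Z \<in> carrier (braid_group n)"
  then obtain w where w: "w \<in> braid_words n" "Z = braid_rel n `` {w}"
    by (rule braid_group_cases)
  show "X \<otimes>\<^bsub>braid_group n\<^esub> Y \<otimes>\<^bsub>braid_group n\<^esub> Z = X \<otimes>\<^bsub>braid_group n\<^esub> (Y \<otimes>\<^bsub>braid_group n\<^esub> Z)"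
    using u v w app by (simp add: braid_mult_class)
qed


section \<open>The Burau representation\<close>

text \<open>
  A Laurent polynomial is a finitely supported function from exponents to coefficients, and the
  product on \<open>\<Rightarrow>\<^sub>0\<close> is convolution, so \<open>int \<Rightarrow>\<^sub>0 int\<close> is the ring \<open>\<int>[t, t\<^sup>-\<^sup>1]\<close>.
\<close>

type_synonym laurent = "int \<Rightarrow>\<^sub>0 int"

definition laurent_t :: laurent where
  "laurent_t = Poly_Mapping.single 1 1"

text \<open>Evaluation at \<open>t = -1\<close>; the absolute value is harmless because \<open>(-1)\<^sup>k = (-1)\<^sup>-\<^sup>k\<close>.\<close>

definition laurent_eval_neg1 :: "laurent \<Rightarrow> int" where
  "laurent_eval_neg1 p = (\<Sum>k\<in>Poly_Mapping.keys p. Poly_Mapping.lookup p k * (-1) ^ nat \<bar>k\<bar>)"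

definition GL :: "nat \<Rightarrow> 'a :: comm_ring_1 mat monoid" where
  "GL n = units_of (ring_mat TYPE('a) n ())"

text \<open>
  The block matrix \<open>I\<^bsub>i-1\<^esub> \<oplus> (a b; c d) \<oplus> I\<^bsub>n-i-1\<^esub>\<close>. Matrix indices start from \<open>0\<close>, so the
  \<open>2 \<times> 2\<close> block occupies the rows and columns with indices \<open>i - 1\<close> and \<open>i\<close>.
\<close>

definition two_block :: "nat \<Rightarrow> nat \<Rightarrow> 'a :: comm_ring_1 \<Rightarrow> 'a \<Rightarrow> 'a \<Rightarrow> 'a \<Rightarrow> 'a mat" where
  "two_block n i a b c d = mat n n (\<lambda>(r, s).
     if r = i - 1 \<and> s = i - 1 then a else if r = i - 1 \<and> s = i then b
     else if r = i \<and> s = i - 1 then c else if r = i \<and> s = i then d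
     else if r = s then 1 else 0)"

definition burau_generator :: "nat \<Rightarrow> nat \<Rightarrow> laurent mat" where
  "burau_generator n i = two_block n i (1 - laurent_t) laurent_t 1 0"

definition burau_letter :: "nat \<Rightarrow> nat \<times> bool \<Rightarrow> laurent mat" where
  "burau_letter n = (\<lambda>(i, b). if b then burau_generator n i else inv\<^bsub>GL n\<^esub> burau_generator n i)"

definition burau_word :: "nat \<Rightarrow> braid_word \<Rightarrow> laurent mat" where
  "burau_word n w = foldr (\<lambda>l M. burau_letter n l \<otimes>\<^bsub>GL n\<^esub> M) w \<one>\<^bsub>GL n\<^esub>"

text \<open>
  By \<open>burau_class\<close> below, \<open>burau_word\<close> is constant on every equivalence class of words, so
  \<open>the_elem\<close> picks its unique value there.
\<close>

definition burau :: "nat \<Rightarrow> braid_word set \<Rightarrow> laurent mat" where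
  "burau n X = the_elem (burau_word n ` X)"

definition integral_burau :: "nat \<Rightarrow> braid_word set \<Rightarrow> int mat" where
  "integral_burau n X = map_mat laurent_eval_neg1 (burau n X)"

definition braid_torelli :: "nat \<Rightarrow> braid_word set monoid" where
  "braid_torelli n =
    (braid_group n)\<lparr>carrier := kernel (braid_group n) (GL n) (integral_burau n)\<rparr>"

lemma GL_simps:
  "mult (GL n) = (*)" "one (GL n) = 1\<^sub>m n"
  by (simp_all add: GL_def units_of_def ring_mat_simps)

lemma monoid_ring_mat: "monoid (ring_mat TYPE('a :: comm_ring_1) n ())"
  using ring_mat[where 'a = 'a, of n "()"] by (simp add: ring_def)

lemma group_GL: "group (GL n :: 'a :: comm_ring_1 mat monoid)"
  unfolding GL_def by (rule monoid.units_group[OF monoid_ring_mat])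

lemma GL_carrierI:
  assumes "A \<in> carrier_mat n n" "B \<in> carrier_mat n n" "A * B = 1\<^sub>m n" "B * A = 1\<^sub>m n"
  shows "A \<in> carrier (GL n)"
  using assms by (auto simp: GL_def units_of_def Units_def ring_mat_simps)

lemma GL_carrierD: "A \<in> carrier (GL n) \<Longrightarrow> A \<in> carrier_mat n n"
  by (auto simp: GL_def units_of_def Units_def ring_mat_simps)

lemma two_block_carrier: "two_block n i a b c d \<in> carrier_mat n n"
  by (simp add: two_block_def)

lemma two_block_mult_index:
  assumes M: "M \<in> carrier_mat n n" and i: "i \<in> {1..<n}" and r: "r < n" and s: "s < n"
  shows "(two_block n i a b c d * M) $$ (r, s) =
    (if r = i - 1 then a * M $$ (i - 1, s) + b * M $$ (i, s)
     else if r = i then c * M $$ (i - 1, s) + d * M $$ (i, s) else M $$ (r, s))"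
proof -
  let ?f = "\<lambda>k. two_block n i a b c d $$ (r, k) * M $$ (k, s)"
  have ne: "i - 1 \<noteq> i" using i by auto
  have "(two_block n i a b c d * M) $$ (r, s) = (\<Sum>k\<in>{0..<n}. ?f k)"
    using M r s two_block_carrier[of n i a b c d] by (auto simp: scalar_prod_def)
  also have "\<dots> = (\<Sum>k\<in>(if r = i - 1 \<or> r = i then {i - 1, i} else {r}). ?f k)"
    using i r by (intro sum.mono_neutral_right) (auto simp: two_block_def)
  also have "\<dots> = (if r = i - 1 then a * M $$ (i - 1, s) + b * M $$ (i, s)
     else if r = i then c * M $$ (i - 1, s) + d * M $$ (i, s) else M $$ (r, s))"
    using i r ne by (auto simp: two_block_def)
  finally show ?thesis .
qed

lemma two_block_mult:
  assumes i: "i \<in> {1..<n}"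
  shows "two_block n i a b c d * two_block n i a' b' c' d' =
    two_block n i (a * a' + b * c') (a * b' + b * d') (c * a' + d * c') (c * b' + d * d')"
proof (rule eq_matI, goal_cases)
  case (1 r s)
  then have rs: "r < n" "s < n" by (simp_all add: two_block_def)
  have "i - 1 \<noteq> i" using i by auto
  then show ?case
    unfolding two_block_mult_index[OF two_block_carrier i rs]
    using i rs by (auto simp: two_block_def)
qed (simp_all add: two_block_def)

lemma two_block_one:
  assumes "i \<in> {1..<n}"
  shows "two_block n i 1 0 0 1 = 1\<^sub>m n"
proof (rule eq_matI, goal_cases)
  case (1 r s)
  then have rs: "r < n" "s < n" by simp_all
  obtain j where j: "i = Suc j" using assms by (cases i) auto
  have a: "two_block n i 1 0 0 1 $$ (r,s) = (if r = i - 1 \<and> s = i - 1 then 1 else if r = i - 1 \<and> s = i then 0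
     else if r = i \<and> s = i - 1 then 0 else if r = i \<and> s = i then 1
     else if r = s then 1 else 0)"
    unfolding two_block_def using rs by (subst index_mat) (simp_all only: prod.case)
  show ?case
  proof (cases "r = s")
    case True
    show ?thesis unfolding a unfolding True j using rs by simp
  next
    case False
    then show ?thesis unfolding a unfolding j using rs by simp
  qed
qed (simp_all add: two_block_def)

lemma burau_generator_GL:
  assumes i: "i \<in> {1..<n}"
  shows "burau_generator n i \<in> carrier (GL n)"
proof (rule GL_carrierI)
  let ?t' = "Poly_Mapping.single (-1) 1 :: laurent"
  have t: "laurent_t * ?t' = 1" "?t' * laurent_t = 1"
    by (simp_all add: laurent_t_def mult_single)
  show "burau_generator n i * two_block n i 0 1 ?t' (1 - ?t') = 1\<^sub>m n"
    unfolding burau_generator_def two_block_mult[OF i]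
    by (simp add: algebra_simps t two_block_one[OF i])
  show "two_block n i 0 1 ?t' (1 - ?t') * burau_generator n i = 1\<^sub>m n"
    unfolding burau_generator_def two_block_mult[OF i]
    by (simp add: algebra_simps t two_block_one[OF i])
qed (simp_all add: burau_generator_def two_block_carrier)

lemma burau_letter_GL: "i \<in> {1..<n} \<Longrightarrow> burau_letter n (i, b) \<in> carrier (GL n)"
  using group.inv_closed[OF group_GL burau_generator_GL] burau_generator_GL
  by (auto simp: burau_letter_def)

lemma burau_word_simps:
  "burau_word n [] = \<one>\<^bsub>GL n\<^esub>"
  "burau_word n (l # w) = burau_letter n l \<otimes>\<^bsub>GL n\<^esub> burau_word n w"
  by (simp_all add: burau_word_def)

lemma braid_words_Cons: "(i, b) # w \<in> braid_words n \<longleftrightarrow> i \<in> {1..<n} \<and> w \<in> braid_words n"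
  by (auto simp: braid_words_def)

lemma burau_word_GL:
  assumes "w \<in> braid_words n"
  shows "burau_word n w \<in> carrier (GL n)"
proof -
  interpret GL: group "GL n :: laurent mat monoid" by (rule group_GL)
  show ?thesis
    using assms
  proof (induction w)
    case Nil
    show ?case by (simp add: burau_word_simps)
  next
    case (Cons l w)
    then show ?case
      by (cases l) (simp add: burau_word_simps braid_words_Cons burau_letter_GL)
  qed
qed

lemma burau_word_append:
  assumes "u \<in> braid_words n" "v \<in> braid_words n"
  shows "burau_word n (u @ v) = burau_word n u \<otimes>\<^bsub>GL n\<^esub> burau_word n v"
proof -
  interpret GL: group "GL n :: laurent mat monoid" by (rule group_GL)
  show ?thesis
    using assms(1)
  proof (induction u)
    case Nil
    show ?case using burau_word_GL[OF assms(2)] by (simp add: burau_word_simps)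
  next
    case (Cons l u)
    then show ?case
      using burau_word_GL[OF assms(2)]
      by (cases l)
        (simp add: burau_word_simps braid_words_Cons burau_letter_GL burau_word_GL GL.m_assoc)
  qed
qed

lemma burau_generator_far_commute:
  assumes i: "i \<in> {1..<n}" and j: "j \<in> {1..<n}" and far: "i + 2 \<le> j"
  shows "burau_generator n i * burau_generator n j = burau_generator n j * burau_generator n i"
  unfolding burau_generator_def
proof (rule eq_matI, goal_cases)
  case (1 r s)
  then have rs: "r < n" "s < n" by (simp_all add: two_block_def)
  obtain k where k: "i = Suc k" using i by (cases i) auto
  obtain l where l: "j = Suc l" using j by (cases j) auto
  have "k \<noteq> l" "Suc k \<noteq> l" "k \<noteq> Suc l" "k < n" "l < n" "Suc k < n" "Suc l < n"
    using i j far by (simp_all add: k l)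
  moreover consider "r = k" | "r = Suc k" | "r = l" | "r = Suc l"
    | "r \<noteq> k" "r \<noteq> Suc k" "r \<noteq> l" "r \<noteq> Suc l" by blast
  ultimately show ?case
    unfolding two_block_mult_index[OF two_block_carrier i rs]
      two_block_mult_index[OF two_block_carrier j rs]
    using rs by cases (simp_all add: two_block_def k l)
qed (simp_all add: two_block_def)

lemma two_block_Suc_index:
  assumes "r < n" "s < n"
  shows "two_block n (Suc k) a b c d $$ (r, s) =
    (if r = k then (if s = k then a else if s = Suc k then b else 0)
     else if r = Suc k then (if s = k then c else if s = Suc k then d else 0)
     else if r = s then 1 else 0)"
  using assms by (simp add: two_block_def)

lemma two_block_Suc_mult_index:
  assumes "M \<in> carrier_mat n n" "Suc k < n" "r < n" "s < n"
  shows "(two_block n (Suc k) a b c d * M) $$ (r, s) =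
    (if r = k then a * M $$ (k, s) + b * M $$ (Suc k, s)
     else if r = Suc k then c * M $$ (k, s) + d * M $$ (Suc k, s) else M $$ (r, s))"
  using two_block_mult_index[OF assms(1) _ assms(3,4), of "Suc k" a b c d] assms(2) by simp

lemma burau_generator_braid:
  assumes i: "i \<in> {1..<n}" and i1: "i + 1 \<in> {1..<n}"
  shows "burau_generator n i * (burau_generator n (i + 1) * burau_generator n i) =
    burau_generator n (i + 1) * (burau_generator n i * burau_generator n (i + 1))"
proof -
  obtain k where k: "i = Suc k" "i + 1 = Suc (Suc k)" using i by (cases i) auto
  have lt: "k < n" "Suc k < n" "Suc (Suc k) < n" using i1 by (simp_all add: k(1))
  show ?thesis
    unfolding k burau_generator_def
  proof (rule eq_matI, goal_cases)
    case (1 r s)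
    then have rs: "r < n" "s < n" by (simp_all add: two_block_def)
    note [simp] = lt rs two_block_Suc_mult_index two_block_carrier
      mult_carrier_mat[OF two_block_carrier two_block_carrier]
    note [simp del] = index_mult_mat(1)
    consider "r = k" | "r = Suc k" | "r = Suc (Suc k)"
      | "r \<noteq> k" "r \<noteq> Suc k" "r \<noteq> Suc (Suc k)" by blast
    then show ?case
      by cases (simp_all add: two_block_Suc_index algebra_simps)
  qed (simp_all add: two_block_def)
qed

lemma burau_word_respects:
  assumes "braid_eq n u v"
  shows "burau_word n u = burau_word n v"
proof -
  interpret GL: group "GL n :: laurent mat monoid" by (rule group_GL)
  show ?thesis
    using assms
  proof (induction rule: braid_eq.induct)
    case (append u u' v v')
    then show ?case
      using braid_eq_words[OF append.hyps(1)] braid_eq_words[OF append.hyps(2)]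
      by (simp add: burau_word_append)
  next
    case (cancel i b)
    then show ?case
      using burau_generator_GL[OF cancel]
      by (cases b) (simp_all add: burau_word_simps burau_letter_def)
  next
    case (far_commute i j)
    have "burau_generator n i \<otimes>\<^bsub>GL n\<^esub> burau_generator n j =
        burau_generator n j \<otimes>\<^bsub>GL n\<^esub> burau_generator n i"
      using burau_generator_far_commute[OF far_commute] by (simp add: GL_simps(1))
    then show ?case
      using burau_generator_GL[OF far_commute(1)] burau_generator_GL[OF far_commute(2)]
      by (simp add: burau_word_simps burau_letter_def)
  next
    case (braid_relation i)
    have "burau_generator n i \<otimes>\<^bsub>GL n\<^esub> (burau_generator n (i + 1) \<otimes>\<^bsub>GL n\<^esub> burau_generator n i) =
        burau_generator n (i + 1) \<otimes>\<^bsub>GL n\<^esub> (burau_generator n i \<otimes>\<^bsub>GL n\<^esub> burau_generator n (i + 1))"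
      using burau_generator_braid[OF braid_relation] by (simp add: GL_simps(1))
    then show ?case
      using burau_generator_GL[OF braid_relation(1)] burau_generator_GL[OF braid_relation(2)]
      by (simp add: burau_word_simps burau_letter_def)
  qed simp_all
qed

lemma burau_class:
  assumes "w \<in> braid_words n"
  shows "burau n (braid_rel n `` {w}) = burau_word n w"
proof -
  have "burau_word n v = burau_word n w" if "v \<in> braid_rel n `` {w}" for v
  proof -
    from that have "braid_eq n w v" by (simp add: braid_rel_def)
    then show ?thesis by (rule burau_word_respects[symmetric])
  qed
  moreover have "w \<in> braid_rel n `` {w}"
    using braid_eq.refl[OF assms] by (simp add: braid_rel_def)
  ultimately have "burau_word n ` (braid_rel n `` {w}) = {burau_word n w}"
    by blast
  then show ?thesis by (simp add: burau_def)
qed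

lemma burau_hom: "burau n \<in> hom (braid_group n) (GL n)"
proof (rule homI)
  fix X assume "X \<in> carrier (braid_group n)"
  then obtain u where u: "u \<in> braid_words n" "X = braid_rel n `` {u}"
    by (rule braid_group_cases)
  show "burau n X \<in> carrier (GL n)"
    using u by (simp add: burau_class burau_word_GL)
  fix Y assume "Y \<in> carrier (braid_group n)"
  then obtain v where v: "v \<in> braid_words n" "Y = braid_rel n `` {v}"
    by (rule braid_group_cases)
  have "u @ v \<in> braid_words n"
    using u v by (auto simp: braid_words_def)
  then show "burau n (X \<otimes>\<^bsub>braid_group n\<^esub> Y) = burau n X \<otimes>\<^bsub>GL n\<^esub> burau n Y"
    using u v by (simp add: braid_mult_class burau_class burau_word_append)
qed

lemma laurent_eval_neg1_superset:
  assumes "finite K" "Poly_Mapping.keys p \<subseteq> K"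
  shows "laurent_eval_neg1 p = (\<Sum>k\<in>K. Poly_Mapping.lookup p k * (-1) ^ nat \<bar>k\<bar>)"
  unfolding laurent_eval_neg1_def
  using assms by (intro sum.mono_neutral_left) (auto simp: in_keys_iff)

lemma laurent_eval_neg1_add:
  "laurent_eval_neg1 (p + q) = laurent_eval_neg1 p + laurent_eval_neg1 q"
proof -
  let ?K = "Poly_Mapping.keys p \<union> Poly_Mapping.keys q"
  have "Poly_Mapping.keys (p + q) \<subseteq> ?K" by (rule Poly_Mapping.keys_add)
  then show ?thesis
    by (simp add: laurent_eval_neg1_superset[of ?K] lookup_add distrib_right sum.distrib)
qed

lemma laurent_eval_neg1_sum:
  "laurent_eval_neg1 (sum f A) = (\<Sum>x\<in>A. laurent_eval_neg1 (f x))"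
  by (induction A rule: infinite_finite_induct)
    (simp_all add: laurent_eval_neg1_add laurent_eval_neg1_def[of 0])

lemma laurent_eval_neg1_single:
  "laurent_eval_neg1 (Poly_Mapping.single k a) = a * (-1) ^ nat \<bar>k\<bar>"
  by (simp add: laurent_eval_neg1_superset[of "{k}"])

lemma poly_mapping_sum_single:
  fixes p :: "'a \<Rightarrow>\<^sub>0 'b :: comm_monoid_add"
  shows "p = (\<Sum>k\<in>Poly_Mapping.keys p. Poly_Mapping.single k (Poly_Mapping.lookup p k))"
  by (rule poly_mapping_eqI)
    (simp add: lookup_sum lookup_single when_def in_keys_iff)

lemma neg1_power_abs_add:
  "(-1 :: int) ^ nat \<bar>k + l\<bar> = (-1) ^ nat \<bar>k\<bar> * (-1) ^ nat \<bar>l\<bar>"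
  by (simp add: minus_one_power_iff even_nat_iff)

lemma laurent_eval_neg1_mult:
  "laurent_eval_neg1 (p * q) = laurent_eval_neg1 p * laurent_eval_neg1 q"
proof -
  let ?s = "\<lambda>p k. Poly_Mapping.single k (Poly_Mapping.lookup p k) :: laurent"
  have "p * q = (\<Sum>k\<in>Poly_Mapping.keys p. ?s p k) * (\<Sum>l\<in>Poly_Mapping.keys q. ?s q l)"
    using poly_mapping_sum_single[of p] poly_mapping_sum_single[of q] by simp
  also have "\<dots> = (\<Sum>k\<in>Poly_Mapping.keys p. \<Sum>l\<in>Poly_Mapping.keys q.
      Poly_Mapping.single (k + l) (Poly_Mapping.lookup p k * Poly_Mapping.lookup q l))"
    by (simp add: sum_product mult_single)
  finally show ?thesis
    by (simp add: laurent_eval_neg1_sum laurent_eval_neg1_single neg1_power_abs_add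
        laurent_eval_neg1_def[of p] laurent_eval_neg1_def[of q] sum_product algebra_simps)
qed

lemma laurent_eval_neg1_ring_hom: "comm_ring_hom laurent_eval_neg1"
proof
  show "laurent_eval_neg1 1 = 1"
    using laurent_eval_neg1_single[of 0 1] by (simp del: single_one flip: single_one)
  show "laurent_eval_neg1 0 = 0" by (simp add: laurent_eval_neg1_def)
qed (simp_all add: laurent_eval_neg1_add laurent_eval_neg1_mult)

lemma map_laurent_eval_neg1_hom: "map_mat laurent_eval_neg1 \<in> hom (GL n) (GL n)"
proof (rule homI)
  interpret comm_ring_hom laurent_eval_neg1 by (rule laurent_eval_neg1_ring_hom)
  fix A :: "laurent mat" assume A: "A \<in> carrier (GL n)"
  let ?B = "inv\<^bsub>GL n\<^esub> A"
  have B: "?B \<in> carrier (GL n)" by (rule group.inv_closed[OF group_GL A])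
  have "A * ?B = 1\<^sub>m n" "?B * A = 1\<^sub>m n"
    using group.r_inv[OF group_GL A] group.l_inv[OF group_GL A] by (simp_all add: GL_simps)
  then show "map_mat laurent_eval_neg1 A \<in> carrier (GL n)"
    using GL_carrierD[OF A] GL_carrierD[OF B]
    by (intro GL_carrierI[of _ _ "map_mat laurent_eval_neg1 ?B"])
      (auto simp flip: mat_hom_mult simp: mat_hom_one)
  fix C :: "laurent mat" assume C: "C \<in> carrier (GL n)"
  show "map_mat laurent_eval_neg1 (A \<otimes>\<^bsub>GL n\<^esub> C) =
      map_mat laurent_eval_neg1 A \<otimes>\<^bsub>GL n\<^esub> map_mat laurent_eval_neg1 C"
    using mat_hom_mult[OF GL_carrierD[OF A] GL_carrierD[OF C]] by (simp add: GL_simps)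
qed

lemma integral_burau_hom: "integral_burau n \<in> hom (braid_group n) (GL n)"
  using hom_compose[OF burau_hom map_laurent_eval_neg1_hom]
  by (simp add: comp_def integral_burau_def[abs_def])

lemma group_braid_torelli: "group (braid_torelli n)"
proof -
  interpret group_hom "braid_group n" "GL n" "integral_burau n"
    using group_braid_group group_GL integral_burau_hom
    by (simp add: group_hom_def group_hom_axioms_def)
  show ?thesis
    unfolding braid_torelli_def using subgroup.subgroup_is_group[OF subgroup_kernel group_braid_group] .
qed


section \<open>Rational group homology\<close>

text \<open>
  The homology of the (inhomogeneous) bar complex with trivial coefficients \<open>\<rat>\<close>. A \<open>k\<close>-chain
  is a finite formal \<open>\<rat>\<close>-linear combination of symbols \<open>[g\<^sub>1|\<dots>|g\<^sub>k]\<close>, written as lists.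
\<close>

type_synonym 'g chain = "'g list \<Rightarrow>\<^sub>0 rat"

definition chain_scale :: "rat \<Rightarrow> 'g chain \<Rightarrow> 'g chain" where
  "chain_scale q c = Poly_Mapping.map ((*) q) c"

definition bar_chains :: "('g, 'm) monoid_scheme \<Rightarrow> nat \<Rightarrow> (rat, 'g chain) module" where
  "bar_chains G k =
    \<lparr>carrier = {c. Poly_Mapping.keys c \<subseteq> {gs. length gs = k \<and> set gs \<subseteq> carrier G}},
     mult = undefined, one = undefined, zero = 0, add = (+), smult = chain_scale\<rparr>"

definition bar_face :: "('g, 'm) monoid_scheme \<Rightarrow> nat \<Rightarrow> 'g list \<Rightarrow> 'g list" where
  "bar_face G i gs =
    (if i = 0 then tl gs
     else if i = length gs then butlast gs
     else take (i - 1) gs @ [gs ! (i - 1) \<otimes>\<^bsub>G\<^esub> gs ! i] @ drop (i + 1) gs)"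

text \<open>The case \<open>gs = []\<close> makes the boundary of a \<open>0\<close>-chain vanish.\<close>

definition bar_boundary_symbol :: "('g, 'm) monoid_scheme \<Rightarrow> 'g list \<Rightarrow> 'g chain" where
  "bar_boundary_symbol G gs =
    (if gs = [] then 0
     else \<Sum>i\<le>length gs. Poly_Mapping.single (bar_face G i gs) ((-1) ^ i))"

definition bar_boundary :: "('g, 'm) monoid_scheme \<Rightarrow> 'g chain \<Rightarrow> 'g chain" where
  "bar_boundary G c =
    (\<Sum>gs\<in>Poly_Mapping.keys c. chain_scale (Poly_Mapping.lookup c gs) (bar_boundary_symbol G gs))"

definition bar_cycles :: "('g, 'm) monoid_scheme \<Rightarrow> nat \<Rightarrow> 'g chain set" where
  "bar_cycles G k = {c \<in> carrier (bar_chains G k). bar_boundary G c = 0}"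

definition bar_boundaries :: "('g, 'm) monoid_scheme \<Rightarrow> nat \<Rightarrow> 'g chain set" where
  "bar_boundaries G k = bar_boundary G ` carrier (bar_chains G (k + 1))"

text \<open>
  The set \<open>W\<close> is added in the scalar multiplication so that \<open>0 \<odot> X\<close> is the coset \<open>W\<close>
  and not \<open>{0}\<close>. The fields \<open>mult\<close> and \<open>one\<close> play no role in a module.
\<close>

definition quotient_module :: "('a, 'v, 'm) module_scheme \<Rightarrow> 'v set \<Rightarrow> ('a, 'v set) module" where
  "quotient_module V W =
    \<lparr>carrier = a_rcosets\<^bsub>V\<^esub> W, mult = undefined, one = undefined, zero = W, add = set_add V,
     smult = (\<lambda>a X. W <+>\<^bsub>V\<^esub> (\<lambda>x. a \<odot>\<^bsub>V\<^esub> x) ` X)\<rparr>"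

definition rational_homology :: "nat \<Rightarrow> ('g, 'm) monoid_scheme \<Rightarrow> (rat, 'g chain set) module" where
  "rational_homology k G =
    quotient_module ((bar_chains G k)\<lparr>carrier := bar_cycles G k\<rparr>) (bar_boundaries G k)"

text \<open>The library's \<open>vectorspace.dim\<close> is meaningful only for finite-dimensional spaces.\<close>

definition extended_dim :: "('a, 'b) ring_scheme \<Rightarrow> ('a, 'v, 'm) module_scheme \<Rightarrow> enat" where
  "extended_dim K V = (if vectorspace.fin_dim K V then enat (vectorspace.dim K V) else \<infinity>)"


lemma lookup_chain_scale:
  "Poly_Mapping.lookup (chain_scale q c) gs = q * Poly_Mapping.lookup c gs"
  by (simp add: chain_scale_def map.rep_eq when_def)

lemma chain_scale_algebra:
  "chain_scale q (c + c') = chain_scale q c + chain_scale q c'"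
  "chain_scale (q + q') c = chain_scale q c + chain_scale q' c"
  "chain_scale (q * q') c = chain_scale q (chain_scale q' c)"
  "chain_scale 1 c = c" "chain_scale 0 c = 0" "chain_scale q 0 = 0"
  by (auto intro!: poly_mapping_eqI simp: lookup_chain_scale lookup_add algebra_simps)

lemma chain_scale_sum: "chain_scale q (sum f A) = (\<Sum>x\<in>A. chain_scale q (f x))"
  by (induction A rule: infinite_finite_induct) (simp_all add: chain_scale_algebra)

lemma keys_chain_scale: "Poly_Mapping.keys (chain_scale q c) \<subseteq> Poly_Mapping.keys c"
  by (auto simp: in_keys_iff lookup_chain_scale)

lemma bar_boundary_superset:
  assumes "finite K" "Poly_Mapping.keys c \<subseteq> K"
  shows "bar_boundary G c =
    (\<Sum>gs\<in>K. chain_scale (Poly_Mapping.lookup c gs) (bar_boundary_symbol G gs))"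
  unfolding bar_boundary_def
  using assms by (intro sum.mono_neutral_left) (auto simp: in_keys_iff chain_scale_algebra)

lemma bar_boundary_add: "bar_boundary G (c + c') = bar_boundary G c + bar_boundary G c'"
proof -
  let ?K = "Poly_Mapping.keys c \<union> Poly_Mapping.keys c'"
  have "Poly_Mapping.keys (c + c') \<subseteq> ?K" by (rule Poly_Mapping.keys_add)
  then show ?thesis
    by (simp add: bar_boundary_superset[of ?K] lookup_add chain_scale_algebra sum.distrib)
qed

lemma bar_boundary_scale: "bar_boundary G (chain_scale q c) = chain_scale q (bar_boundary G c)"
  using bar_boundary_superset[OF finite_keys keys_chain_scale, of G q c]
  by (simp add: bar_boundary_def lookup_chain_scale chain_scale_algebra chain_scale_sum)

lemma bar_boundary_zero: "bar_boundary G 0 = 0"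
  by (simp add: bar_boundary_def)

lemma bar_chains_simps:
  "c \<in> carrier (bar_chains G k) \<longleftrightarrow>
    Poly_Mapping.keys c \<subseteq> {gs. length gs = k \<and> set gs \<subseteq> carrier G}"
  "\<zero>\<^bsub>bar_chains G k\<^esub> = 0" "add (bar_chains G k) = (+)" "smult (bar_chains G k) = chain_scale"
  by (simp_all add: bar_chains_def)

lemma bar_chains_closed:
  "0 \<in> carrier (bar_chains G k)"
  "c \<in> carrier (bar_chains G k) \<Longrightarrow> c' \<in> carrier (bar_chains G k) \<Longrightarrow>
    c + c' \<in> carrier (bar_chains G k)"
  "c \<in> carrier (bar_chains G k) \<Longrightarrow> chain_scale q c \<in> carrier (bar_chains G k)"
  using order_trans[OF Poly_Mapping.keys_add[of c c'] Un_least] order_trans[OF keys_chain_scale[of q c]]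
  unfolding bar_chains_simps(1) by simp_all

lemma module_bar_chains: "Module.module class_ring (bar_chains G k)"
proof (rule module_criteria)
  show "cring (class_ring :: rat ring)"
    by (unfold_locales)
next
  show "\<forall>v\<in>carrier (bar_chains G k). \<exists>w\<in>carrier (bar_chains G k).
      v \<oplus>\<^bsub>bar_chains G k\<^esub> w = \<zero>\<^bsub>bar_chains G k\<^esub>"
  proof
    fix v assume v: "v \<in> carrier (bar_chains G k)"
    have "v + chain_scale (-1) v = 0"
      by (rule poly_mapping_eqI) (simp add: lookup_add lookup_chain_scale)
    then show "\<exists>w\<in>carrier (bar_chains G k). v \<oplus>\<^bsub>bar_chains G k\<^esub> w = \<zero>\<^bsub>bar_chains G k\<^esub>"
      using bar_chains_closed(3)[OF v]
      by (intro bexI[of _ "chain_scale (-1) v"]) (simp_all add: bar_chains_simps(2-4))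
  qed
qed (auto simp: bar_chains_simps(2-4) chain_scale_algebra bar_chains_closed algebra_simps)

lemma submodule_bar_cycles: "submodule class_ring (bar_cycles G k) (bar_chains G k)"
  using module_bar_chains
  by (rule submodule.intro)
    (auto simp: bar_cycles_def bar_chains_closed bar_chains_simps(2-4) bar_boundary_add
      bar_boundary_scale bar_boundary_zero chain_scale_algebra)

lemma bar_boundary_one_chain:
  assumes "c \<in> carrier (bar_chains G 1)"
  shows "bar_boundary G c = 0"
  unfolding bar_boundary_def
proof (intro sum.neutral ballI)
  fix gs assume "gs \<in> Poly_Mapping.keys c"
  then obtain h where "gs = [h]"
    using assms by (auto simp: bar_chains_simps length_Suc_conv)
  then have "bar_boundary_symbol G gs = 0"
    by (simp add: bar_boundary_symbol_def bar_face_def flip: single_add)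
  then show "chain_scale (Poly_Mapping.lookup c gs) (bar_boundary_symbol G gs) = 0"
    by (simp add: chain_scale_algebra)
qed

lemma bar_boundary_symbol_two:
  "bar_boundary_symbol G [g, h] =
    Poly_Mapping.single [h] 1 - Poly_Mapping.single [g \<otimes>\<^bsub>G\<^esub> h] 1 + Poly_Mapping.single [g] 1"
  by (simp add: bar_boundary_symbol_def bar_face_def numeral_2_eq_2 single_uminus)

lemma bar_boundary_two_chain:
  assumes G: "group G" and c: "c \<in> carrier (bar_chains G 2)"
  shows "bar_boundary G c \<in> carrier (bar_chains G 1)"
proof -
  interpret group G by (rule G)
  have sym: "bar_boundary_symbol G gs \<in> carrier (bar_chains G 1)"
    if "gs \<in> Poly_Mapping.keys c" for gs
  proof -
    obtain g h where gs: "gs = [g, h]" "g \<in> carrier G" "h \<in> carrier G"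
      using c \<open>gs \<in> Poly_Mapping.keys c\<close>
      by (auto simp: bar_chains_simps length_Suc_conv numeral_2_eq_2)
    have "Poly_Mapping.keys (bar_boundary_symbol G gs) \<subseteq> {[g], [h], [g \<otimes>\<^bsub>G\<^esub> h]}"
      by (auto simp: gs(1) bar_boundary_symbol_two in_keys_iff lookup_add lookup_minus
          lookup_single when_def split: if_splits)
    then show ?thesis
      using gs by (auto simp: bar_chains_simps)
  qed
  have "(\<Sum>gs\<in>A. chain_scale (Poly_Mapping.lookup c gs) (bar_boundary_symbol G gs))
      \<in> carrier (bar_chains G 1)" if "A \<subseteq> Poly_Mapping.keys c" for A
    using that
    by (induction A rule: infinite_finite_induct) (auto simp del: One_nat_def intro!: bar_chains_closed sym)
  then show ?thesis by (simp add: bar_boundary_def)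
qed

lemma submodule_bar_boundaries_one:
  assumes G: "group G"
  shows "submodule class_ring (bar_boundaries G 1)
    ((bar_chains G 1)\<lparr>carrier := bar_cycles G 1\<rparr>)"
proof (rule submodule.intro)
  show "Module.module class_ring ((bar_chains G 1)\<lparr>carrier := bar_cycles G 1\<rparr>)"
    by (rule module.submodule_is_module[OF module_bar_chains submodule_bar_cycles])
  show "bar_boundaries G 1 \<subseteq> carrier ((bar_chains G 1)\<lparr>carrier := bar_cycles G 1\<rparr>)"
    using bar_boundary_two_chain[OF G] bar_boundary_one_chain[of _ G]
    by (auto simp: bar_boundaries_def bar_cycles_def one_add_one simp del: One_nat_def)
  show "\<zero>\<^bsub>(bar_chains G 1)\<lparr>carrier := bar_cycles G 1\<rparr>\<^esub> \<in> bar_boundaries G 1"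
    using bar_chains_closed(1)[of G 2]
    by (auto simp: bar_boundaries_def bar_chains_simps(2-4) image_iff bar_boundary_zero
        one_add_one simp del: One_nat_def intro!: bexI[of _ 0])
qed (auto simp: bar_boundaries_def bar_chains_simps(2-4) bar_chains_closed
      simp flip: bar_boundary_add bar_boundary_scale)

lemma module_quotient_module:
  fixes R :: "('a, 'b) ring_scheme" and V :: "('a, 'v, 'm) module_scheme"
  assumes W: "submodule R W V"
  shows "Module.module R (quotient_module V W)"
proof -
  interpret W: submodule R W V by (rule W)
  interpret V: Module.module R V by (rule W.module)
  have "additive_subgroup W V"
  proof (rule additive_subgroup.intro, rule subgroup.intro)
    fix x assume x: "x \<in> W"
    then show "inv\<^bsub>add_monoid V\<^esub> x \<in> W"
      using W.smult_closed[OF V.R.a_inv_closed[OF V.R.one_closed] x] V.smult_minus_1[of x]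
        W.subset
      by (metis a_inv_def subsetD)
  qed (use W.subset in auto)
  then interpret S: abelian_subgroup W V
    by (rule abelian_subgroupI3) (rule V.M.abelian_group_axioms)
  note add = S.a_rcos_sum
  have sm: "smult (quotient_module V W) a (W +>\<^bsub>V\<^esub> x) = W +>\<^bsub>V\<^esub> (a \<odot>\<^bsub>V\<^esub> x)"
    if a: "a \<in> carrier R" and x: "x \<in> carrier V" for a x
  proof -
    have "W <+>\<^bsub>V\<^esub> (\<lambda>x. a \<odot>\<^bsub>V\<^esub> x) ` (W +>\<^bsub>V\<^esub> x) = W +>\<^bsub>V\<^esub> (a \<odot>\<^bsub>V\<^esub> x)"
    proof (intro equalityI subsetI)
      fix y assume "y \<in> W <+>\<^bsub>V\<^esub> (\<lambda>x. a \<odot>\<^bsub>V\<^esub> x) ` (W +>\<^bsub>V\<^esub> x)"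
      then obtain w w' where w: "w \<in> W" "w' \<in> W" "y = w \<oplus>\<^bsub>V\<^esub> a \<odot>\<^bsub>V\<^esub> (w' \<oplus>\<^bsub>V\<^esub> x)"
        by (auto simp: set_add_def' a_r_coset_def')
      then have "y = (w \<oplus>\<^bsub>V\<^esub> a \<odot>\<^bsub>V\<^esub> w') \<oplus>\<^bsub>V\<^esub> a \<odot>\<^bsub>V\<^esub> x"
        using a x W.subset by (auto simp: V.smult_r_distr V.M.a_assoc subset_iff)
      then show "y \<in> W +>\<^bsub>V\<^esub> (a \<odot>\<^bsub>V\<^esub> x)"
        using w a by (auto simp: a_r_coset_def')
    next
      fix y assume "y \<in> W +>\<^bsub>V\<^esub> (a \<odot>\<^bsub>V\<^esub> x)"
      then obtain w where w: "w \<in> W" "y = w \<oplus>\<^bsub>V\<^esub> a \<odot>\<^bsub>V\<^esub> x"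
        by (auto simp: a_r_coset_def')
      have "x \<in> W +>\<^bsub>V\<^esub> x" using x by (rule S.a_rcos_self)
      then show "y \<in> W <+>\<^bsub>V\<^esub> (\<lambda>x. a \<odot>\<^bsub>V\<^esub> x) ` (W +>\<^bsub>V\<^esub> x)"
        using w by (auto simp: set_add_def')
    qed
    then show ?thesis by (simp add: quotient_module_def)
  qed
  have car: "carrier (quotient_module V W) = (\<lambda>x. W +>\<^bsub>V\<^esub> x) ` carrier V"
    by (auto simp: quotient_module_def A_RCOSETS_def')
  have ad: "(W +>\<^bsub>V\<^esub> x) \<oplus>\<^bsub>quotient_module V W\<^esub> (W +>\<^bsub>V\<^esub> y) = W +>\<^bsub>V\<^esub> (x \<oplus>\<^bsub>V\<^esub> y)"
    if "x \<in> carrier V" "y \<in> carrier V" for x y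
    using add[OF that] by (simp add: quotient_module_def)
  have ze: "\<zero>\<^bsub>quotient_module V W\<^esub> = W +>\<^bsub>V\<^esub> \<zero>\<^bsub>V\<^esub>"
    using S.a_rcos_const[of "\<zero>\<^bsub>V\<^esub>"] by (simp add: quotient_module_def)
  show ?thesis
  proof (rule module_criteria)
    show "\<forall>v\<in>carrier (quotient_module V W). \<exists>w\<in>carrier (quotient_module V W).
        v \<oplus>\<^bsub>quotient_module V W\<^esub> w = \<zero>\<^bsub>quotient_module V W\<^esub>"
    proof (clarsimp simp: car)
      fix x assume x: "x \<in> carrier V"
      show "\<exists>y\<in>carrier V. (W +>\<^bsub>V\<^esub> x) \<oplus>\<^bsub>quotient_module V W\<^esub> (W +>\<^bsub>V\<^esub> y) =
          \<zero>\<^bsub>quotient_module V W\<^esub>"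
        using x by (intro bexI[of _ "\<ominus>\<^bsub>V\<^esub> x"]) (simp_all add: ad ze V.M.r_neg)
    qed
  qed (auto simp: car ad ze sm V.M.a_ac V.smult_l_distr V.smult_r_distr V.smult_assoc1
      V.R.cring_axioms)
qed

lemma vectorspace_rational_homology_one:
  assumes "group G"
  shows "vectorspace class_ring (rational_homology 1 G)"
proof -
  have "Module.module class_ring (rational_homology 1 G)"
    unfolding rational_homology_def
    by (rule module_quotient_module[OF submodule_bar_boundaries_one[OF assms]])
  moreover have "field (class_ring :: rat ring)"
    by unfold_locales
  ultimately show ?thesis
    by (simp add: vectorspace_def)
qed

end

theory Submission
  imports Defs
begin

text \<open>
  It suffices to exhibit sufficiently many homomorphisms to \<open>\<rat>\<close> that are linearly independent on
  \<open>BI\<^sub>n\<close>, \<open>n = 2g + 1\<close>. Three kinds are used: the \<open>n\<close> choose \<open>2\<close> linking numbers of pairs of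
  strands; three dihedral translation lengths for every four-element subset of \<open>{1, \<dots>, n + 1}\<close>
  (on \<open>PB\<^sub>n\<close> these are crossed homomorphisms for characters of order two, and such characters are
  trivial on \<open>BI\<^sub>n\<close>, which lies in the level four braid group); and components of the second Johnson
  homomorphism, whose values on the squared Dehn twist about a curve around three points with
  symplectic plane \<open>\<langle>a, b\<rangle>\<close> are quadratic in \<open>a \<and> b\<close>.

  For independence, evaluate a vanishing combination on conjugates of one such twist. Conjugating by
  powers \<open>h\<^sup>k\<close> of an even power of a full twist makes the Johnson part a quadratic polynomial
  in \<open>k\<close> and leaves the other parts unchanged, so its higher coefficients vanish; they are values on planes
  \<open>(p\<^sub>i - p\<^sub>j) \<and> (p\<^sub>k - p\<^sub>l)\<close>, and these kill the Johnson coefficients. Conjugating by full twists then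
  separates the characters of the dihedral part, and finally the linking numbers remain.
\<close>

section \<open>Detecting degree one homology classes by homomorphisms to the rationals\<close>

section \<open>A lower bound for the dimension of the first homology\<close>

text \<open>Conjugates of a single element suffice because the value of such a cocycle on the
  conjugate of \<open>w\<close> by \<open>g\<close> depends on \<open>g\<close> only through the
  state to which \<open>g\<close> carries the starting point. For linking numbers and dihedral
  lengths this state is a permutation together with signs, so it is finite information; for the
  Johnson part it is a lattice plane, on which the value is polynomial. A polynomial that only
  matches finitely many values along a ray is constant there, and this contrast splits off the
  Johnson part.

  The planes consist of vectors with coordinate sum zero, so \<open>n - 1\<close> coordinates are
  enough. The Johnson components used are those of a curvature tensor in \<open>n - 1\<close>
  dimensions with at least three distinct indices. Writing C for binomial coefficients, the bound is
  C(n,2) + 3 C(n+1,4) + 3 C(n-1,3) + 2 C(n-1,4) with n = 2g + 1.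

  The extra point \<open>n + 1\<close> cannot be moved by a braid, so splittings through it are not
  separated directly; they are reached only after all other splittings have been eliminated.\<close>

lemma homogeneous_system_nontrivial_solution:
  fixes v :: "'i \<Rightarrow> 'b \<Rightarrow> 'a :: field"
  assumes "finite B" "finite I" "card B < card I"
  shows "\<exists>a. (\<exists>i\<in>I. a i \<noteq> 0) \<and> (\<forall>b\<in>B. (\<Sum>i\<in>I. a i * v i b) = 0)"
  using assms
proof (induction B arbitrary: I v rule: finite_induct)
  case empty
  then have "I \<noteq> {}" by auto
  then show ?case by (auto intro!: exI[of _ "\<lambda>_. 1"])
next
  case (insert b B)
  show ?case
  proof (cases "\<forall>i\<in>I. v i b = 0")
    case True
    have "card B < card I" using insert by simp
    from insert.IH[OF insert.prems(1) this, of v] True show ?thesis by auto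
  next
    case False
    then obtain j where j: "j \<in> I" "v j b \<noteq> 0" by auto
    define I' where "I' = I - {j}"
    have I': "finite I'" "card B < card I'"
      using insert.prems insert.hyps j by (auto simp: I'_def)
    \<comment> \<open>Gaussian elimination: equation \<open>b\<close> is solved for the unknown
      \<open>j\<close> and substituted into the others.\<close>
    define v' where "v' i c = v i c - v i b / v j b * v j c" for i c
    obtain a where a: "\<exists>i\<in>I'. a i \<noteq> 0" "\<forall>c\<in>B. (\<Sum>i\<in>I'. a i * v' i c) = 0"
      using insert.IH[OF I', of v'] by blast
    define s where "s = - (\<Sum>i\<in>I'. a i * v i b) / v j b"
    define a' where "a' = a(j := s)"
    have sum: "(\<Sum>i\<in>I. a' i * v i c) = s * v j c + (\<Sum>i\<in>I'. a i * v i c)" for c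
      using j insert.prems(1) by (auto simp: sum.remove[of I j] I'_def a'_def intro!: sum.cong)
    have "(\<Sum>i\<in>I. a' i * v i c) = 0" if "c \<in> B" for c
    proof -
      have "0 = (\<Sum>i\<in>I'. a i * v' i c)" using a(2) that by simp
      also have "\<dots> = (\<Sum>i\<in>I'. a i * v i c) - (\<Sum>i\<in>I'. a i * v i b) / v j b * v j c"
        by (simp add: v'_def algebra_simps sum_subtractf sum_distrib_left sum_divide_distrib)
      finally show ?thesis by (simp add: sum s_def algebra_simps)
    qed
    moreover have "(\<Sum>i\<in>I. a' i * v i b) = 0"
      using j by (simp add: sum s_def)
    moreover have "\<exists>i\<in>I. a' i \<noteq> 0"
      using a(1) by (auto simp: I'_def a'_def)
    ultimately show ?thesis by auto
  qed
qed

text \<open>Meant for one-chains, whose symbols have the single entry \<open>hd gs\<close>; ignoring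
  the length keeps the map linear on all chains.\<close>

definition chain_eval :: "('g \<Rightarrow> rat) \<Rightarrow> 'g chain \<Rightarrow> rat" where
  "chain_eval \<psi> c = (\<Sum>gs\<in>Poly_Mapping.keys c. Poly_Mapping.lookup c gs * \<psi> (hd gs))"

lemma chain_eval_superset:
  assumes "finite K" "Poly_Mapping.keys c \<subseteq> K"
  shows "chain_eval \<psi> c = (\<Sum>gs\<in>K. Poly_Mapping.lookup c gs * \<psi> (hd gs))"
  unfolding chain_eval_def
  using assms by (intro sum.mono_neutral_left) (auto simp: in_keys_iff)

lemma chain_eval_add: "chain_eval \<psi> (c + c') = chain_eval \<psi> c + chain_eval \<psi> c'"
proof -
  let ?K = "Poly_Mapping.keys c \<union> Poly_Mapping.keys c'"
  have "Poly_Mapping.keys (c + c') \<subseteq> ?K" by (rule Poly_Mapping.keys_add)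
  then show ?thesis
    by (simp add: chain_eval_superset[of ?K] lookup_add algebra_simps sum.distrib)
qed

lemma chain_eval_scale: "chain_eval \<psi> (chain_scale q c) = q * chain_eval \<psi> c"
  using chain_eval_superset[OF finite_keys keys_chain_scale, of \<psi> q c]
  by (simp add: chain_eval_def lookup_chain_scale sum_distrib_left mult.assoc)

lemma chain_eval_zero: "chain_eval \<psi> 0 = 0"
  by (simp add: chain_eval_def)

lemma chain_eval_diff: "chain_eval \<psi> (c - c') = chain_eval \<psi> c - chain_eval \<psi> c'"
  using chain_eval_add[of \<psi> "c - c'" c'] by simp

lemma chain_eval_sum: "chain_eval \<psi> (sum f A) = (\<Sum>x\<in>A. chain_eval \<psi> (f x))"
  by (induction A rule: infinite_finite_induct) (simp_all add: chain_eval_add chain_eval_zero)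

lemma chain_eval_single: "chain_eval \<psi> (Poly_Mapping.single gs q) = q * \<psi> (hd gs)"
  by (cases "q = 0") (simp_all add: chain_eval_def)

lemma chain_eval_linear:
  "chain_eval (\<lambda>x. \<Sum>i\<in>I. a i * \<phi> i x) c = (\<Sum>i\<in>I. a i * chain_eval (\<phi> i) c)"
  unfolding chain_eval_def sum_distrib_left
  by (subst sum.swap) (simp add: algebra_simps)

lemma chain_eval_boundary:
  assumes add: "\<And>x y. x \<in> carrier G \<Longrightarrow> y \<in> carrier G \<Longrightarrow> \<psi> (x \<otimes>\<^bsub>G\<^esub> y) = \<psi> x + \<psi> y"
    and c: "c \<in> bar_boundaries G 1"
  shows "chain_eval \<psi> c = 0"
proof -
  obtain d where d: "d \<in> carrier (bar_chains G 2)" "c = bar_boundary G d"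
    using c by (auto simp: bar_boundaries_def one_add_one simp del: One_nat_def)
  have "chain_eval \<psi> (bar_boundary_symbol G gs) = 0" if "gs \<in> Poly_Mapping.keys d" for gs
  proof -
    obtain g h where gs: "gs = [g, h]" "g \<in> carrier G" "h \<in> carrier G"
      using d(1) \<open>gs \<in> Poly_Mapping.keys d\<close>
      by (auto simp: bar_chains_simps length_Suc_conv numeral_2_eq_2)
    then show ?thesis
      by (simp add: bar_boundary_symbol_two chain_eval_add chain_eval_diff chain_eval_single add)
  qed
  then show ?thesis
    by (simp add: d(2) bar_boundary_def chain_eval_sum chain_eval_scale)
qed

lemma single_cycle:
  assumes "x \<in> carrier G"
  shows "Poly_Mapping.single [x] 1 \<in> bar_cycles G 1"
proof -
  have "Poly_Mapping.single [x] 1 \<in> carrier (bar_chains G 1)"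
    using assms by (simp add: bar_chains_simps)
  then show ?thesis using bar_boundary_one_chain by (auto simp: bar_cycles_def simp del: One_nat_def)
qed

text \<open>If a basis had fewer elements than \<open>I\<close>, some nonzero combination of the
  homomorphisms would vanish on it, hence on the whole space. Evaluating at the classes of the
  symbols \<open>[x]\<close> then contradicts independence.\<close>

lemma card_le_dim_rational_homology_one:
  fixes \<phi> :: "'i \<Rightarrow> 'g \<Rightarrow> rat"
  assumes G: "group G" and fin: "finite I"
    and add: "\<And>i x y. i \<in> I \<Longrightarrow> x \<in> carrier G \<Longrightarrow> y \<in> carrier G \<Longrightarrow>
      \<phi> i (x \<otimes>\<^bsub>G\<^esub> y) = \<phi> i x + \<phi> i y"
    and indep: "\<And>a i. (\<And>x. x \<in> carrier G \<Longrightarrow> (\<Sum>i\<in>I. a i * \<phi> i x) = 0) \<Longrightarrow> i \<in> I \<Longrightarrow> a i = 0"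
  shows "enat (card I) \<le> extended_dim class_ring (rational_homology 1 G)"
proof -
  note [simp del] = One_nat_def
  let ?H = "rational_homology 1 G"
  let ?C = "(bar_chains G 1)\<lparr>carrier := bar_cycles G 1\<rparr>"
  let ?W = "bar_boundaries G 1"
  interpret H: vectorspace class_ring ?H by (rule vectorspace_rational_homology_one[OF G])
  have carrier: "carrier ?H = {?W +>\<^bsub>?C\<^esub> c | c. c \<in> bar_cycles G 1}"
    by (auto simp: rational_homology_def quotient_module_def A_RCOSETS_def')
  have coset: "?W +>\<^bsub>?C\<^esub> c = (\<lambda>w. w + c) ` ?W" for c
    by (auto simp: a_r_coset_def' bar_chains_simps)
  have zero_W: "0 \<in> ?W"
    using submodule.zero_closed[OF submodule_bar_boundaries_one[OF G]] by (simp add: bar_chains_simps)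
  have self: "c \<in> ?W +>\<^bsub>?C\<^esub> c" for c
    unfolding coset using zero_W by force
  show ?thesis
  proof (cases "H.fin_dim")
    case False
    then show ?thesis by (simp add: extended_dim_def)
  next
    case True
    then obtain B where B: "finite B" "H.basis B" using H.finite_basis_exists by blast
    have "card I \<le> card B"
    proof (rule ccontr)
      assume "\<not> card I \<le> card B"
      then have lt: "card B < card I" by simp
      \<comment> \<open>Representatives are fixed before the combination \<open>a\<close> is known;
        \<open>W0\<close> shows afterwards that the choice is immaterial.\<close>
      define r where "r X = (SOME c. c \<in> X)" for X :: "'g chain set"
      obtain a where a: "\<exists>i\<in>I. a i \<noteq> 0" "\<forall>X\<in>B. (\<Sum>i\<in>I. a i * chain_eval (\<phi> i) (r X)) = 0"
        using homogeneous_system_nontrivial_solution[OF B(1) fin lt, of "\<lambda>i X. chain_eval (\<phi> i) (r X)"]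
        by blast
      define \<psi> where "\<psi> x = (\<Sum>i\<in>I. a i * \<phi> i x)" for x
      have \<psi>_add: "\<psi> (x \<otimes>\<^bsub>G\<^esub> y) = \<psi> x + \<psi> y" if "x \<in> carrier G" "y \<in> carrier G" for x y
        using that by (simp add: \<psi>_def add sum.distrib algebra_simps)
      have W0: "chain_eval \<psi> w = 0" if "w \<in> ?W" for w
        using chain_eval_boundary[of G \<psi>, OF \<psi>_add that] by blast
      define Z where "Z = {X \<in> carrier ?H. \<forall>c\<in>X. chain_eval \<psi> c = 0}"
      have Z_iff: "?W +>\<^bsub>?C\<^esub> c \<in> Z \<longleftrightarrow> chain_eval \<psi> c = 0" if "c \<in> bar_cycles G 1" for c
        using that self[of c] by (auto simp: Z_def carrier coset chain_eval_add W0 simp del: One_nat_def)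
      have "submodule class_ring Z ?H"
      proof (rule submodule.intro)
        show "Module.module class_ring ?H" by (rule H.module_axioms)
        show "Z \<subseteq> carrier ?H" by (auto simp: Z_def)
        have "\<forall>c\<in>\<zero>\<^bsub>?H\<^esub>. chain_eval \<psi> c = 0"
          using W0 by (simp add: rational_homology_def quotient_module_def)
        then show "\<zero>\<^bsub>?H\<^esub> \<in> Z" using H.M.zero_closed by (simp add: Z_def)
        fix X Y assume X: "X \<in> Z" and Y: "Y \<in> Z"
        have "\<forall>c\<in>X \<oplus>\<^bsub>?H\<^esub> Y. chain_eval \<psi> c = 0"
          using X Y by (auto simp: rational_homology_def quotient_module_def set_add_def' Z_def
              bar_chains_simps chain_eval_add)
        then show "X \<oplus>\<^bsub>?H\<^esub> Y \<in> Z" using X Y H.M.a_closed by (simp add: Z_def)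
      next
        fix q :: rat and X assume q: "q \<in> carrier class_ring" and X: "X \<in> Z"
        have "\<forall>c\<in>q \<odot>\<^bsub>?H\<^esub> X. chain_eval \<psi> c = 0"
          using X W0 by (auto simp: rational_homology_def quotient_module_def set_add_def' Z_def
              bar_chains_simps chain_eval_add chain_eval_scale)
        then show "q \<odot>\<^bsub>?H\<^esub> X \<in> Z" using X q H.smult_closed by (simp add: Z_def)
      qed
      moreover have "B \<subseteq> Z"
      proof
        fix X assume X: "X \<in> B"
        then obtain c where c: "c \<in> bar_cycles G 1" "X = ?W +>\<^bsub>?C\<^esub> c"
          using B(2) by (auto simp: H.basis_def carrier simp del: One_nat_def)
        have "r X \<in> X" unfolding r_def using self[of c] c(2) by (intro someI[of "\<lambda>c. c \<in> X" c]) simp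
        then obtain w where w: "w \<in> ?W" "r X = w + c" unfolding c(2) coset by blast
        have "chain_eval \<psi> (r X) = 0"
          unfolding \<psi>_def chain_eval_linear using a(2) X by simp
        then have "chain_eval \<psi> c = 0" using w W0 by (simp add: chain_eval_add)
        then show "X \<in> Z" using Z_iff c by simp
      qed
      ultimately have "H.span B \<subseteq> Z" by (intro H.span_is_subset)
      then have all: "carrier ?H \<subseteq> Z" using B(2) unfolding H.basis_def by blast
      have "(\<Sum>i\<in>I. a i * \<phi> i x) = 0" if x: "x \<in> carrier G" for x
      proof -
        have "?W +>\<^bsub>?C\<^esub> Poly_Mapping.single [x] 1 \<in> Z"
          using all single_cycle[OF x] by (auto simp: carrier simp del: One_nat_def)
        then show ?thesis
          using Z_iff[OF single_cycle[OF x]] by (simp add: chain_eval_single \<psi>_def)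
      qed
      with a(1) indep show False by blast
    qed
    then show ?thesis
      using True H.dim_basis[OF B] by (simp add: extended_dim_def)
  qed
qed

section \<open>Braid invariants obtained from actions of the generators\<close>

section \<open>Actions of the braid group\<close>

text \<open>Words act by \<open>foldr\<close>, so the last letter acts first. The set
  \<open>X\<close> is there for the coloured cocycles below, whose maps for distant generators
  commute only over balanced colourings.\<close>

locale braid_action =
  fixes n :: nat and step :: "nat \<times> bool \<Rightarrow> 'x \<Rightarrow> 'x" and X :: "'x set"
  assumes closed: "\<And>x i b. x \<in> X \<Longrightarrow> i \<in> {1..<n} \<Longrightarrow> step (i, b) x \<in> X"
    and cancel: "\<And>x i b. x \<in> X \<Longrightarrow> i \<in> {1..<n} \<Longrightarrow> step (i, b) (step (i, \<not> b) x) = x"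
    and far: "\<And>x i j. x \<in> X \<Longrightarrow> i \<in> {1..<n} \<Longrightarrow> j \<in> {1..<n} \<Longrightarrow> i + 2 \<le> j \<Longrightarrow>
      step (i, True) (step (j, True) x) = step (j, True) (step (i, True) x)"
    and braid: "\<And>x i. x \<in> X \<Longrightarrow> i \<in> {1..<n} \<Longrightarrow> Suc i \<in> {1..<n} \<Longrightarrow>
      step (i, True) (step (Suc i, True) (step (i, True) x)) =
      step (Suc i, True) (step (i, True) (step (Suc i, True) x))"
begin

lemma foldr_closed: "w \<in> braid_words n \<Longrightarrow> x \<in> X \<Longrightarrow> foldr step w x \<in> X"
  by (induction w) (auto simp: braid_words_def closed)

lemma foldr_respects: "braid_eq n u v \<Longrightarrow> x \<in> X \<Longrightarrow> foldr step u x = foldr step v x"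
proof (induction arbitrary: x rule: braid_eq.induct)
  case (append u u' v v')
  then show ?case
    using foldr_closed[of v'] braid_eq_words[OF append.hyps(2)] by simp
next
  case (braid_relation i)
  then show ?case using braid[of x i] by simp
next
  case (far_commute i j)
  then show ?case using far[of x i j] by simp
qed (simp_all add: cancel)

end

definition inv_word :: "braid_word \<Rightarrow> braid_word" where
  "inv_word w = rev (map (\<lambda>(i, b). (i, \<not> b)) w)"

lemma inv_word_closed: "w \<in> braid_words n \<Longrightarrow> inv_word w \<in> braid_words n"
  by (auto simp: inv_word_def braid_words_def in_lists_conv_set)

lemma braid_words_append: "u @ v \<in> braid_words n \<longleftrightarrow> u \<in> braid_words n \<and> v \<in> braid_words n"
  by (auto simp: braid_words_def)

lemma braid_words_Nil: "[] \<in> braid_words n"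
  by (simp add: braid_words_def)

lemma (in braid_action) foldr_inv_word:
  assumes "w \<in> braid_words n" "x \<in> X"
  shows "foldr step (inv_word w) (foldr step w x) = x"
  using foldr_respects[OF braid_eq_inverse_word[OF assms(1)] assms(2)] by (simp add: inv_word_def)

section \<open>The kernel described by an action on integer tuples\<close>

section \<open>The integral Burau representation on words\<close>

text \<open>The Burau block \<open>(1 - t, t; 1, 0)\<close> at \<open>t = -1\<close> and its
  inverse, acting on columns whose coordinates are numbered from 1.\<close>

fun vstep :: "nat \<times> bool \<Rightarrow> (nat \<Rightarrow> 'a :: comm_ring_1) \<Rightarrow> nat \<Rightarrow> 'a" where
  "vstep (s, True) x = x(s := 2 * x s - x (Suc s), Suc s := x s)"
| "vstep (s, False) x = x(s := x (Suc s), Suc s := 2 * x (Suc s) - x s)"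

lemma braid_action_vstep: "braid_action n vstep UNIV"
proof
  show "vstep (i, b) (vstep (i, \<not> b) x) = x" for i b and x :: "nat \<Rightarrow> 'a"
    by (cases b) (auto simp: fun_eq_iff)
qed (auto simp: fun_eq_iff algebra_simps)

abbreviation vrun :: "braid_word \<Rightarrow> (nat \<Rightarrow> 'a :: comm_ring_1) \<Rightarrow> nat \<Rightarrow> 'a" where
  "vrun \<equiv> foldr vstep"

lemma vstep_outside: "i \<in> {1..<n} \<Longrightarrow> m \<notin> {1..n} \<Longrightarrow> vstep (i, b) x m = x m"
  by (cases b) auto

lemma vrun_outside: "w \<in> braid_words n \<Longrightarrow> m \<notin> {1..n} \<Longrightarrow> vrun w x m = x m"
proof (induction w)
  case (Cons l w)
  obtain i b where "l = (i, b)" by (cases l)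
  with Cons show ?case by (simp add: braid_words_Cons vstep_outside[of i n m b])
qed simp

definition vecn :: "nat \<Rightarrow> (nat \<Rightarrow> int) \<Rightarrow> int vec" where
  "vecn n x = vec n (\<lambda>k. x (Suc k))"

lemma two_block_mult_vecn:
  assumes i: "i \<in> {1..<n}"
  shows "two_block n i a b c d *\<^sub>v vecn n x =
    vecn n (x(i := a * x i + b * x (Suc i), Suc i := c * x i + d * x (Suc i)))"
proof -
  obtain j where j: "i = Suc j" using i by (cases i) auto
  have lt: "j < n" "Suc j < n" using i by (simp_all add: j)
  let ?y = "x(i := a * x i + b * x (Suc i), Suc i := c * x i + d * x (Suc i))"
  have "(two_block n i a b c d *\<^sub>v vecn n x) $ r = vecn n ?y $ r" if r: "r < n" for r
  proof -
    let ?f = "\<lambda>k. two_block n i a b c d $$ (r, k) * x (Suc k)"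
    have "(two_block n i a b c d *\<^sub>v vecn n x) $ r = (\<Sum>k\<in>{0..<n}. ?f k)"
      using r two_block_carrier[of n i a b c d] by (auto simp: scalar_prod_def vecn_def)
    also have "\<dots> = (\<Sum>k\<in>(if r = j \<or> r = Suc j then {j, Suc j} else {r}). ?f k)"
      using lt r by (intro sum.mono_neutral_right) (auto simp: j two_block_Suc_index split: if_splits)
    also have "\<dots> = vecn n ?y $ r"
      using lt r by (simp add: j two_block_Suc_index vecn_def)
    finally show ?thesis .
  qed
  then show ?thesis by (intro eq_vecI) (simp_all add: two_block_def vecn_def)
qed

lemma map_mat_two_block:
  assumes "f 0 = 0" "f 1 = 1"
  shows "map_mat f (two_block n i a b c d) = two_block n i (f a) (f b) (f c) (f d)"
  by (rule eq_matI) (auto simp: two_block_def assms)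

lemma eval_burau_letter_vecn:
  assumes i: "i \<in> {1..<n}"
  shows "map_mat laurent_eval_neg1 (burau_letter n (i, b)) *\<^sub>v vecn n x = vecn n (vstep (i, b) x)"
proof -
  interpret comm_ring_hom laurent_eval_neg1 by (rule laurent_eval_neg1_ring_hom)
  have t: "laurent_eval_neg1 laurent_t = -1" by (simp add: laurent_t_def laurent_eval_neg1_single)
  let ?A = "burau_generator n i"
  have A: "?A \<in> carrier (GL n)" by (rule burau_generator_GL[OF i])
  have pos: "map_mat laurent_eval_neg1 ?A *\<^sub>v vecn n x = vecn n (vstep (i, True) x)" for x
    by (simp add: burau_generator_def map_mat_two_block two_block_mult_vecn[OF i] hom_minus t)
  show ?thesis
  proof (cases b)
    case True
    then show ?thesis using pos by (simp add: burau_letter_def)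
  next
    case False
    let ?B = "inv\<^bsub>GL n\<^esub> ?A"
    have B: "?B \<in> carrier (GL n)" by (rule group.inv_closed[OF group_GL A])
    have car: "map_mat laurent_eval_neg1 ?A \<in> carrier_mat n n" "map_mat laurent_eval_neg1 ?B \<in> carrier_mat n n"
      using GL_carrierD[OF A] GL_carrierD[OF B] by simp_all
    have "?B * ?A = 1\<^sub>m n"
      using group.l_inv[OF group_GL A] by (simp add: GL_simps)
    then have BA: "map_mat laurent_eval_neg1 ?B * map_mat laurent_eval_neg1 ?A = 1\<^sub>m n"
      using mat_hom_mult[OF GL_carrierD[OF B] GL_carrierD[OF A]] by (simp add: mat_hom_one)
    define y where "y = vstep (i, False) x"
    have y: "vstep (i, True) y = x"
      unfolding y_def by (auto simp: fun_eq_iff)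
    have vy: "vecn n y \<in> carrier_vec n" by (simp add: vecn_def)
    have "map_mat laurent_eval_neg1 ?B *\<^sub>v vecn n x =
        map_mat laurent_eval_neg1 ?B *\<^sub>v (map_mat laurent_eval_neg1 ?A *\<^sub>v vecn n y)"
      by (simp only: pos y)
    also have "\<dots> = vecn n y"
      using assoc_mult_mat_vec[OF car(2,1) vy] BA vy by simp
    finally show ?thesis using False by (simp add: burau_letter_def y_def)
  qed
qed

lemma eval_burau_word_vecn:
  "w \<in> braid_words n \<Longrightarrow> map_mat laurent_eval_neg1 (burau_word n w) *\<^sub>v vecn n x = vecn n (vrun w x)"
proof (induction w)
  case Nil
  interpret comm_ring_hom laurent_eval_neg1 by (rule laurent_eval_neg1_ring_hom)
  show ?case by (simp add: burau_word_simps GL_simps mat_hom_one vecn_def)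
next
  case (Cons l w)
  interpret comm_ring_hom laurent_eval_neg1 by (rule laurent_eval_neg1_ring_hom)
  obtain i b where l: "l = (i, b)" by (cases l)
  have i: "i \<in> {1..<n}" and w: "w \<in> braid_words n"
    using Cons.prems by (auto simp: l braid_words_Cons)
  have c: "burau_letter n l \<in> carrier_mat n n" "burau_word n w \<in> carrier_mat n n"
    using burau_letter_GL[OF i] burau_word_GL[OF w] by (simp_all add: l GL_carrierD)
  have "map_mat laurent_eval_neg1 (burau_word n (l # w)) *\<^sub>v vecn n x =
      map_mat laurent_eval_neg1 (burau_letter n l) *\<^sub>v
      (map_mat laurent_eval_neg1 (burau_word n w) *\<^sub>v vecn n x)"
    using c by (simp add: burau_word_simps GL_simps mat_hom_mult[OF c] vecn_def)
  then show ?case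
    using Cons.IH[OF w] eval_burau_letter_vecn[OF i, of b] by (simp add: l)
qed

text \<open>Testing functions on all positions agrees with the matrix condition, since positions
  outside \<open>{1..n}\<close> never change.\<close>

definition torelli_words :: "nat \<Rightarrow> braid_word set" where
  "torelli_words n = {w \<in> braid_words n. \<forall>x :: nat \<Rightarrow> int. vrun w x = x}"

lemma integral_burau_eq_one_iff:
  assumes w: "w \<in> braid_words n"
  shows "integral_burau n (braid_rel n `` {w}) = \<one>\<^bsub>GL n\<^esub> \<longleftrightarrow> w \<in> torelli_words n"
proof -
  let ?M = "map_mat laurent_eval_neg1 (burau_word n w)"
  have M: "?M \<in> carrier_mat n n" using burau_word_GL[OF w] by (simp add: GL_carrierD)
  have ib: "integral_burau n (braid_rel n `` {w}) = ?M"
    by (simp add: integral_burau_def burau_class[OF w])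
  have "?M = 1\<^sub>m n \<longleftrightarrow> (\<forall>x :: nat \<Rightarrow> int. vrun w x = x)"
  proof
    assume 1: "?M = 1\<^sub>m n"
    show "\<forall>x :: nat \<Rightarrow> int. vrun w x = x"
    proof (intro allI ext)
      fix x :: "nat \<Rightarrow> int" and m
      have *: "vecn n x = vecn n (vrun w x)"
        using eval_burau_word_vecn[OF w, of x] 1 by (simp add: vecn_def)
      show "vrun w x m = x m"
      proof (cases "m \<in> {1..n}")
        case True
        then have "m - 1 < n" "Suc (m - 1) = m" by auto
        then show ?thesis using arg_cong[OF *, of "\<lambda>v. v $ (m - 1)"] by (simp add: vecn_def)
      next
        case False
        then show ?thesis by (rule vrun_outside[OF w])
      qed
    qed
  next
    assume x: "\<forall>x :: nat \<Rightarrow> int. vrun w x = x"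
    show "?M = 1\<^sub>m n"
    proof (rule eq_matI)
      fix i j assume "i < dim_row (1\<^sub>m n :: int mat)" "j < dim_col (1\<^sub>m n :: int mat)"
      then have ij: "i < n" "j < n" by simp_all
      let ?x = "\<lambda>k. if k = Suc j then 1 else 0 :: int"
      have v: "vecn n ?x = unit_vec n j" by (auto simp: vecn_def unit_vec_def)
      have "?M *\<^sub>v unit_vec n j = unit_vec n j"
        using eval_burau_word_vecn[OF w, of ?x] x by (simp add: v)
      then have "(?M *\<^sub>v unit_vec n j) $ i = unit_vec n j $ i" by simp
      then show "?M $$ (i, j) = 1\<^sub>m n $$ (i, j)"
        using M ij by (simp add: scalar_prod_right_unit[OF ij(2)] index_one_mat)
    qed (use M in simp_all)
  qed
  then show ?thesis using w by (simp add: ib GL_simps torelli_words_def)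
qed

lemma carrier_braid_torelli:
  "carrier (braid_torelli n) = {braid_rel n `` {w} | w. w \<in> torelli_words n}"
proof -
  have "X \<in> carrier (braid_torelli n) \<longleftrightarrow> (\<exists>w\<in>torelli_words n. X = braid_rel n `` {w})" for X
  proof
    assume "X \<in> carrier (braid_torelli n)"
    then have X: "X \<in> carrier (braid_group n)" "integral_burau n X = \<one>\<^bsub>GL n\<^esub>"
      by (auto simp: braid_torelli_def kernel_def)
    obtain w where w: "w \<in> braid_words n" "X = braid_rel n `` {w}"
      using X(1) by (rule braid_group_cases)
    then show "\<exists>w\<in>torelli_words n. X = braid_rel n `` {w}"
      using X(2) integral_burau_eq_one_iff by blast
  next
    assume "\<exists>w\<in>torelli_words n. X = braid_rel n `` {w}"
    then obtain w where w: "w \<in> torelli_words n" "X = braid_rel n `` {w}" by blast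
    then have "w \<in> braid_words n" by (simp add: torelli_words_def)
    then show "X \<in> carrier (braid_torelli n)"
      using w integral_burau_eq_one_iff[of w n]
      by (simp add: braid_torelli_def kernel_def braid_class_carrier)
  qed
  then show ?thesis by auto
qed


text \<open>Invariance is asked for all braids but additivity only on Torelli words, because the
  invariants to come are merely crossed homomorphisms elsewhere.\<close>

lemma card_le_dim_homology_braid_torelli:
  fixes \<phi> :: "'i \<Rightarrow> braid_word \<Rightarrow> rat"
  assumes fin: "finite I"
    and resp: "\<And>i u v. i \<in> I \<Longrightarrow> braid_eq n u v \<Longrightarrow> \<phi> i u = \<phi> i v"
    and add: "\<And>i u v. i \<in> I \<Longrightarrow> u \<in> torelli_words n \<Longrightarrow> v \<in> torelli_words n \<Longrightarrow>
      \<phi> i (u @ v) = \<phi> i u + \<phi> i v"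
    and indep: "\<And>a i. (\<And>w. w \<in> torelli_words n \<Longrightarrow> (\<Sum>i\<in>I. a i * \<phi> i w) = 0) \<Longrightarrow> i \<in> I \<Longrightarrow> a i = 0"
  shows "enat (card I) \<le> extended_dim class_ring (rational_homology 1 (braid_torelli n))"
proof -
  define \<Phi> where "\<Phi> i X = \<phi> i (SOME w. w \<in> X)" for i and X :: "braid_word set"
  have \<Phi>: "\<Phi> i (braid_rel n `` {w}) = \<phi> i w" if "i \<in> I" "w \<in> braid_words n" for i w
  proof -
    have "w \<in> braid_rel n `` {w}" using that by (simp add: braid_rel_def braid_eq.refl)
    then have "(SOME v. v \<in> braid_rel n `` {w}) \<in> braid_rel n `` {w}" by (rule someI)
    then have "braid_eq n w (SOME v. v \<in> braid_rel n `` {w})" by (simp add: braid_rel_def)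
    then show ?thesis using resp[OF that(1)] by (simp add: \<Phi>_def)
  qed
  have T: "w \<in> braid_words n" if "w \<in> torelli_words n" for w
    using that by (simp add: torelli_words_def)
  show ?thesis
  proof (rule card_le_dim_rational_homology_one[OF group_braid_torelli fin, of n \<Phi>])
    fix i X Y assume i: "i \<in> I" and "X \<in> carrier (braid_torelli n)" "Y \<in> carrier (braid_torelli n)"
    then obtain u v where u: "u \<in> torelli_words n" "X = braid_rel n `` {u}"
      and v: "v \<in> torelli_words n" "Y = braid_rel n `` {v}"
      by (auto simp: carrier_braid_torelli)
    have "X \<otimes>\<^bsub>braid_torelli n\<^esub> Y = braid_rel n `` {u @ v}"
      using braid_mult_class[OF T[OF u(1)] T[OF v(1)]] by (simp add: braid_torelli_def u v)
    then show "\<Phi> i (X \<otimes>\<^bsub>braid_torelli n\<^esub> Y) = \<Phi> i X + \<Phi> i Y"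
      using \<Phi>[OF i] T u v add[OF i u(1) v(1)] by (simp add: braid_words_append)
  next
    fix a i
    assume *: "\<And>X. X \<in> carrier (braid_torelli n) \<Longrightarrow> (\<Sum>i\<in>I. a i * \<Phi> i X) = 0" and i: "i \<in> I"
    have "(\<Sum>i\<in>I. a i * \<phi> i w) = 0" if w: "w \<in> torelli_words n" for w
    proof -
      have "(\<Sum>i\<in>I. a i * \<Phi> i (braid_rel n `` {w})) = 0"
        using * w by (auto simp: carrier_braid_torelli)
      then show ?thesis using \<Phi> T[OF w] by simp
    qed
    then show "a i = 0" using i by (rule indep)
  qed
qed

section \<open>Crossed homomorphisms to the integers and their values on conjugates\<close>

section \<open>Affine cocycles\<close>

primrec twist_sgn :: "('l \<Rightarrow> 'q \<Rightarrow> 'q) \<Rightarrow> ('l \<Rightarrow> 'q \<Rightarrow> int) \<Rightarrow> 'l list \<Rightarrow> 'q \<Rightarrow> int" where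
  "twist_sgn base sg [] q = 1"
| "twist_sgn base sg (l # w) q = sg l (foldr base w q) * twist_sgn base sg w q"

primrec twist_val :: "('l \<Rightarrow> 'q \<Rightarrow> 'q) \<Rightarrow> ('l \<Rightarrow> 'q \<Rightarrow> int) \<Rightarrow> ('l \<Rightarrow> 'q \<Rightarrow> int) \<Rightarrow> 'l list \<Rightarrow> 'q \<Rightarrow> int" where
  "twist_val base sg tr [] q = 0"
| "twist_val base sg tr (l # w) q =
    sg l (foldr base w q) * twist_val base sg tr w q + tr l (foldr base w q)"

definition twist_step :: "('l \<Rightarrow> 'q \<Rightarrow> 'q) \<Rightarrow> ('l \<Rightarrow> 'q \<Rightarrow> int) \<Rightarrow> ('l \<Rightarrow> 'q \<Rightarrow> int) \<Rightarrow>
    'l \<Rightarrow> 'q \<times> int \<Rightarrow> 'q \<times> int" where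
  "twist_step base sg tr l = (\<lambda>(q, y). (base l q, sg l q * y + tr l q))"

lemma foldr_twist_step:
  "foldr (twist_step base sg tr) w (q, y) =
    (foldr base w q, twist_sgn base sg w q * y + twist_val base sg tr w q)"
  by (induction w) (simp_all add: twist_step_def algebra_simps)

lemma twist_sgn_append:
  "twist_sgn base sg (u @ v) q = twist_sgn base sg u (foldr base v q) * twist_sgn base sg v q"
  by (induction u) simp_all

lemma twist_val_append:
  "twist_val base sg tr (u @ v) q =
    twist_sgn base sg u (foldr base v q) * twist_val base sg tr v q + twist_val base sg tr u (foldr base v q)"
  by (induction u) (simp_all add: algebra_simps)

text \<open>A crossed homomorphism is encoded by the affine maps
  \<open>y \<mapsto> sg l q * y + tr l q\<close> over a base action. Checking the braid relations
  for these maps makes linear part and translation part invariants of braids at once.\<close>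

locale affine_cocycle =
  fixes n :: nat and base :: "nat \<times> bool \<Rightarrow> 'q \<Rightarrow> 'q" and sg tr :: "nat \<times> bool \<Rightarrow> 'q \<Rightarrow> int"
    and Q :: "'q set"
  assumes action: "braid_action n (twist_step base sg tr) (Q \<times> UNIV)"
    and sg_unit: "\<And>l q. sg l q = 1 \<or> sg l q = -1"
begin

sublocale braid_action n "twist_step base sg tr" "Q \<times> UNIV"
  by (rule action)

abbreviation "sgn_of \<equiv> twist_sgn base sg"
abbreviation "val_of \<equiv> twist_val base sg tr"

lemma sgn_of_unit: "sgn_of w q = 1 \<or> sgn_of w q = -1"
proof (induction w)
  case (Cons l w)
  then show ?case using sg_unit[of l "foldr base w q"] by (elim disjE) simp_all
qed simp

lemma base_closed: "w \<in> braid_words n \<Longrightarrow> q \<in> Q \<Longrightarrow> foldr base w q \<in> Q"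
  using foldr_closed[of w "(q, 0)"] by (simp add: foldr_twist_step)

lemma val_of_respects: "braid_eq n u v \<Longrightarrow> q \<in> Q \<Longrightarrow> val_of u q = val_of v q"
  using foldr_respects[of u v "(q, 0)"] by (simp add: foldr_twist_step)

text \<open>At the state reached by \<open>g\<close>, the word \<open>w\<close> is a pure
  translation. Conjugation carries it back through the linear part of \<open>g\<close>, and the
  translation part of \<open>g\<close> cancels.\<close>

lemma val_of_conj:
  assumes g: "g \<in> braid_words n" and q: "q \<in> Q"
    and w: "foldr base w (foldr base g q) = foldr base g q" "sgn_of w (foldr base g q) = 1"
  shows "val_of (inv_word g @ w @ g) q = sgn_of g q * val_of w (foldr base g q)"
proof -
  let ?y = "sgn_of g q * val_of w (foldr base g q)"
  have "sgn_of g q * ?y = val_of w (foldr base g q)"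
    using sgn_of_unit[of g q] by auto
  then have "foldr (twist_step base sg tr) (w @ g) (q, 0) = foldr (twist_step base sg tr) g (q, ?y)"
    by (simp add: foldr_twist_step w)
  then have "foldr (twist_step base sg tr) (inv_word g @ w @ g) (q, 0) = (q, ?y)"
    using foldr_inv_word[OF g, of "(q, ?y)"] q by simp
  then show ?thesis by (simp only: foldr_twist_step) simp
qed

lemma sgn_of_conj:
  assumes g: "g \<in> braid_words n" and q: "q \<in> Q"
    and w: "foldr base w (foldr base g q) = foldr base g q"
  shows "sgn_of (inv_word g @ w @ g) q = sgn_of w (foldr base g q)"
proof -
  have "foldr (twist_step base sg tr) (inv_word g @ g) (q, y) = (q, y)" for y
    using foldr_inv_word[OF g, of "(q, y)"] q by simp
  then have "sgn_of (inv_word g @ g) q * y + val_of (inv_word g @ g) q = y" for y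
    by (simp only: foldr_twist_step prod.inject)
  from this[of 0] this[of 1] have "sgn_of (inv_word g @ g) q = 1" by simp
  then have "sgn_of (inv_word g) (foldr base g q) * sgn_of g q = 1"
    by (simp add: twist_sgn_append)
  then show ?thesis by (simp add: twist_sgn_append w)
qed

end

section \<open>Linking numbers and the permutation action modulo 2\<close>

section \<open>Permutations and crossing numbers\<close>

fun pstep :: "nat \<times> bool \<Rightarrow> (nat \<Rightarrow> 'a) \<Rightarrow> nat \<Rightarrow> 'a" where
  "pstep (s, b) x = x(s := x (Suc s), Suc s := x s)"

abbreviation prun :: "braid_word \<Rightarrow> (nat \<Rightarrow> 'a) \<Rightarrow> nat \<Rightarrow> 'a" where
  "prun \<equiv> foldr pstep"

lemma pstep_comp: "pstep l (\<lambda>m. f (x m)) = (\<lambda>m. f (pstep l x m))"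
  by (cases l) auto

lemma prun_comp: "prun w (\<lambda>m. f (x m)) = (\<lambda>m. f (prun w x m))"
  by (induction w) (simp_all add: pstep_comp)

lemma odd_vrun: "odd (vrun w x m) \<longleftrightarrow> prun w (\<lambda>m. odd (x m)) m" for x :: "nat \<Rightarrow> int"
proof (induction w arbitrary: m)
  case (Cons l w)
  obtain s b where l: "l = (s, b)" by (cases l)
  show ?case by (cases b) (simp_all add: l Cons)
qed simp

text \<open>Modulo 2 each \<open>vstep\<close> only exchanges two coordinates. Applying this to the
  indicator function of one label recovers the permutation of arbitrary labels.\<close>

lemma prun_torelli:
  assumes "w \<in> torelli_words n"
  shows "prun w x = x"
proof
  fix m
  have "prun w (\<lambda>k. x k = x m) m \<longleftrightarrow> odd (vrun w (\<lambda>k. if x k = x m then 1 else 0 :: int) m)"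
    by (simp add: odd_vrun if_distrib cong: if_cong)
  also have "\<dots>" using assms by (simp add: torelli_words_def)
  finally show "prun w x m = x m" by (simp add: prun_comp[of w "\<lambda>v. v = x m" x])
qed

lemma prun_inv_word: "prun (inv_word w) (prun w x) = x"
  by (induction w arbitrary: x) (auto simp: inv_word_def fun_eq_iff)

text \<open>Signed crossings of marked strands: for two marked strands of a pure braid, twice their
  linking number.\<close>

definition cross_val :: "nat \<times> bool \<Rightarrow> (nat \<Rightarrow> bool) \<Rightarrow> int" where
  "cross_val = (\<lambda>(s, b) c. if c s \<and> c (Suc s) then if b then 1 else -1 else 0)"

lemma affine_cocycle_cross: "affine_cocycle n pstep (\<lambda>_ _. 1) cross_val UNIV"
proof
  show "twist_step pstep (\<lambda>_ _. 1) cross_val (i, b)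
      (twist_step pstep (\<lambda>_ _. 1) cross_val (i, \<not> b) x) = x" for i b x
    by (cases x; cases b) (auto simp: fun_eq_iff twist_step_def cross_val_def)
qed (auto simp: fun_eq_iff twist_step_def cross_val_def)

section \<open>Dihedral translation lengths and characters of order two\<close>

section \<open>Two-coloured crossing cocycles\<close>

datatype colour = Blank | Red | Blue

text \<open>Among four coloured strands, an odd value singles out a crossing of the two middle ones,
  the generator that \<open>B_4 \<rightarrow> B_3\<close> does not identify with another.\<close>

primrec parity :: "(nat \<Rightarrow> colour) \<Rightarrow> nat \<Rightarrow> bool" where
  "parity c 0 = False"
| "parity c (Suc s) = (parity c s \<noteq> (c s \<noteq> Blank))"

lemma parity_cong: "(\<And>m. m < s \<Longrightarrow> c m = c' m) \<Longrightarrow> parity c s = parity c' s"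
  by (induction s) auto

lemma parity_upd [simp]: "s \<le> m \<Longrightarrow> parity (c(m := v)) s = parity c s"
  by (rule parity_cong) auto

lemma parity_odd: "parity c s \<longleftrightarrow> odd (card {m. m < s \<and> c m \<noteq> Blank})"
proof (induction s)
  case (Suc s)
  have "{m. m < Suc s \<and> c m \<noteq> Blank} =
    (if c s \<noteq> Blank then insert s {m. m < s \<and> c m \<noteq> Blank} else {m. m < s \<and> c m \<noteq> Blank})"
    by (auto simp: less_Suc_eq)
  then show ?case using Suc by simp
qed simp

lemma parity_pstep: "Suc s < t \<Longrightarrow> parity (pstep (s, b) c) t = parity c t"
proof (induction t)
  case (Suc t)
  show ?case
  proof (cases "t = Suc s")
    case True
    have "parity (pstep (s, b) c) s = parity c s" by (rule parity_cong) simp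
    moreover have "pstep (s, b) c s = c (Suc s)" "pstep (s, b) c (Suc s) = c s" by simp_all
    ultimately show ?thesis using True by (auto simp del: pstep.simps)
  qed (use Suc in auto)
qed simp

text \<open>
  Forgetting all but four strands and using \<open>PB\<^sub>4 \<rightarrow> PB\<^sub>3 \<rightarrow> F\<^sub>2\<close>, each splitting of the four strands
  into two pairs (here: red and blue) gives a homomorphism to the infinite dihedral group in which a
  full twist of two strands of the same colour is a translation and a full twist of two strands of
  different colours is a reflection. The constants below extend it from pure braids to all braids.
\<close>

definition col_sgn :: "nat \<times> bool \<Rightarrow> (nat \<Rightarrow> colour) \<Rightarrow> int" where
  "col_sgn = (\<lambda>(s, b) c. if if b then c s = Red \<and> c (Suc s) = Blue else c s = Blue \<and> c (Suc s) = Red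
    then -1 else 1)"

definition col_val :: "nat \<times> bool \<Rightarrow> (nat \<Rightarrow> colour) \<Rightarrow> int" where
  "col_val = (\<lambda>(s, b) c.
    if c s \<noteq> Blank \<and> c (Suc s) = c s then (if b then 1 else -1)
    else if parity c s then
      (if b then (if c s = Blue \<and> c (Suc s) = Red then -2 else 0)
       else (if c s = Red \<and> c (Suc s) = Blue then 2 else 0))
    else 0)"

definition balanced :: "(nat \<Rightarrow> colour) set" where
  "balanced = {c. card {m. c m = Red} = 2 \<and> card {m. c m = Blue} = 2}"

lemma balanced_not_three:
  assumes "c \<in> balanced" "x \<noteq> Blank" "p \<noteq> q" "p \<noteq> r" "q \<noteq> r" "c p = x" "c q = x"
  shows "c r \<noteq> x"
proof
  assume "c r = x"
  have c: "card {m. c m = x} = 2"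
    using assms(1,2) by (cases x) (auto simp: balanced_def)
  then have "finite {m. c m = x}" by (intro card_ge_0_finite) simp
  then have "card {p, q, r} \<le> card {m. c m = x}"
    using assms \<open>c r = x\<close> by (intro card_mono) auto
  then show False using assms c by simp
qed

lemma balanced_pstep: "c \<in> balanced \<Longrightarrow> pstep (s, b) c \<in> balanced"
proof -
  have eq: "{m. pstep (s, b) c m = x} = Transposition.transpose s (Suc s) -` {m. c m = x}" for x
    by (auto simp: transpose_def)
  have "card {m. pstep (s, b) c m = x} = card {m. c m = x}" for x
    unfolding eq by (rule card_vimage_inj) (auto simp: inj_transpose)
  then show "c \<in> balanced \<Longrightarrow> pstep (s, b) c \<in> balanced" by (simp add: balanced_def)
qed

lemma balanced_parity:
  assumes c: "c \<in> balanced" and ij: "i + 2 \<le> j"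
    and col: "c i \<noteq> Blank" "c (Suc i) \<noteq> Blank" "c j \<noteq> Blank" "c (Suc j) \<noteq> Blank"
  shows "\<not> parity c i" "\<not> parity c j"
proof -
  let ?S = "{m. c m \<noteq> Blank}"
  have "x \<noteq> Blank \<longleftrightarrow> x = Red \<or> x = Blue" for x by (cases x) simp_all
  then have S: "?S = {m. c m = Red} \<union> {m. c m = Blue}" by auto
  have "finite {m. c m = x}" if "card {m. c m = x} = 2" for x
    by (rule card_ge_0_finite) (simp add: that)
  then have "finite {m. c m = Red}" "finite {m. c m = Blue}"
    using c by (simp_all add: balanced_def)
  then have fin: "finite ?S" and "card ?S = card {m. c m = Red} + card {m. c m = Blue}"
    unfolding S by (simp, subst card_Un_disjoint, auto)
  then have "card ?S = 4" using c by (simp add: balanced_def)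
  moreover have "card {i, Suc i, j, Suc j} = 4" using ij by simp
  moreover have "{i, Suc i, j, Suc j} \<subseteq> ?S" using col by simp
  ultimately have "{i, Suc i, j, Suc j} = ?S" using fin by (intro card_subset_eq) simp_all
  then have mem: "c m \<noteq> Blank \<longleftrightarrow> m \<in> {i, Suc i, j, Suc j}" for m by blast
  have e: "{m. m < i \<and> c m \<noteq> Blank} = {}" "{m. m < j \<and> c m \<noteq> Blank} = {i, Suc i}"
    using ij by (auto simp only: mem)
  show "\<not> parity c i" unfolding parity_odd e(1) by simp
  show "\<not> parity c j" unfolding parity_odd e(2) by simp
qed

lemma affine_cocycle_col: "affine_cocycle n pstep col_sgn col_val balanced"
proof
  let ?f = "twist_step pstep col_sgn col_val"
  note defs = twist_step_def col_sgn_def col_val_def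
  show "?f (i, b) (?f (i, \<not> b) x) = x" for i b x
  proof -
    obtain c y where x: "x = (c, y)" by (cases x)
    show ?thesis
      unfolding x by (cases b; cases "c i"; cases "c (Suc i)") (simp_all add: fun_eq_iff defs)
  qed
  show "?f (i, b) x \<in> balanced \<times> UNIV" if "x \<in> balanced \<times> UNIV" for i b x
    using that balanced_pstep[of "fst x" i b] by (cases x) (simp add: twist_step_def)
  show "col_sgn l q = 1 \<or> col_sgn l q = -1" for l q
    by (simp add: col_sgn_def split: prod.split)
  show "?f (i, True) (?f (Suc i, True) (?f (i, True) x)) =
    ?f (Suc i, True) (?f (i, True) (?f (Suc i, True) x))" for i x
  proof -
    obtain c y where x: "x = (c, y)" by (cases x)
    show ?thesis
      unfolding x by (cases "c i"; cases "c (Suc i)"; cases "c (Suc (Suc i))"; cases "parity c i")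
        (simp_all add: fun_eq_iff defs)
  qed
  show "?f (i, True) (?f (j, True) x) = ?f (j, True) (?f (i, True) x)"
    if x: "x \<in> balanced \<times> UNIV" and ij: "i + 2 \<le> j" for i j x
  proof -
    obtain c y where xc: "x = (c, y)" by (cases x)
    have c: "c \<in> balanced" using x xc by simp
    define ci where "ci = pstep (i, True) c"
    define cj where "cj = pstep (j, True) c"
    have p: "parity ci j = parity c j" "parity cj i = parity c i"
      unfolding ci_def cj_def using ij by (simp_all add: parity_pstep del: pstep.simps) simp
    have v: "ci j = c j" "ci (Suc j) = c (Suc j)" "cj i = c i" "cj (Suc i) = c (Suc i)"
      using ij by (simp_all add: ci_def cj_def)
    have comm: "pstep (i, True) cj = pstep (j, True) ci"
      using ij by (auto simp: fun_eq_iff ci_def cj_def)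
    have sg: "col_sgn (i, True) cj = col_sgn (i, True) c" "col_sgn (j, True) ci = col_sgn (j, True) c"
      by (simp_all add: col_sgn_def v)
    have tr: "col_val (i, True) cj = col_val (i, True) c" "col_val (j, True) ci = col_val (j, True) c"
      by (simp_all add: col_val_def v p)
    let ?s = "\<lambda>k. col_sgn (k, True) c" and ?t = "\<lambda>k. col_val (k, True) c"
    \<comment> \<open>Commutation of two affine maps. A blank makes one of them the identity.
      Otherwise balance makes both pairs unicoloured, so both maps are translations, or both mixed,
      where even parity leaves no translation part.\<close>
    have "?s i * ?t j + ?t i = ?s j * ?t i + ?t j"
    proof (cases "c i = Blank \<or> c (Suc i) = Blank \<or> c j = Blank \<or> c (Suc j) = Blank")
      case True
      then show ?thesis by (auto simp: col_sgn_def col_val_def)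
    next
      case False
      note b3 = balanced_not_three[OF c]
      have par: "\<not> parity c i" "\<not> parity c j" using balanced_parity[OF c ij] False by auto
      have ne: "i \<noteq> Suc i" "i \<noteq> j" "i \<noteq> Suc j" "Suc i \<noteq> j" "Suc i \<noteq> Suc j" "j \<noteq> Suc j" using ij by auto
      have "\<not> (c i = c (Suc i) \<and> (c j = c i \<or> c (Suc j) = c i))"
        "\<not> (c j = c (Suc j) \<and> (c i = c j \<or> c (Suc i) = c j))"
        using b3[of "c i" i "Suc i" j] b3[of "c i" i "Suc i" "Suc j"]
          b3[of "c j" j "Suc j" i] b3[of "c j" j "Suc j" "Suc i"] False ne by metis+
      then show ?thesis
        using False par
        by (cases "c i"; cases "c (Suc i)"; cases "c j"; cases "c (Suc j)")
          (simp_all add: col_sgn_def col_val_def)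
    qed
    then show ?thesis
      by (simp add: xc twist_step_def comm sg tr algebra_simps del: pstep.simps flip: ci_def cj_def)
  qed
qed

lemma sum_two_positions:
  fixes h :: "nat \<Rightarrow> 'a :: comm_monoid_add"
  assumes "finite S" "s \<in> S" "Suc s \<in> S"
  shows "sum h S = h s + h (Suc s) + sum h (S - {s, Suc s})"
proof -
  have "S = insert s (insert (Suc s) (S - {s, Suc s}))" using assms by auto
  then have "sum h S = sum h (insert s (insert (Suc s) (S - {s, Suc s})))" by simp
  then show ?thesis using assms(1) by (simp add: add.assoc)
qed

text \<open>
  Starting from the indicator of the red strands, a blue strand changes by \<open>2\<close> modulo \<open>4\<close> exactly
  when it passes under a red one. Hence the matrix modulo \<open>4\<close> determines the sign.
\<close>

lemma blue_sum_step:
  fixes x :: "nat \<Rightarrow> int"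
  assumes odd: "\<And>m. odd (x m) \<longleftrightarrow> c m = Red" and s: "s < M"
  shows "4 dvd (\<Sum>m\<le>M. if pstep (s, b) c m = Blue then vstep (s, b) x m else 0)
    - ((\<Sum>m\<le>M. if c m = Blue then x m else 0) + (1 - col_sgn (s, b) c))"
proof -
  let ?R = "{..M} - {s, Suc s}"
  let ?h = "\<lambda>m. if pstep (s, b) c m = Blue then vstep (s, b) x m else 0"
  let ?k = "\<lambda>m. if c m = Blue then x m else 0"
  have rest: "sum ?h ?R = sum ?k ?R"
    by (rule sum.cong) (cases b; auto)+
  have two: "sum ?h {..M} = ?h s + ?h (Suc s) + sum ?h ?R" "sum ?k {..M} = ?k s + ?k (Suc s) + sum ?k ?R"
    using s by (intro sum_two_positions; simp)+
  have "4 dvd ?h s + ?h (Suc s) - (?k s + ?k (Suc s) + (1 - col_sgn (s, b) c))"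
    using odd[of s] odd[of "Suc s"]
    by (cases b; cases "c s"; cases "c (Suc s)") (auto simp: col_sgn_def elim!: evenE oddE)
  then show ?thesis unfolding two rest by (simp add: algebra_simps)
qed

lemma blue_sum_run:
  fixes x :: "nat \<Rightarrow> int"
  assumes odd: "\<And>m. odd (x m) \<longleftrightarrow> c m = Red" and w: "w \<in> braid_words n"
  shows "4 dvd (\<Sum>m\<le>n. if prun w c m = Blue then vrun w x m else 0)
    - ((\<Sum>m\<le>n. if c m = Blue then x m else 0) + (1 - twist_sgn pstep col_sgn w c))"
  using w
proof (induction w)
  case (Cons l w)
  obtain s b where l: "l = (s, b)" by (cases l)
  have w: "w \<in> braid_words n" and s: "s < n" using Cons.prems by (auto simp: l braid_words_Cons)
  interpret affine_cocycle n pstep col_sgn col_val balanced by (rule affine_cocycle_col)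
  have odd': "odd (vrun w x m) \<longleftrightarrow> prun w c m = Red" for m
    using prun_comp[of w "\<lambda>v. v = Red" c] by (simp add: odd_vrun odd)
  let ?e = "col_sgn l (prun w c)" and ?f = "twist_sgn pstep col_sgn w c"
  \<comment> \<open>The number equals \<open>(1 - ?e) * (1 - ?f)\<close>, which is 0 or 4; so modulo
    4 a product of signs turns into a sum.\<close>
  have "4 dvd (1 - ?e) + (1 - ?f) - (1 - ?e * ?f)"
    using sg_unit[of l "prun w c"] sgn_of_unit[of w c] by (elim disjE) simp_all
  moreover have "4 dvd X - (Y + e) \<Longrightarrow> 4 dvd Y - (Z + f) \<Longrightarrow> 4 dvd e + f - g \<Longrightarrow> 4 dvd X - (Z + g)"
    for X Y Z e f g :: int
    by presburger
  ultimately show ?case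
    using blue_sum_step[of "vrun w x" "prun w c", OF odd' s, of b] Cons.IH[OF w]
    unfolding l foldr_Cons o_apply twist_sgn.simps by blast
qed (simp cong: if_cong)

text \<open>Neither the vector nor the colouring changes, so the blue sum stays put and 4 divides
  \<open>1 - sign\<close>, which is 0 or 2.\<close>

lemma col_sgn_torelli:
  assumes "w \<in> torelli_words n"
  shows "twist_sgn pstep col_sgn w c = 1"
proof -
  interpret affine_cocycle n pstep col_sgn col_val balanced by (rule affine_cocycle_col)
  have w: "w \<in> braid_words n" "vrun w x = x" for x :: "nat \<Rightarrow> int"
    using assms by (simp_all add: torelli_words_def)
  have "4 dvd - (1 - twist_sgn pstep col_sgn w c)"
    using blue_sum_run[of "\<lambda>m. if c m = Red then 1 else 0" c w n] w(1)
    by (simp add: w(2) prun_torelli[OF assms])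
  then show ?thesis using sgn_of_unit[of w c] by auto
qed

section \<open>Components of the second Johnson homomorphism\<close>

section \<open>The quartic cocycle\<close>

text \<open>
  Let the braid group act by \<open>(x, y) \<mapsto> (x y x, x)\<close> on tuples of involutions. Writing them as
  \<open>(p + \<surd>(1 + p\<^sup>2)) \<iota>\<close> with noncommuting \<open>p\<close> and \<open>\<iota> p = - p \<iota>\<close>, the linear part of the induced action on
  the \<open>p\<close>'s is \<open>vstep\<close>, and with \<open>d = a - b\<close> the cubic correction is \<open>(a d\<^sup>2 + d\<^sup>2 a) / 2\<close>. In
  \<open>quad_inc\<close> this cubic is evaluated on three covectors and paired with a vector \<open>m\<close> that transforms
  contragrediently, by \<open>mstep\<close>; the resulting homomorphism is a component of the second Johnson
  homomorphism of the hyperelliptic Torelli group.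
\<close>

fun mstep :: "nat \<times> bool \<Rightarrow> (nat \<Rightarrow> int) \<Rightarrow> nat \<Rightarrow> int" where
  "mstep (s, True) m = m(s := - m (Suc s), Suc s := m s + 2 * m (Suc s))"
| "mstep (s, False) m = m(s := m (Suc s) + 2 * m s, Suc s := - m s)"

type_synonym quad = "(nat \<Rightarrow> int) \<times> (nat \<Rightarrow> int) \<times> (nat \<Rightarrow> int) \<times> (nat \<Rightarrow> int)"

definition quad_step :: "nat \<times> bool \<Rightarrow> quad \<Rightarrow> quad" where
  "quad_step l = (\<lambda>(a, b, c, m). (vstep l a, vstep l b, vstep l c, mstep l m))"

definition quad_inc :: "nat \<Rightarrow> quad \<Rightarrow> int" where
  "quad_inc s = (\<lambda>(a, b, c, m). m (Suc s) * (b s - b (Suc s)) *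
    (a s * (c s - c (Suc s)) + (a s - a (Suc s)) * c s))"

text \<open>An inverse letter is charged at the state it leads to, as cancellation with the positive
  letter demands.\<close>

definition quad_val :: "nat \<times> bool \<Rightarrow> quad \<Rightarrow> int" where
  "quad_val = (\<lambda>(s, b) q. if b then - quad_inc s q else quad_inc s (quad_step (s, False) q))"

lemma affine_cocycle_quad: "affine_cocycle n quad_step (\<lambda>_ _. 1) quad_val UNIV"
proof
  let ?f = "twist_step quad_step (\<lambda>_ _. 1) quad_val"
  note defs = twist_step_def quad_step_def quad_val_def quad_inc_def
  show "?f (i, b) (?f (i, \<not> b) x) = x" for i b x
  proof -
    obtain p q r m y where x: "x = ((p, q, r, m), y)" by (cases x) auto
    show ?thesis unfolding x by (cases b) (simp_all add: defs fun_eq_iff)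
  qed
  show "?f (i, True) (?f (j, True) x) = ?f (j, True) (?f (i, True) x)" if "i + 2 \<le> j" for i j x
  proof -
    obtain p q r m y where x: "x = ((p, q, r, m), y)" by (cases x) auto
    show ?thesis unfolding x using that by (simp add: defs fun_eq_iff)
  qed
  show "?f (i, True) (?f (Suc i, True) (?f (i, True) x)) =
    ?f (Suc i, True) (?f (i, True) (?f (Suc i, True) x))" for i x
  proof -
    obtain p q r m y where x: "x = ((p, q, r, m), y)" by (cases x) auto
    show ?thesis unfolding x by (simp add: defs fun_eq_iff algebra_simps)
  qed
qed simp_all

lemma quad_run: "foldr quad_step w (a, b, c, m) = (vrun w a, vrun w b, vrun w c, foldr mstep w m)"
  by (induction w) (simp_all add: quad_step_def)

lemma mrun_pairing:
  assumes "w \<in> braid_words n"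
  shows "(\<Sum>k\<in>{1..n}. foldr mstep w m k * vrun w x k) = (\<Sum>k\<in>{1..n}. m k * x k)"
  using assms
proof (induction w)
  case (Cons l w)
  obtain s b where l: "l = (s, b)" by (cases l)
  have w: "w \<in> braid_words n" and s: "s \<in> {1..n}" "Suc s \<in> {1..n}"
    using Cons.prems by (auto simp: l braid_words_Cons)
  define m' where "m' = foldr mstep w m"
  define x' where "x' = vrun w x"
  let ?R = "{1..n} - {s, Suc s}"
  have "(\<Sum>k\<in>?R. mstep (s, b) m' k * vstep (s, b) x' k) = (\<Sum>k\<in>?R. m' k * x' k)"
    by (rule sum.cong) (cases b; auto)+
  then have "(\<Sum>k\<in>{1..n}. mstep (s, b) m' k * vstep (s, b) x' k) = (\<Sum>k\<in>{1..n}. m' k * x' k)"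
    using s by (subst (1 2) sum_two_positions[of _ s]) (cases b; simp add: algebra_simps)+
  then show ?case using Cons.IH[OF w] by (simp add: l m'_def x'_def)
qed simp

lemma mrun_outside: "w \<in> braid_words n \<Longrightarrow> k \<notin> {1..n} \<Longrightarrow> foldr mstep w m k = m k"
proof (induction w)
  case (Cons l w)
  obtain i b where "l = (i, b)" by (cases l)
  with Cons show ?case by (cases b) (auto simp: braid_words_Cons)
qed simp

lemma mrun_torelli:
  assumes "w \<in> torelli_words n"
  shows "foldr mstep w m = m"
proof
  fix k
  have w: "w \<in> braid_words n" "vrun w x = x" for x :: "nat \<Rightarrow> int"
    using assms by (simp_all add: torelli_words_def)
  show "foldr mstep w m k = m k"
  proof (cases "k \<in> {1..n}")
    case True
    then show ?thesis
      using mrun_pairing[OF w(1), of m "\<lambda>j. if j = k then 1 else 0"]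
      by (simp add: w(2) if_distrib sum.delta cong: if_cong)
  qed (simp add: mrun_outside[OF w(1)])
qed

text \<open>A duality between \<open>m\<close> and covectors that every letter respects. The value
  on the twist sees \<open>m\<close> only through such neighbouring sums, so the fourth slot can be
  read as a covector like the other three.\<close>

lemma mrun_sum:
  assumes "\<And>k. m k + m (Suc k) = x k - x (Suc k)"
  shows "foldr mstep w m k + foldr mstep w m (Suc k) = vrun w x k - vrun w x (Suc k)"
proof (induction w arbitrary: k)
  case (Cons l w)
  obtain s b where l: "l = (s, b)" by (cases l)
  define m' where "m' = foldr mstep w m"
  define x' where "x' = vrun w x"
  have IH: "m' k + m' (Suc k) = x' k - x' (Suc k)" for k
    using Cons by (simp add: m'_def x'_def)
  have "mstep (s, b) m' k + mstep (s, b) m' (Suc k) = vstep (s, b) x' k - vstep (s, b) x' (Suc k)"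
    using IH[of k] IH[of s] IH[of "Suc s"]
    by (cases b; cases "k = s"; cases "k = Suc s"; cases "Suc k = s") auto
  then show ?case by (simp add: l m'_def x'_def)
qed (simp add: assms)

section \<open>Values of all cocycles on the squared Dehn twist\<close>

section \<open>A genus one twist\<close>

definition rot3 :: "nat \<Rightarrow> braid_word" where
  "rot3 s = [(s, True), (Suc s, True), (s, True), (Suc s, True), (s, True), (Suc s, True)]"

definition twist3 :: "nat \<Rightarrow> braid_word" where
  "twist3 s = rot3 s @ rot3 s"

text \<open>The full twist fixes the alternating sum of the three coordinates and negates their
  differences, so its square acts trivially.\<close>

lemma vrun_rot3: "vrun (rot3 s) x =
  x(s := 2 * (x s - x (Suc s) + x (Suc (Suc s))) - x s,
    Suc s := 2 * (x s - x (Suc s) + x (Suc (Suc s))) - x (Suc s),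
    Suc (Suc s) := 2 * (x s - x (Suc s) + x (Suc (Suc s))) - x (Suc (Suc s)))"
  by (auto simp: rot3_def fun_eq_iff algebra_simps)

lemma vrun_twist3: "vrun (twist3 s) x = x"
  by (auto simp: twist3_def vrun_rot3 fun_eq_iff algebra_simps)

lemma twist3_torelli: "s \<ge> 1 \<Longrightarrow> Suc s < n \<Longrightarrow> twist3 s \<in> torelli_words n"
  unfolding torelli_words_def mem_Collect_eq vrun_twist3
  by (simp add: twist3_def rot3_def braid_words_Cons braid_words_Nil)

text \<open>Expressed by base coordinates and consecutive differences (sums for \<open>m\<close>),
  because the state after \<open>rot3 s\<close> has the same shape and the formula can be applied a
  second time.\<close>

lemma quad_val_rot3:
  fixes a b c m :: "nat \<Rightarrow> int"
  assumes "a (Suc s) = a s - p" "a (Suc (Suc s)) = a s - p - p'"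
    and "b (Suc s) = b s - q" "b (Suc (Suc s)) = b s - q - q'"
    and "c (Suc s) = c s - r" "c (Suc (Suc s)) = c s - r - r'"
    and "m (Suc s) = u - m s" "m (Suc (Suc s)) = u' - u + m s"
  shows "twist_val quad_step (\<lambda>_ _. 1) quad_val (rot3 s) (a, b, c, m) =
    (-1) * a s * q * r * u' + (1) * a s * q * r' * u + (1) * a s * q * r' * u' + (1) * a s * q' * r * u + (1) * a s * q' * r * u' + (-1) * a s * q' * r' * u + (-1) * p * q * c s * u' + (1) * p * q' * c s * u + (1) * p * q' * c s * u' + (2) * p * q' * r * m s + (4) * p * q' * r * u' + (-2) * p * q' * r' * u + (-1) * p * q' * r' * u' + (1) * p' * q * c s * u + (1) * p' * q * c s * u' + (-2) * p' * q * r' * m s + (-4) * p' * q * r' * u' + (-1) * p' * q' * c s * u + (-2) * p' * q' * r * u + (-1) * p' * q' * r * u' + (2) * p' * q' * r' * u"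
  unfolding rot3_def
  by (simp add: quad_val_def quad_inc_def quad_step_def assms) (simp add: algebra_simps)


lemma mrun_rot3: "foldr mstep (rot3 s) m =
  m(s := 2 * (m s + m (Suc s) + m (Suc (Suc s))) - m s,
    Suc s := - 2 * (m s + m (Suc s) + m (Suc (Suc s))) - m (Suc s),
    Suc (Suc s) := 2 * (m s + m (Suc s) + m (Suc (Suc s))) - m (Suc (Suc s)))"
  by (auto simp: rot3_def fun_eq_iff algebra_simps)

lemma twist_sgn_one: "twist_sgn base (\<lambda>_ _. 1) w q = 1"
  by (induction w) simp_all

text \<open>For the second full twist all differences and sums have changed sign, while base
  coordinates are only shifted by twice one of them. Each term is quartic with at most one base
  coordinate, so the base coordinates themselves cancel.\<close>

lemma quad_val_twist3:
  fixes a b c m :: "nat \<Rightarrow> int" and s :: nat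
  defines "\<alpha> \<equiv> \<lambda>x. x s - x (Suc s) :: int" and "\<beta> \<equiv> \<lambda>x. x (Suc s) - x (Suc (Suc s)) :: int"
    and "\<mu> \<equiv> m s + m (Suc s)" and "\<nu> \<equiv> m (Suc s) + m (Suc (Suc s))"
  shows "twist_val quad_step (\<lambda>_ _. 1) quad_val (twist3 s) (a, b, c, m) =
    - 2 * ((\<alpha> a * \<beta> b - \<beta> a * \<alpha> b) * (\<mu> * \<beta> c - \<nu> * \<alpha> c)
         + (\<alpha> c * \<beta> b - \<beta> c * \<alpha> b) * (\<mu> * \<beta> a - \<nu> * \<alpha> a))"
proof -
  have x: "x (Suc s) = x s - \<alpha> x" "x (Suc (Suc s)) = x s - \<alpha> x - \<beta> x" for x
    by (simp_all add: \<alpha>_def \<beta>_def)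
  have m: "m (Suc s) = \<mu> - m s" "m (Suc (Suc s)) = \<nu> - \<mu> + m s"
    by (simp_all add: \<mu>_def \<nu>_def)
  let ?v = "vrun (rot3 s)" and ?m = "foldr mstep (rot3 s) m"
  have v: "?v x s = x s - 2 * \<beta> x" "?v x (Suc s) = ?v x s - (- \<alpha> x)"
    "?v x (Suc (Suc s)) = ?v x s - (- \<alpha> x) - (- \<beta> x)" for x :: "nat \<Rightarrow> int"
    by (simp_all add: vrun_rot3 \<alpha>_def \<beta>_def)
  have vm: "?m s = m s + 2 * \<nu>" "?m (Suc s) = (- \<mu>) - ?m s" "?m (Suc (Suc s)) = (- \<nu>) - (- \<mu>) + ?m s"
    by (simp_all add: mrun_rot3 \<mu>_def \<nu>_def)
  show ?thesis
    unfolding twist3_def twist_val_append quad_run twist_sgn_one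
      quad_val_rot3[where a = a and b = b and c = c, OF x x x m]
      quad_val_rot3[where a = "?v a" and b = "?v b" and c = "?v c", OF v(2,3) v(2,3) v(2,3) vm(2,3)] v(1) vm(1)
    by (simp add: algebra_simps)
qed

lemma prun_twist3: "prun (twist3 s) c = c"
  by (auto simp: twist3_def rot3_def fun_eq_iff)

lemma cross_val_twist3:
  "twist_val pstep (\<lambda>_ _. 1) cross_val (twist3 s) c =
    4 * (of_bool (c s \<and> c (Suc s)) + of_bool (c s \<and> c (Suc (Suc s))) + of_bool (c (Suc s) \<and> c (Suc (Suc s))))"
  unfolding twist3_def rot3_def
  by (cases "c s"; cases "c (Suc s)"; cases "c (Suc (Suc s))") (simp_all add: cross_val_def)

definition twin :: "colour \<Rightarrow> colour \<Rightarrow> colour \<Rightarrow> bool" where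
  "twin x y z \<longleftrightarrow> x = y \<and> x \<noteq> Blank \<and> z = Blank \<or> x = z \<and> x \<noteq> Blank \<and> y = Blank \<or>
    y = z \<and> y \<noteq> Blank \<and> x = Blank"

text \<open>Two full twists of a unicoloured pair translate by \<open>2 + 2\<close>; those of a
  mixed pair are a reflection applied twice. With three coloured strands the full twist is central
  in \<open>PB_3\<close> and dies in \<open>F_2\<close>.\<close>

lemma col_val_twist3:
  assumes "\<not> parity c s" "c \<in> balanced"
  shows "twist_val pstep col_sgn col_val (twist3 s) c =
    (if twin (c s) (c (Suc s)) (c (Suc (Suc s))) then 4 else 0)"
proof -
  have not3: "\<not> (c s = x \<and> c (Suc s) = x \<and> c (Suc (Suc s)) = x)" if "x \<noteq> Blank" for x
    using balanced_not_three[OF assms(2) that, of s "Suc s" "Suc (Suc s)"] by auto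
  show ?thesis
    using assms(1) not3[of Red] not3[of Blue] unfolding twist3_def rot3_def
    by (cases "c s"; cases "c (Suc s)"; cases "c (Suc (Suc s))")
      (simp_all add: col_sgn_def col_val_def twin_def)
qed

section \<open>Braids carrying prescribed strands to the first positions\<close>

section \<open>Words that gather strands\<close>

text \<open>Inverse letters are used because \<open>vstep (s, False)\<close> copies the coordinate
  at \<open>Suc s\<close> to \<open>s\<close> unaltered; only coordinates passed on the way
  change.\<close>

definition pull :: "nat \<Rightarrow> nat \<Rightarrow> braid_word" where
  "pull lo hi = map (\<lambda>s. (s, False)) [lo..<hi]"

lemma pull_closed: "1 \<le> lo \<Longrightarrow> hi \<le> n \<Longrightarrow> pull lo hi \<in> braid_words n"
  by (auto simp: pull_def braid_words_def)

lemma pull_rec: "lo < hi \<Longrightarrow> pull lo hi = (lo, False) # pull (Suc lo) hi"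
  by (simp add: pull_def upt_conv_Cons)

lemma vrun_pull:
  assumes "lo \<le> hi"
  shows "vrun (pull lo hi) x lo = x hi" "m < lo \<or> hi < m \<Longrightarrow> vrun (pull lo hi) x m = x m"
proof -
  have "vrun (pull lo hi) x lo = x hi \<and> (\<forall>m. m < lo \<or> hi < m \<longrightarrow> vrun (pull lo hi) x m = x m)"
    using assms
  proof (induction lo rule: inc_induct)
    case base
    then show ?case by (simp add: pull_def)
  next
    case (step lo)
    then show ?case by (auto simp: pull_rec)
  qed
  then show "vrun (pull lo hi) x lo = x hi" "m < lo \<or> hi < m \<Longrightarrow> vrun (pull lo hi) x m = x m"
    by blast+
qed

lemma prun_pull:
  assumes "lo \<le> hi"
  shows "prun (pull lo hi) c m = c (if m = lo then hi else if lo < m \<and> m \<le> hi then m - 1 else m)"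
  using assms
proof (induction lo arbitrary: m rule: inc_induct)
  case base
  then show ?case by (simp add: pull_def)
next
  case (step lo)
  then show ?case by (auto simp: pull_rec)
qed

definition sort4 :: "nat \<Rightarrow> nat \<Rightarrow> nat \<Rightarrow> nat \<Rightarrow> braid_word" where
  "sort4 i j k l = pull 4 l @ pull 3 k @ pull 2 j @ pull 1 i"

lemma vrun_sort4:
  assumes "1 \<le> i" "i < j" "j < k" "k < l"
  shows "vrun (sort4 i j k l) x 1 = x i" "vrun (sort4 i j k l) x 2 = x j"
    "vrun (sort4 i j k l) x 3 = x k" "vrun (sort4 i j k l) x 4 = x l"
  using assms by (simp_all add: sort4_def vrun_pull del: One_nat_def)

lemma sort4_closed:
  assumes "1 \<le> i" "i < j" "j < k" "k < l" "l \<le> n"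
  shows "sort4 i j k l \<in> braid_words n"
  using assms by (simp add: sort4_def braid_words_append pull_closed)

lemma gather_three:
  assumes xyz: "x \<in> {1..n}" "y \<in> {1..n}" "z \<in> {1..n}" "x \<noteq> y" "x \<noteq> z" "y \<noteq> z"
  obtains g where "g \<in> braid_words n"
    "\<And>c :: nat \<Rightarrow> 'a. prun g c 1 = c x" "\<And>c :: nat \<Rightarrow> 'a. prun g c 2 = c y"
    "\<And>c :: nat \<Rightarrow> 'a. prun g c 3 = c z"
proof -
  \<comment> \<open>Pulling a strand forward shifts those it passes up by one; \<open>y'\<close> and
    \<open>z''\<close> are the places where \<open>y\<close> and \<open>z\<close> are found when
    their turn comes.\<close>
  define y' where "y' = (if y < x then Suc y else y)"
  define z' where "z' = (if z < x then Suc z else z)"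
  define z'' where "z'' = (if z' < y' then Suc z' else z')"
  have le: "1 \<le> x" "2 \<le> y'" "3 \<le> z''" "x \<le> n" "y' \<le> n" "z'' \<le> n"
    using xyz by (auto simp: y'_def z''_def z'_def)
  define g where "g = pull 3 z'' @ pull 2 y' @ pull 1 x"
  have "g \<in> braid_words n"
    using le by (simp add: g_def braid_words_append pull_closed)
  moreover have "prun g c 1 = c x" for c :: "nat \<Rightarrow> 'a"
    using le by (simp add: g_def prun_pull del: One_nat_def)
  moreover have "prun g c 2 = c y" for c :: "nat \<Rightarrow> 'a"
    using le xyz by (auto simp: g_def prun_pull y'_def simp del: One_nat_def)
  moreover have "prun g c 3 = c z" for c :: "nat \<Rightarrow> 'a"
    using le xyz by (auto simp: g_def prun_pull y'_def z'_def z''_def simp del: One_nat_def split: if_splits)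
  ultimately show thesis by (rule that)
qed

section \<open>Evaluation of the three families on conjugates of the twist\<close>

section \<open>The three families of homomorphisms\<close>

definition mark_pair :: "nat \<times> nat \<Rightarrow> nat \<Rightarrow> bool" where
  "mark_pair = (\<lambda>(i, j) m. m = i \<or> m = j)"

definition colouring :: "nat \<times> nat \<times> nat \<times> nat \<Rightarrow> nat \<Rightarrow> colour" where
  "colouring = (\<lambda>(a, c, b, d) m. if m = a \<or> m = c then Red else if m = b \<or> m = d then Blue else Blank)"

definition unit_at :: "nat \<Rightarrow> nat \<Rightarrow> int" where
  "unit_at x m = of_bool (m = x)"

text \<open>Solves \<open>m\<^sub>k + m\<^sub>k\<^sub>+\<^sub>1 = x\<^sub>k - x\<^sub>k\<^sub>+\<^sub>1\<close> for the unit covector \<open>x\<close> at \<open>t\<close>, see \<open>mrun_sum\<close>.\<close>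

definition dual_unit :: "nat \<Rightarrow> nat \<Rightarrow> int" where
  "dual_unit t m = (if m < t then 0 else if m = t then -1 else 2 * (-1) ^ (m - Suc t))"

definition quad_at :: "nat \<times> nat \<times> nat \<times> nat \<Rightarrow> quad" where
  "quad_at = (\<lambda>(x, y, z, t). (unit_at x, unit_at y, unit_at z, dual_unit t))"

lemma dual_unit_sum: "dual_unit t m + dual_unit t (Suc m) = unit_at t m - unit_at t (Suc m)"
  by (cases m t rule: linorder_cases)
    (auto simp: dual_unit_def unit_at_def not_less Suc_diff_le Suc_le_eq dest!: less_imp_Suc_add)

definition link_hom :: "nat \<times> nat \<Rightarrow> braid_word \<Rightarrow> int" where
  "link_hom i w = twist_val pstep (\<lambda>_ _. 1) cross_val w (mark_pair i)"

definition dihedral_hom :: "nat \<times> nat \<times> nat \<times> nat \<Rightarrow> braid_word \<Rightarrow> int" where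
  "dihedral_hom i w = twist_val pstep col_sgn col_val w (colouring i)"

definition johnson_hom :: "nat \<times> nat \<times> nat \<times> nat \<Rightarrow> braid_word \<Rightarrow> int" where
  "johnson_hom i w = twist_val quad_step (\<lambda>_ _. 1) quad_val w (quad_at i)"

definition distinct4 :: "nat \<times> nat \<times> nat \<times> nat \<Rightarrow> bool" where
  "distinct4 = (\<lambda>(a, c, b, d). distinct [a, c, b, d])"

lemma colouring_balanced: "distinct4 i \<Longrightarrow> colouring i \<in> balanced"
proof -
  obtain a c b d where i: "i = (a, c, b, d)" by (cases i)
  assume "distinct4 i"
  then have "{m. colouring i m = Red} = {a, c}" "{m. colouring i m = Blue} = {b, d}" "a \<noteq> c" "b \<noteq> d"
    by (auto simp: i distinct4_def colouring_def)
  then show "colouring i \<in> balanced" by (simp add: balanced_def)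
qed

lemma quad_run_torelli: "w \<in> torelli_words n \<Longrightarrow> foldr quad_step w q = q"
  by (cases q) (simp add: quad_run mrun_torelli, simp add: torelli_words_def)

lemma link_hom_add:
  "v \<in> torelli_words n \<Longrightarrow> link_hom i (u @ v) = link_hom i u + link_hom i v"
  by (simp add: link_hom_def twist_val_append twist_sgn_one prun_torelli)

lemma dihedral_hom_add:
  "u \<in> torelli_words n \<Longrightarrow> v \<in> torelli_words n \<Longrightarrow>
    dihedral_hom i (u @ v) = dihedral_hom i u + dihedral_hom i v"
  by (simp add: dihedral_hom_def twist_val_append col_sgn_torelli prun_torelli)

lemma johnson_hom_add:
  "v \<in> torelli_words n \<Longrightarrow> johnson_hom i (u @ v) = johnson_hom i u + johnson_hom i v"
  by (simp add: johnson_hom_def twist_val_append twist_sgn_one quad_run_torelli)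

lemma link_hom_respects: "braid_eq n u v \<Longrightarrow> link_hom i u = link_hom i v"
  unfolding link_hom_def by (rule affine_cocycle.val_of_respects[OF affine_cocycle_cross]) auto

lemma dihedral_hom_respects: "distinct4 i \<Longrightarrow> braid_eq n u v \<Longrightarrow> dihedral_hom i u = dihedral_hom i v"
  unfolding dihedral_hom_def
  by (rule affine_cocycle.val_of_respects[OF affine_cocycle_col]) (auto intro: colouring_balanced)

lemma johnson_hom_respects: "braid_eq n u v \<Longrightarrow> johnson_hom i u = johnson_hom i v"
  unfolding johnson_hom_def by (rule affine_cocycle.val_of_respects[OF affine_cocycle_quad]) auto

definition conj_twist :: "braid_word \<Rightarrow> braid_word" where
  "conj_twist g = inv_word g @ twist3 1 @ g"

lemma conj_twist_torelli:
  assumes g: "g \<in> braid_words n" and n: "3 \<le> n"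
  shows "conj_twist g \<in> torelli_words n"
proof -
  interpret braid_action n "vstep :: _ \<Rightarrow> (nat \<Rightarrow> int) \<Rightarrow> _" UNIV by (rule braid_action_vstep)
  have t: "twist3 1 \<in> torelli_words n" using n by (intro twist3_torelli) simp_all
  then show ?thesis
    using g inv_word_closed[OF g] foldr_inv_word[OF g]
    by (simp add: torelli_words_def conj_twist_def braid_words_append vrun_twist3)
qed

lemma link_hom_conj_twist:
  assumes g: "g \<in> braid_words n"
  defines "c \<equiv> prun g"
  shows "link_hom i (conj_twist g) = 4 * (of_bool (c (mark_pair i) 1 \<and> c (mark_pair i) 2)
    + of_bool (c (mark_pair i) 1 \<and> c (mark_pair i) 3) + of_bool (c (mark_pair i) 2 \<and> c (mark_pair i) 3))"
proof -
  interpret affine_cocycle n pstep "\<lambda>_ _. 1" cross_val UNIV by (rule affine_cocycle_cross)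
  show ?thesis
    using val_of_conj[OF g, of "mark_pair i" "twist3 1"]
    by (simp add: link_hom_def conj_twist_def prun_twist3 twist_sgn_one cross_val_twist3 c_def
        numeral_2_eq_2 numeral_3_eq_3)
qed

lemma dihedral_hom_conj_twist:
  assumes g: "g \<in> braid_words n" and i: "distinct4 i" "colouring i 0 = Blank" and n: "3 \<le> n"
  defines "c \<equiv> prun g (colouring i)"
  shows "dihedral_hom i (conj_twist g) =
    twist_sgn pstep col_sgn g (colouring i) * (if twin (c 1) (c 2) (c 3) then 4 else 0)"
proof -
  interpret affine_cocycle n pstep col_sgn col_val balanced by (rule affine_cocycle_col)
  have b: "colouring i \<in> balanced" by (rule colouring_balanced[OF i(1)])
  have c: "c \<in> balanced" unfolding c_def by (rule base_closed[OF g b])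
  \<comment> \<open>Position 0 is untouched by braid words and blank, so no coloured strand precedes
    position 1.\<close>
  have "prun g x 0 = x 0" for x :: "nat \<Rightarrow> colour"
    using g by (induction g) (auto simp: braid_words_Cons)
  then have "\<not> parity c 1" by (simp add: c_def i)
  moreover have "twist_sgn pstep col_sgn (twist3 1) c = 1"
    using n by (intro col_sgn_torelli[OF twist3_torelli, of 1 n]) simp_all
  ultimately show ?thesis
    using val_of_conj[OF g b, of "twist3 1"] col_val_twist3[of c 1] c
    by (simp add: dihedral_hom_def conj_twist_def prun_twist3 c_def numeral_2_eq_2 numeral_3_eq_3)
qed

definition minor :: "(nat \<Rightarrow> int) \<Rightarrow> (nat \<Rightarrow> int) \<Rightarrow> nat \<Rightarrow> nat \<Rightarrow> int" where
  "minor \<alpha> \<beta> x y = \<alpha> x * \<beta> y - \<beta> x * \<alpha> y"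

text \<open>Quadratic in the Pluecker coordinates of the plane of \<alpha> and \<beta>; such
  expressions have the symmetries of curvature tensors.\<close>

definition curvature :: "(nat \<Rightarrow> int) \<Rightarrow> (nat \<Rightarrow> int) \<Rightarrow> nat \<times> nat \<times> nat \<times> nat \<Rightarrow> int" where
  "curvature \<alpha> \<beta> = (\<lambda>(x, y, z, t). minor \<alpha> \<beta> x y * minor \<alpha> \<beta> t z + minor \<alpha> \<beta> z y * minor \<alpha> \<beta> t x)"

text \<open>A difference of neighbouring rows of the matrix of \<open>g\<close>. Constant tuples are
  fixed by the action, so for a braid word on \<open>n\<close> strands and
  \<open>1 \<le> s < n\<close> its entries over \<open>{1..n}\<close> sum to zero.\<close>

definition edge :: "braid_word \<Rightarrow> nat \<Rightarrow> nat \<Rightarrow> int" where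
  "edge g s x = vrun g (unit_at x) s - vrun g (unit_at x) (Suc s)"

lemma johnson_hom_conj_twist:
  assumes g: "g \<in> braid_words n"
  shows "johnson_hom i (conj_twist g) = - 2 * curvature (edge g 1) (edge g 2) i"
proof -
  interpret affine_cocycle n quad_step "\<lambda>_ _. 1" quad_val UNIV by (rule affine_cocycle_quad)
  obtain x y z t where i: "i = (x, y, z, t)" by (cases i)
  have fix3: "foldr quad_step (twist3 1) q = q" for q
    using quad_run_torelli[OF twist3_torelli, of 1 3 q] by simp
  note sum = mrun_sum[of "dual_unit t" "unit_at t" g, OF dual_unit_sum]
  have "johnson_hom i (conj_twist g) = val_of (twist3 1) (foldr quad_step g (quad_at i))"
    unfolding johnson_hom_def conj_twist_def val_of_conj[OF g UNIV_I fix3 twist_sgn_one]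
    by (simp add: twist_sgn_one)
  then show ?thesis
    using sum[of "Suc 0"] sum[of "Suc (Suc 0)"]
    by (simp add: i quad_at_def quad_run quad_val_twist3 curvature_def minor_def edge_def numeral_2_eq_2 mult.commute)
qed

section \<open>A quadratic form on planes that vanishes on split planes\<close>

section \<open>Independence of the curvature family\<close>

text \<open>Curvature components up to symmetry and Bianchi identity: three for each set of three
  indices, two for each set of four.\<close>

definition johnson_index :: "nat \<Rightarrow> (nat \<times> nat \<times> nat \<times> nat) set" where
  "johnson_index N = {(x, y, u, t).
    u = x \<and> y < t \<and> x \<noteq> y \<and> x \<noteq> t \<and> {x, y, t} \<subseteq> {1..N} \<or>
    1 \<le> x \<and> x < u \<and> u < y \<and> y < t \<and> t \<le> N \<or>
    1 \<le> x \<and> x < y \<and> y < t \<and> t < u \<and> u \<le> N}"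

lemma johnson_index_cases:
  assumes "(x, y, u, t) \<in> johnson_index N"
  obtains (triple) "u = x" "y < t" "x \<noteq> y" "x \<noteq> t" "{x, y, t} \<subseteq> {1..N}"
    | (quad1) "1 \<le> x" "x < u" "u < y" "y < t" "t \<le> N"
    | (quad2) "1 \<le> x" "x < y" "y < t" "t < u" "u \<le> N"
  using assms unfolding johnson_index_def mem_Collect_eq prod.case by (elim disjE conjE) (erule that; assumption)+

lemma finite_johnson_index: "finite (johnson_index N)"
  by (rule finite_subset[of _ "{1..N} \<times> {1..N} \<times> {1..N} \<times> {1..N}"]) (auto simp: johnson_index_def)

lemma curvature_expand:
  "curvature \<alpha> (\<lambda>x. \<beta> x + k * \<delta> x) i =
    curvature \<alpha> \<beta> i + k * (curvature \<alpha> (\<lambda>x. \<beta> x + \<delta> x) i - curvature \<alpha> \<beta> i - curvature \<alpha> \<delta> i)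
    + k\<^sup>2 * curvature \<alpha> \<delta> i"
proof -
  obtain x y z t where i: "i = (x, y, z, t)" by (cases i)
  have minor: "minor \<alpha> (\<lambda>x. \<beta> x + k * \<delta> x) p q = minor \<alpha> \<beta> p q + k * minor \<alpha> \<delta> p q" for k p q
    by (simp add: minor_def algebra_simps)
  show ?thesis
    using minor[of 1] by (simp add: i curvature_def minor) (simp add: algebra_simps power2_eq_square)
qed

text \<open>The third generator leaves \<open>x 3 - x 4\<close> invariant, so its powers act as a
  shear along that difference.\<close>

lemma sigma_power_edge:
  "edge (replicate k (3, True) @ g) 1 = edge g 1"
  "edge (replicate k (3, True) @ g) 2 = (\<lambda>x. edge g 2 x + (- int k) * edge g 3 x)"
  "edge (replicate k (3, True) @ g) 3 = edge g 3"
proof -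
  have "vrun (replicate k (3, True)) x = x(3 := x 3 + int k * (x 3 - x 4), 4 := x 4 + int k * (x 3 - x 4))"
    for x :: "nat \<Rightarrow> int"
    by (induction k) (auto simp: fun_eq_iff algebra_simps)
  then show "edge (replicate k (3, True) @ g) 1 = edge g 1"
    "edge (replicate k (3, True) @ g) 2 = (\<lambda>x. edge g 2 x + (- int k) * edge g 3 x)"
    "edge (replicate k (3, True) @ g) 3 = edge g 3"
    by (auto simp: edge_def fun_eq_iff algebra_simps)
qed

lemma increasing_in_four:
  fixes i j k l :: nat
  assumes "i < j" "j < k" "k < l" "x < u" "u < y" "y < t"
    and "x \<in> {i, j, k, l}" "u \<in> {i, j, k, l}" "y \<in> {i, j, k, l}" "t \<in> {i, j, k, l}"
  shows "x = i \<and> u = j \<and> y = k \<and> t = l"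
proof -
  have "i \<le> x" using assms(1-3,7) by auto
  then have "u \<in> {j, k, l}" using assms(4,8) by auto
  then have "y \<in> {k, l}" using assms(1-3,5,9) by auto
  then have t: "t = l" using assms(1-3,6,10) by auto
  then have y: "y = k" using \<open>y \<in> {k, l}\<close> assms(6) by auto
  then have u: "u = j" using \<open>u \<in> {j, k, l}\<close> assms(1-3,5) by auto
  then have "x = i" using assms(1-4,7) by auto
  then show ?thesis using t y u by simp
qed

text \<open>
  The hypothesis comes from conjugating the twist by even powers of a full twist, which changes
  neither linking numbers nor dihedral signs. The form is then a polynomial in \<open>k\<close> that is constant on
  multiples of \<open>4\<close>, so its coefficients vanish.
\<close>

locale curvature_relation =
  fixes n :: nat and C :: "nat \<times> nat \<times> nat \<times> nat \<Rightarrow> rat"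
  assumes n: "5 \<le> n"
    and shift: "\<And>g k. g \<in> braid_words n \<Longrightarrow> 4 dvd k \<Longrightarrow>
      (\<Sum>i\<in>johnson_index (n - 1). C i * of_int (curvature (edge (replicate k (3, True) @ g) 1) (edge (replicate k (3, True) @ g) 2) i))
      = (\<Sum>i\<in>johnson_index (n - 1). C i * of_int (curvature (edge g 1) (edge g 2) i))"
begin

definition form :: "(nat \<Rightarrow> int) \<Rightarrow> (nat \<Rightarrow> int) \<Rightarrow> rat" where
  "form \<alpha> \<beta> = (\<Sum>i\<in>johnson_index (n - 1). C i * of_int (curvature \<alpha> \<beta> i))"

lemma form_expand:
  "form \<alpha> (\<lambda>x. \<beta> x + k * \<delta> x) =
    form \<alpha> \<beta> + of_int k * (form \<alpha> (\<lambda>x. \<beta> x + \<delta> x) - form \<alpha> \<beta> - form \<alpha> \<delta>) + (of_int k)\<^sup>2 * form \<alpha> \<delta>"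
proof -
  let ?p = "\<lambda>i. C i * of_int (curvature \<alpha> \<beta> i)" and ?r = "\<lambda>i. C i * of_int (curvature \<alpha> \<delta> i)"
  let ?q = "\<lambda>i. C i * of_int (curvature \<alpha> (\<lambda>x. \<beta> x + \<delta> x) i)"
  have "C i * of_int (curvature \<alpha> (\<lambda>x. \<beta> x + k * \<delta> x) i) =
      ?p i + of_int k * (?q i - ?p i - ?r i) + (of_int k)\<^sup>2 * ?r i" for i
    by (subst curvature_expand) (simp add: ring_distribs)
  then have "form \<alpha> (\<lambda>x. \<beta> x + k * \<delta> x) =
      (\<Sum>i\<in>johnson_index (n - 1). ?p i + of_int k * (?q i - ?p i - ?r i) + (of_int k)\<^sup>2 * ?r i)"
    unfolding form_def by simp
  then show ?thesis
    unfolding form_def by (simp only: sum.distrib sum_subtractf flip: sum_distrib_left)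
qed

lemma form_edge:
  assumes g: "g \<in> braid_words n"
  shows "form (edge g 1) (edge g 3) = 0"
    and "form (edge g 1) (\<lambda>x. edge g 2 x + edge g 3 x) = form (edge g 1) (edge g 2)"
proof -
  let ?D = "form (edge g 1) (\<lambda>x. edge g 2 x + edge g 3 x) - form (edge g 1) (edge g 2) - form (edge g 1) (edge g 3)"
  have "- of_nat k * ?D + (of_nat k)\<^sup>2 * form (edge g 1) (edge g 3) = 0" if "4 dvd k" for k
    using shift[OF g that] form_expand[of "edge g 1" "edge g 2" "- int k" "edge g 3"]
    unfolding sigma_power_edge form_def[symmetric] by simp
  \<comment> \<open>Two nonzero values of \<open>k\<close> determine both coefficients of a
    polynomial without constant term.\<close>
  from this[of 4] this[of 8] have "form (edge g 1) (edge g 3) = 0" "?D = 0" by simp_all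
  then show "form (edge g 1) (edge g 3) = 0"
    "form (edge g 1) (\<lambda>x. edge g 2 x + edge g 3 x) = form (edge g 1) (edge g 2)"
    by simp_all
qed

definition ediff :: "nat \<Rightarrow> nat \<Rightarrow> nat \<Rightarrow> int" where
  "ediff i j x = of_bool (x = i) - of_bool (x = j)"

lemma form_splits:
  assumes "1 \<le> i" "i < j" "j < k" "k < l" "l \<le> n"
  shows "form (ediff i j) (ediff k l) = 0" "form (ediff i l) (ediff k j) = 0"
    "form (ediff i j) (ediff j k) = form (ediff i j) (ediff j l)"
proof -
  let ?g = "sort4 i j k l"
  \<comment> \<open>The added letters carry the fourth strand past the third and second, which turns
    the splitting \<open>i j | k l\<close> into the nested one \<open>i l | k j\<close>.\<close>
  let ?h = "[(2, False), (3, False)] @ ?g"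
  have g: "?g \<in> braid_words n" using assms by (intro sort4_closed) simp_all
  then have h: "?h \<in> braid_words n" using n by (simp add: braid_words_Cons)
  note v = vrun_sort4[OF assms(1-4)]
  have suc: "Suc 1 = 2" "Suc 2 = 3" "Suc 3 = 4" by simp_all
  have e: "edge ?g 1 = ediff i j" "edge ?g 2 = ediff j k" "edge ?g 3 = ediff k l"
    by (rule ext, simp only: edge_def suc v, simp add: ediff_def unit_at_def eq_commute)+
  have vh: "vrun ?h x 1 = vrun ?g x 1" "vrun ?h x 2 = vrun ?g x 4"
    "vrun ?h x 3 = 2 * vrun ?g x 4 - vrun ?g x 2" "vrun ?h x 4 = 2 * vrun ?g x 4 - vrun ?g x 3"
    for x :: "nat \<Rightarrow> int"
    by simp_all
  have e': "edge ?h 1 = ediff i l" "edge ?h 3 = ediff k j"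
    by (rule ext, simp only: edge_def suc vh v, simp add: ediff_def unit_at_def eq_commute)+
  have "(\<lambda>x. ediff j k x + ediff k l x) = ediff j l"
    by (simp add: ediff_def fun_eq_iff)
  then show "form (ediff i j) (ediff k l) = 0" "form (ediff i l) (ediff k j) = 0"
    "form (ediff i j) (ediff j k) = form (ediff i j) (ediff j l)"
    using form_edge[OF g] form_edge(1)[OF h] by (simp_all only: e e')
qed

lemma form_restrict:
  assumes "F \<subseteq> johnson_index (n - 1)" "finite F"
    and "\<And>i. i \<in> johnson_index (n - 1) \<Longrightarrow> i \<notin> F \<Longrightarrow> C i = 0 \<or> curvature \<alpha> \<beta> i = 0"
  shows "form \<alpha> \<beta> = (\<Sum>i\<in>F. C i * of_int (curvature \<alpha> \<beta> i))"
  unfolding form_def using assms finite_johnson_index by (intro sum.mono_neutral_right) auto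

text \<open>The point \<open>n\<close> serves as fourth point: it occurs in no index, so only the
  three triples on \<open>i\<close>, \<open>j\<close>, \<open>k\<close> contribute. The two split
  planes isolate the coefficients at \<open>k\<close> and at \<open>i\<close>, and the third
  relation then gives the one at \<open>j\<close>.\<close>

lemma triple_coefficients:
  assumes ijk: "1 \<le> i" "i < j" "j < k" "k < n"
  shows "C (i, j, i, k) = 0 \<and> C (j, i, j, k) = 0 \<and> C (k, i, k, j) = 0"
proof -
  let ?F = "{(i, j, i, k), (j, i, j, k), (k, i, k, j)}"
  have F: "?F \<subseteq> johnson_index (n - 1)" using ijk by (auto simp: johnson_index_def)
  have supp: "form \<alpha> \<beta> = (\<Sum>i\<in>?F. C i * of_int (curvature \<alpha> \<beta> i))"
    if z: "\<And>x. x \<notin> {i, j, k, n} \<Longrightarrow> \<alpha> x = 0 \<and> \<beta> x = 0" for \<alpha> \<beta>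
  proof (rule form_restrict[OF F])
    fix q assume q: "q \<in> johnson_index (n - 1)" "q \<notin> ?F"
    obtain x y u t where xyut: "q = (x, y, u, t)" by (cases q)
    have "x \<notin> {i, j, k, n} \<or> y \<notin> {i, j, k, n} \<or> u \<notin> {i, j, k, n} \<or> t \<notin> {i, j, k, n}"
    proof (rule ccontr)
      assume "\<not> ?thesis"
      then have all: "x \<in> {i, j, k, n}" "y \<in> {i, j, k, n}" "u \<in> {i, j, k, n}" "t \<in> {i, j, k, n}" by simp_all
      have "x \<le> n - 1 \<and> y \<le> n - 1 \<and> u \<le> n - 1 \<and> t \<le> n - 1"
        using q(1)[unfolded xyut] by (cases rule: johnson_index_cases) simp_all
      then have "x \<noteq> n" "y \<noteq> n" "u \<noteq> n" "t \<noteq> n" using ijk by linarith+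
      with all have mem: "x \<in> {i, j, k}" "y \<in> {i, j, k}" "u \<in> {i, j, k}" "t \<in> {i, j, k}"
        by simp_all
      from q(1)[unfolded xyut] show False
      proof (cases rule: johnson_index_cases)
        case triple
        have "(y, t) \<in> {(i, j), (i, k), (j, k)}" using mem(2,4) triple(2) ijk by auto
        then show False using mem(1) triple(1,3,4) q(2) by (auto simp: xyut)
      next
        case quad1
        then have "card {x, u, y, t} = 4" by simp
        moreover have "card {x, u, y, t} \<le> card {i, j, k}" using mem by (intro card_mono) auto
        ultimately show False using ijk by simp
      next
        case quad2
        then have "card {x, y, t, u} = 4" by simp
        moreover have "card {x, y, t, u} \<le> card {i, j, k}" using mem by (intro card_mono) auto
        ultimately show False using ijk by simp
      qed
    qed
    then show "C q = 0 \<or> curvature \<alpha> \<beta> q = 0"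
      using z[of x] z[of y] z[of u] z[of t]
      by (elim disjE) (simp_all add: xyut curvature_def minor_def)
  qed simp
  have f: "form (ediff a b) (ediff c d) = (\<Sum>i\<in>?F. C i * of_int (curvature (ediff a b) (ediff c d) i))"
    if "a \<in> {i, j, k, n}" "b \<in> {i, j, k, n}" "c \<in> {i, j, k, n}" "d \<in> {i, j, k, n}" for a b c d
    by (intro supp) (use that in \<open>auto simp: ediff_def\<close>)
  have ijkn: "1 \<le> i" "i < j" "j < k" "k < n" "n \<le> n" using ijk by simp_all
  note s = form_splits[OF ijkn]
  have k0: "C (k, i, k, j) = 0"
    using s(1) ijk by (subst (asm) f) (auto simp: curvature_def minor_def ediff_def)
  have i0: "C (i, j, i, k) = 0"
    using s(2) ijk by (subst (asm) f) (auto simp: curvature_def minor_def ediff_def)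
  have "C (j, i, j, k) = 0"
    using s(3) ijk k0 i0 by (subst (asm) (1 2) f) (auto simp: curvature_def minor_def ediff_def)
  then show ?thesis using k0 i0 by simp
qed

text \<open>With the triples gone, the two splittings say that each of the two coefficients is twice
  the other.\<close>

lemma quadruple_coefficients:
  assumes ijkl: "1 \<le> i" "i < j" "j < k" "k < l" "l < n"
  shows "C (i, k, j, l) = 0 \<and> C (i, j, l, k) = 0"
proof -
  let ?F = "{(i, k, j, l), (i, j, l, k)}"
  have F: "?F \<subseteq> johnson_index (n - 1)" using ijkl by (auto simp: johnson_index_def)
  have f: "form (ediff a b) (ediff c d) = (\<Sum>i\<in>?F. C i * of_int (curvature (ediff a b) (ediff c d) i))"
    if abcd: "a \<in> {i, j, k, l}" "b \<in> {i, j, k, l}" "c \<in> {i, j, k, l}" "d \<in> {i, j, k, l}" for a b c d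
  proof (rule form_restrict[OF F])
    fix q assume q: "q \<in> johnson_index (n - 1)" "q \<notin> ?F"
    obtain x y u t where xyut: "q = (x, y, u, t)" by (cases q)
    show "C q = 0 \<or> curvature (ediff a b) (ediff c d) q = 0"
    proof (cases "x \<in> {i, j, k, l} \<and> y \<in> {i, j, k, l} \<and> u \<in> {i, j, k, l} \<and> t \<in> {i, j, k, l}")
      case True
      from q(1)[unfolded xyut] show ?thesis
      proof (cases rule: johnson_index_cases)
        case triple
        then have "x < y \<or> y < x \<and> x < t \<or> t < x" by auto
        then show ?thesis
          using triple triple_coefficients[of x y t] triple_coefficients[of y x t]
            triple_coefficients[of y t x] ijkl by (auto simp: xyut)
      next
        case quad1
        then have "x = i \<and> u = j \<and> y = k \<and> t = l"
          using True ijkl by (intro increasing_in_four) simp_all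
        then show ?thesis using q(2) by (simp add: xyut)
      next
        case quad2
        then have "x = i \<and> y = j \<and> t = k \<and> u = l"
          using True ijkl by (intro increasing_in_four) simp_all
        then show ?thesis using q(2) by (simp add: xyut)
      qed
    next
      case False
      have z: "v \<notin> {i, j, k, l} \<Longrightarrow> ediff a b v = 0 \<and> ediff c d v = 0" for v
        using abcd by (auto simp: ediff_def)
      from False have "x \<notin> {i, j, k, l} \<or> y \<notin> {i, j, k, l} \<or> u \<notin> {i, j, k, l} \<or> t \<notin> {i, j, k, l}"
        by blast
      then show ?thesis
        using z[of x] z[of y] z[of u] z[of t]
        by (elim disjE) (simp_all add: xyut curvature_def minor_def)
    qed
  qed simp
  have ijkl': "1 \<le> i" "i < j" "j < k" "k < l" "l \<le> n" using ijkl by simp_all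
  note s = form_splits[OF ijkl']
  have "of_int 2 * C (i, k, j, l) = C (i, j, l, k)"
    using s(1) ijkl by (subst (asm) f) (auto simp: curvature_def minor_def ediff_def)
  moreover have "of_int 2 * C (i, j, l, k) = C (i, k, j, l)"
    using s(2) ijkl by (subst (asm) f) (auto simp: curvature_def minor_def ediff_def)
  ultimately show ?thesis by simp
qed

lemma coefficients_zero:
  assumes "q \<in> johnson_index (n - 1)"
  shows "C q = 0"
proof -
  have le: "m \<le> n - 1 \<longleftrightarrow> m < n" for m using n by auto
  obtain x y u t where xyut: "q = (x, y, u, t)" by (cases q)
  from assms[unfolded xyut] show ?thesis
  proof (cases rule: johnson_index_cases)
    case triple
    then have "x < y \<or> y < x \<and> x < t \<or> t < x" by auto
    then show ?thesis
      using triple triple_coefficients[of x y t] triple_coefficients[of y x t]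
        triple_coefficients[of y t x] n by (auto simp: le xyut)
  next
    case quad1
    then show ?thesis using quadruple_coefficients[of x u y t] by (simp add: le xyut)
  next
    case quad2
    then show ?thesis using quadruple_coefficients[of x y t u] by (simp add: le xyut)
  qed
qed

end

section \<open>Separating splittings by characters of the pure braid group\<close>

section \<open>Independence of the dihedral and linking families\<close>

definition pure_words :: "nat \<Rightarrow> braid_word set" where
  "pure_words n = {u \<in> braid_words n. \<forall>x :: nat \<Rightarrow> nat. prun u x = x}"

lemma prun_pure: "u \<in> pure_words n \<Longrightarrow> prun u x = x"
  using prun_comp[of u x "\<lambda>m. m"] by (simp add: pure_words_def)

definition separates :: "(nat \<Rightarrow> colour) \<Rightarrow> nat \<Rightarrow> nat \<Rightarrow> bool" where
  "separates c p q \<longleftrightarrow> c p \<noteq> Blank \<and> c q \<noteq> Blank \<and> c p \<noteq> c q"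

lemma ex_other:
  assumes "finite X" "card X < n"
  shows "\<exists>z\<in>{1..n :: nat}. z \<notin> X"
proof (rule ccontr)
  assume "\<not> ?thesis"
  then have "{1..n} \<subseteq> X" by auto
  then have "card {1..n} \<le> card X" using assms(1) by (rule card_mono[rotated])
  then show False using assms(2) by simp
qed

text \<open>A full twist of two strands is a reflection exactly when their colours differ;
  conjugation places it at \<open>x\<close> and \<open>y\<close>.\<close>

lemma separating_word:
  assumes xy: "x \<in> {1..n}" "y \<in> {1..n}" "x \<noteq> y" and n: "3 \<le> n"
  obtains h where "h \<in> pure_words n"
    "\<And>c. c \<in> balanced \<Longrightarrow> twist_sgn pstep col_sgn h c = (if separates c x y then -1 else 1)"
proof -
  interpret affine_cocycle n pstep col_sgn col_val balanced by (rule affine_cocycle_col)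
  obtain z where z: "z \<in> {1..n}" "z \<notin> {x, y}"
    using ex_other[of "{x, y}" n] xy n by auto
  obtain g where g: "g \<in> braid_words n"
    and gc: "\<And>c :: nat \<Rightarrow> colour. prun g c 1 = c x" "\<And>c :: nat \<Rightarrow> colour. prun g c 2 = c y"
    using gather_three[of x n y z, where 'a = colour] xy z by (metis insertCI)
  let ?f = "[(1, True), (1, True)] :: braid_word"
  have f: "prun ?f c = c" for c :: "nat \<Rightarrow> 'c"
    by (auto simp: fun_eq_iff)
  have f': "prun ?f c = c" for c :: "nat \<Rightarrow> nat"
    by (auto simp: fun_eq_iff)
  have "prun (inv_word g @ ?f @ g) x = x" for x :: "nat \<Rightarrow> nat"
    by (simp only: foldr_append f' prun_inv_word)
  moreover have "inv_word g @ ?f @ g \<in> braid_words n"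
    using g inv_word_closed[OF g] n by (simp add: braid_words_append braid_words_Cons)
  ultimately have "inv_word g @ ?f @ g \<in> pure_words n" by (simp add: pure_words_def)
  moreover have "twist_sgn pstep col_sgn (inv_word g @ ?f @ g) c = (if separates c x y then -1 else 1)"
    if c: "c \<in> balanced" for c
  proof -
    define c' where "c' = prun g c"
    have "c' 1 = c x" "c' 2 = c y" using gc[of c] by (simp_all only: c'_def)
    then show ?thesis
      unfolding sgn_of_conj[OF g c f] c'_def[symmetric]
      by (cases "c x"; cases "c y") (simp_all add: col_sgn_def separates_def numeral_2_eq_2)
  qed
  ultimately show thesis by (rule that)
qed

definition link_index :: "nat \<Rightarrow> (nat \<times> nat) set" where
  "link_index n = {(i, j). 1 \<le> i \<and> i < j \<and> j \<le> n}"

text \<open>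
  The strand \<open>n + 1\<close> never moves; splittings that use it stand for the reflections of triples of
  strands.
\<close>

definition dihedral_index :: "nat \<Rightarrow> (nat \<times> nat \<times> nat \<times> nat) set" where
  "dihedral_index n = {(a, c, b, d). 1 \<le> a \<and> a < c \<and> b < d \<and> a < b \<and> c \<noteq> b \<and> c \<noteq> d \<and>
    c \<le> Suc n \<and> d \<le> Suc n}"

lemma finite_link_index: "finite (link_index n)"
  by (rule finite_subset[of _ "{..n} \<times> {..n}"]) (auto simp: link_index_def)

lemma finite_dihedral_index: "finite (dihedral_index n)"
  by (rule finite_subset[of _ "{..Suc n} \<times> {..Suc n} \<times> {..Suc n} \<times> {..Suc n}"])
    (auto simp: dihedral_index_def)

lemma dihedral_index_props:
  assumes "i \<in> dihedral_index n"
  shows "distinct4 i" "colouring i 0 = Blank" "colouring i \<in> balanced"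
proof -
  show "distinct4 i" using assms by (auto simp: dihedral_index_def distinct4_def)
  then show "colouring i \<in> balanced" by (rule colouring_balanced)
  show "colouring i 0 = Blank" using assms by (auto simp: dihedral_index_def colouring_def)
qed

lemma min_max_pair:
  fixes p q :: nat
  assumes "x = p \<or> x = q" "y = p \<or> y = q" "x \<noteq> y" "p < q"
  shows "min x y = p" "max x y = q"
  using assms by auto

lemma dihedral_index_unique:
  assumes "i \<in> dihedral_index n" "x \<noteq> y" "b \<noteq> d"
    and "colouring i x = colouring i y" "colouring i b = colouring i d" "separates (colouring i) x b"
  shows "i = (if min x y < min b d then (min x y, max x y, min b d, max b d)
    else (min b d, max b d, min x y, max x y))"
proof -
  obtain p q r s where i: "i = (p, q, r, s)" by (cases i)
  have o: "p < q" "r < s" "p < r" "r \<noteq> q" "s \<noteq> q" "s \<noteq> p"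
    using assms(1) by (auto simp: i dihedral_index_def)
  have red: "colouring i v = Red \<longleftrightarrow> v = p \<or> v = q" and blue: "colouring i v = Blue \<longleftrightarrow> v = r \<or> v = s" for v
    using o by (auto simp: i colouring_def)
  consider "colouring i x = Red" "colouring i b = Blue" | "colouring i x = Blue" "colouring i b = Red"
    using assms(6) unfolding separates_def by (metis colour.exhaust)
  then show ?thesis
  proof cases
    case 1
    then have "x = p \<or> x = q" "y = p \<or> y = q" "b = r \<or> b = s" "d = r \<or> d = s"
      using red[of x] red[of y] blue[of b] blue[of d] assms(4,5) by simp_all
    then have "min x y = p" "max x y = q" "min b d = r" "max b d = s"
      using min_max_pair assms(2,3) o(1,2) by metis+
    then show ?thesis using o(3) by (simp add: i)
  next
    case 2
    then have "x = r \<or> x = s" "y = r \<or> y = s" "b = p \<or> b = q" "d = p \<or> d = q"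
      using blue[of x] blue[of y] red[of b] red[of d] assms(4,5) by simp_all
    then have "min x y = r" "max x y = s" "min b d = p" "max b d = q"
      using min_max_pair assms(2,3) o(1,2) by metis+
    then show ?thesis using o(3) by (simp add: i)
  qed
qed

lemma dihedral_index_blank:
  assumes "i \<in> dihedral_index n" "x \<noteq> y" "b \<noteq> d"
    and "colouring i x = colouring i y" "colouring i b = colouring i d" "separates (colouring i) x b"
    and "v \<notin> {x, y, b, d}"
  shows "colouring i v = Blank"
proof -
  note b3 = balanced_not_three[OF dihedral_index_props(3)[OF assms(1)]]
  have c: "colouring i x \<noteq> Blank" "colouring i b \<noteq> Blank" "colouring i x \<noteq> colouring i b"
    using assms(6) by (simp_all add: separates_def)
  have v: "x \<noteq> v" "y \<noteq> v" "b \<noteq> v" "d \<noteq> v" using assms(7) by auto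
  have "colouring i v \<noteq> colouring i x"
    by (rule b3[OF c(1) assms(2) v(1,2) HOL.refl assms(4)[symmetric]])
  moreover have "colouring i v \<noteq> colouring i b"
    by (rule b3[OF c(2) assms(3) v(3,4) HOL.refl assms(5)[symmetric]])
  ultimately show ?thesis
    using c by (cases "colouring i v"; cases "colouring i x"; cases "colouring i b") simp_all
qed

locale dihedral_relation =
  fixes n :: nat and A :: "nat \<times> nat \<Rightarrow> rat" and B :: "nat \<times> nat \<times> nat \<times> nat \<Rightarrow> rat"
  assumes n: "5 \<le> n"
    and rel: "\<And>g. g \<in> braid_words n \<Longrightarrow>
      (\<Sum>i\<in>link_index n. A i * of_int (link_hom i (conj_twist g)))
      + (\<Sum>i\<in>dihedral_index n. B i * of_int (dihedral_hom i (conj_twist g))) = 0"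
begin

abbreviation sgn_at :: "nat \<times> nat \<times> nat \<times> nat \<Rightarrow> braid_word \<Rightarrow> int" where
  "sgn_at i u \<equiv> twist_sgn pstep col_sgn u (colouring i)"

lemma sgn_at_append: "h \<in> pure_words n \<Longrightarrow> sgn_at i (u @ h) = sgn_at i u * sgn_at i h"
  by (simp add: twist_sgn_append prun_pure)

lemma pure_append: "u \<in> pure_words n \<Longrightarrow> h \<in> pure_words n \<Longrightarrow> u @ h \<in> pure_words n"
  by (simp add: pure_words_def braid_words_append)

text \<open>Compare \<open>u\<close> with \<open>u @ h\<close>, where \<open>h\<close> twists
  \<open>x\<close> and \<open>y\<close>: the constant and the unseparated terms cancel, the others
  double.\<close>

lemma difference:
  assumes f: "\<forall>u\<in>pure_words n. K + (\<Sum>i\<in>dihedral_index n. D i * of_int (sgn_at i u)) = 0"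
    and xy: "x \<in> {1..n}" "y \<in> {1..n}" "x \<noteq> y"
  shows "\<forall>u\<in>pure_words n.
    0 + (\<Sum>i\<in>dihedral_index n. (if separates (colouring i) x y then D i else 0) * of_int (sgn_at i u)) = (0 :: rat)"
proof
  fix u assume u: "u \<in> pure_words n"
  have "3 \<le> n" using n by simp
  obtain h where h: "h \<in> pure_words n"
    "\<And>c. c \<in> balanced \<Longrightarrow> twist_sgn pstep col_sgn h c = (if separates c x y then -1 else 1)"
    using separating_word[OF xy \<open>3 \<le> n\<close>] by metis
  have "(\<Sum>i\<in>dihedral_index n. 2 * ((if separates (colouring i) x y then D i else 0) * of_int (sgn_at i u)))
    = (\<Sum>i\<in>dihedral_index n. D i * of_int (sgn_at i u) - D i * of_int (sgn_at i (u @ h)))"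
    by (rule sum.cong) (simp_all add: sgn_at_append[OF h(1)] h(2) dihedral_index_props)
  also have "\<dots> = 0"
    using f u pure_append[OF u h(1)] by (simp add: sum_subtractf add_eq_0_iff)
  finally show "0 + (\<Sum>i\<in>dihedral_index n. (if separates (colouring i) x y then D i else 0) * of_int (sgn_at i u)) = (0 :: rat)"
    by (simp flip: sum_distrib_left)
qed

text \<open>A pure braid \<open>u\<close> before \<open>g\<close> leaves linking numbers alone and
  multiplies each dihedral term by its character at \<open>u\<close>.\<close>

lemma gathered_relation:
  assumes g: "g \<in> braid_words n"
  obtains K where "\<forall>u\<in>pure_words n. K + (\<Sum>i\<in>dihedral_index n.
      (B i * of_int (sgn_at i g) * (if twin (prun g (colouring i) 1) (prun g (colouring i) 2) (prun g (colouring i) 3) then 4 else 0))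
      * of_int (sgn_at i u)) = 0"
proof -
  have "3 \<le> n" using n by simp
  note val = dihedral_hom_conj_twist[OF _ _ _ this]
  define K where "K = (\<Sum>i\<in>link_index n. A i * of_int (link_hom i (conj_twist g)))"
  have "K + (\<Sum>i\<in>dihedral_index n.
      (B i * of_int (sgn_at i g) * (if twin (prun g (colouring i) 1) (prun g (colouring i) 2) (prun g (colouring i) 3) then 4 else 0))
      * of_int (sgn_at i u)) = 0" if u: "u \<in> pure_words n" for u
  proof -
    have gu: "g @ u \<in> braid_words n" using g u by (simp add: braid_words_append pure_words_def)
    have "(\<Sum>i\<in>link_index n. A i * of_int (link_hom i (conj_twist (g @ u)))) = K"
      unfolding K_def by (simp add: link_hom_conj_twist[OF gu] link_hom_conj_twist[OF g] prun_pure[OF u])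
    moreover have "(\<Sum>i\<in>dihedral_index n. B i * of_int (dihedral_hom i (conj_twist (g @ u)))) =
      (\<Sum>i\<in>dihedral_index n.
      (B i * of_int (sgn_at i g) * (if twin (prun g (colouring i) 1) (prun g (colouring i) 2) (prun g (colouring i) 3) then 4 else 0))
      * of_int (sgn_at i u))"
      by (rule sum.cong) (simp_all add: val[OF gu] dihedral_index_props sgn_at_append[OF u] prun_pure[OF u])
    ultimately show ?thesis using rel[OF gu] by simp
  qed
  then show thesis using that by blast
qed

text \<open>The twist about \<open>x\<close>, \<open>y\<close>, \<open>e\<close> leaves splittings
  with twins among these three. Separating \<open>b\<close> from both \<open>x\<close> and
  \<open>y\<close> forces the twins to be \<open>x\<close> and \<open>y\<close>, since otherwise one
  of these would be blank.\<close>

lemma two_differences: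
  assumes "x \<in> {1..n}" "y \<in> {1..n}" "e \<in> {1..n}" "b \<in> {1..n}" "distinct [x, y, e, b]"
  obtains D where "\<And>u. u \<in> pure_words n \<Longrightarrow> 0 + (\<Sum>i\<in>dihedral_index n. D i * of_int (sgn_at i u)) = (0 :: rat)"
    and "\<And>i. D i = 0 \<or> separates (colouring i) x b \<and> colouring i x = colouring i y \<and> colouring i e = Blank \<and> B i \<noteq> 0"
    and "\<And>i. separates (colouring i) x b \<Longrightarrow> colouring i x = colouring i y \<Longrightarrow> colouring i e = Blank \<Longrightarrow> D i = 0 \<Longrightarrow> B i = 0"
proof -
  obtain g where g: "g \<in> braid_words n"
    and gc: "\<And>c :: nat \<Rightarrow> colour. prun g c 1 = c x" "\<And>c :: nat \<Rightarrow> colour. prun g c 2 = c y"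
      "\<And>c :: nat \<Rightarrow> colour. prun g c 3 = c e"
    using gather_three[OF assms(1-3), where 'a = colour] assms(5) by (metis distinct_length_2_or_more)
  obtain K where K: "\<forall>u\<in>pure_words n. K + (\<Sum>i\<in>dihedral_index n.
      (B i * of_int (sgn_at i g) * (if twin (prun g (colouring i) 1) (prun g (colouring i) 2) (prun g (colouring i) 3) then 4 else 0))
      * of_int (sgn_at i u)) = 0"
    using gathered_relation[OF g] by blast
  define D0 where "D0 i = B i * of_int (sgn_at i g) *
    (if twin (prun g (colouring i) 1) (prun g (colouring i) 2) (prun g (colouring i) 3) then 4 else 0)" for i
  define D where "D i = (if separates (colouring i) y b then if separates (colouring i) x b then D0 i else 0 else 0)" for i
  have xb: "x \<noteq> b" "y \<noteq> b" using assms by auto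
  have s: "sgn_at i g \<noteq> 0" for i
    using affine_cocycle.sgn_of_unit[OF affine_cocycle_col, of g "colouring i"] by auto
  have D0: "D0 i = B i * of_int (sgn_at i g) * (if twin (colouring i x) (colouring i y) (colouring i e) then 4 else 0)" for i
    unfolding D0_def gc by simp
  note d1 = difference[OF K[folded D0_def] assms(1,4) xb(1)]
  note d2 = difference[OF d1 assms(2,4) xb(2)]
  show thesis
  proof (rule that)
    show "0 + (\<Sum>i\<in>dihedral_index n. D i * of_int (sgn_at i u)) = 0" if "u \<in> pure_words n" for u
      using d2 that unfolding D_def by blast
    show "D i = 0 \<or> separates (colouring i) x b \<and> colouring i x = colouring i y \<and> colouring i e = Blank \<and> B i \<noteq> 0" for i
      by (cases "colouring i x"; cases "colouring i y"; cases "colouring i e"; cases "colouring i b")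
        (auto simp: D_def D0 separates_def twin_def)
    show "B i = 0" if "separates (colouring i) x b" "colouring i x = colouring i y" "colouring i e = Blank" "D i = 0" for i
      using that s[of i] by (auto simp: D_def D0 separates_def twin_def)
  qed
qed

lemma nil_pure: "[] \<in> pure_words n"
  by (simp add: pure_words_def braid_words_Nil)

text \<open>A third comparison, of \<open>x\<close> with \<open>d\<close>, leaves a single
  splitting. The blank strand \<open>e\<close> is where five strands are used.\<close>

lemma coefficient_zero_inside:
  assumes i: "i \<in> dihedral_index n" and xybd: "{x, y, b, d} \<subseteq> {1..n}" "distinct [x, y, b, d]"
    and c: "separates (colouring i) x b" "colouring i x = colouring i y" "colouring i b = colouring i d"
  shows "B i = 0"
proof -
  obtain e where e: "e \<in> {1..n}" "e \<notin> {x, y, b, d}"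
    using ex_other[of "{x, y, b, d}" n] xybd n by auto
  have ce: "colouring i e = Blank"
    using xybd(2) e by (intro dihedral_index_blank[OF i _ _ c(2,3,1)]) auto
  have m: "x \<in> {1..n}" "y \<in> {1..n}" "b \<in> {1..n}" "d \<in> {1..n}" "x \<noteq> d" "distinct [x, y, e, b]"
    using xybd e by auto
  obtain D where D: "\<And>u. u \<in> pure_words n \<Longrightarrow> 0 + (\<Sum>i\<in>dihedral_index n. D i * of_int (sgn_at i u)) = (0 :: rat)"
    "\<And>i. D i = 0 \<or> separates (colouring i) x b \<and> colouring i x = colouring i y \<and> colouring i e = Blank \<and> B i \<noteq> 0"
    "\<And>i. separates (colouring i) x b \<Longrightarrow> colouring i x = colouring i y \<Longrightarrow> colouring i e = Blank \<Longrightarrow> D i = 0 \<Longrightarrow> B i = 0"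
    using two_differences[OF m(1,2) e(1) m(3) m(6)] by blast
  let ?E = "\<lambda>j. if separates (colouring j) x d then D j else 0"
  have "(\<Sum>j\<in>dihedral_index n. ?E j) = 0"
    using difference[OF ballI[OF D(1)] m(1,4,5)] nil_pure by force
  moreover have "?E j = 0" if j: "j \<in> dihedral_index n" "j \<noteq> i" for j
  proof (rule ccontr)
    assume "?E j \<noteq> 0"
    then have s: "separates (colouring j) x d" "separates (colouring j) x b" "colouring j x = colouring j y"
      using D(2)[of j] by (auto split: if_splits)
    then have "colouring j b = colouring j d"
      by (cases "colouring j x"; cases "colouring j b"; cases "colouring j d") (auto simp: separates_def)
    then have "j = i"
      using dihedral_index_unique[OF j(1) _ _ s(3) _ s(2), of d] dihedral_index_unique[OF i _ _ c(2,3,1)] xybd(2)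
      by simp
    then show False using j by simp
  qed
  ultimately have "?E i = 0"
    using sum.remove[OF finite_dihedral_index i, of ?E] by simp
  moreover have "separates (colouring i) x d" using c by (auto simp: separates_def)
  ultimately show ?thesis using D(3)[OF c(1,2) ce] by simp
qed

text \<open>No comparison with the immobile strand \<open>n + 1\<close> is possible, but every
  surviving splitting pairs \<open>b\<close> with some \<open>d\<close>, and those with
  \<open>d \<le> n\<close> have been dealt with.\<close>

lemma coefficient_zero_boundary:
  assumes i: "i \<in> dihedral_index n" and xyb: "{x, y, b} \<subseteq> {1..n}" "distinct [x, y, b]"
    and c: "separates (colouring i) x b" "colouring i x = colouring i y" "colouring i b = colouring i (Suc n)"
  shows "B i = 0"
proof -
  obtain e where e: "e \<in> {1..n}" "e \<notin> {x, y, b}"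
    using ex_other[of "{x, y, b}" n] xyb n by auto
  have ne: "Suc n \<noteq> x" "Suc n \<noteq> y" "Suc n \<noteq> b" "Suc n \<noteq> e" using xyb e by auto
  have ce: "colouring i e = Blank"
    using xyb(2) e ne by (intro dihedral_index_blank[OF i _ _ c(2,3,1)]) auto
  have m: "x \<in> {1..n}" "y \<in> {1..n}" "b \<in> {1..n}" "distinct [x, y, e, b]"
    using xyb e by auto
  obtain D where D: "\<And>u. u \<in> pure_words n \<Longrightarrow> 0 + (\<Sum>i\<in>dihedral_index n. D i * of_int (sgn_at i u)) = (0 :: rat)"
    "\<And>i. D i = 0 \<or> separates (colouring i) x b \<and> colouring i x = colouring i y \<and> colouring i e = Blank \<and> B i \<noteq> 0"
    "\<And>i. separates (colouring i) x b \<Longrightarrow> colouring i x = colouring i y \<Longrightarrow> colouring i e = Blank \<Longrightarrow> D i = 0 \<Longrightarrow> B i = 0"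
    using two_differences[OF m(1,2) e(1) m(3,4)] by blast
  have "(\<Sum>j\<in>dihedral_index n. D j) = 0"
    using D(1)[OF nil_pure] by simp
  moreover have "D j = 0" if j: "j \<in> dihedral_index n" "j \<noteq> i" for j
  proof (rule ccontr)
    assume "D j \<noteq> 0"
    then have s: "separates (colouring j) x b" "colouring j x = colouring j y" "B j \<noteq> 0"
      using D(2)[of j] by auto
    obtain p q r t where jt: "j = (p, q, r, t)" by (cases j)
    have "b = p \<or> b = q \<or> b = r \<or> b = t"
      using s(1) by (auto simp: jt separates_def colouring_def split: if_splits)
    then have "\<exists>d. d \<noteq> b \<and> colouring j d = colouring j b \<and> d \<in> {1..Suc n}"
    proof (elim disjE)
      assume "b = p"
      then show ?thesis using j(1) by (intro exI[of _ q]) (auto simp: jt colouring_def dihedral_index_def)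
    next
      assume "b = q"
      then show ?thesis using j(1) by (intro exI[of _ p]) (auto simp: jt colouring_def dihedral_index_def)
    next
      assume "b = r"
      then show ?thesis using j(1) by (intro exI[of _ t]) (auto simp: jt colouring_def dihedral_index_def)
    next
      assume "b = t"
      then show ?thesis using j(1) by (intro exI[of _ r]) (auto simp: jt colouring_def dihedral_index_def)
    qed
    then obtain d where d: "d \<noteq> b" "colouring j d = colouring j b" "d \<in> {1..Suc n}" by blast
    have dxy: "d \<noteq> x" "d \<noteq> y" using s d by (auto simp: separates_def)
    show False
    proof (cases "d = Suc n")
      case True
      then have "j = i"
        using dihedral_index_unique[OF j(1) _ _ s(2) _ s(1), of d] dihedral_index_unique[OF i _ _ c(2,3,1)]
          xyb(2) d by simp
      then show False using j by simp
    next
      case False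
      then have "B j = 0"
        using xyb d dxy s(1,2) by (intro coefficient_zero_inside[OF j(1), of x y b d]) auto
      then show False using s by simp
    qed
  qed
  ultimately have "D i = 0"
    using sum.remove[OF finite_dihedral_index i, of D] by simp
  then show ?thesis using D(3)[OF c(1,2) ce] by simp
qed

lemma dihedral_coefficients_zero:
  assumes i: "i \<in> dihedral_index n"
  shows "B i = 0"
proof -
  obtain a c b d where eq: "i = (a, c, b, d)" by (cases i)
  have o: "1 \<le> a" "a < c" "b < d" "a < b" "c \<noteq> b" "c \<noteq> d" "c \<le> Suc n" "d \<le> Suc n"
    using i by (simp_all add: eq dihedral_index_def)
  consider "c \<le> n" "d \<le> n" | "d = Suc n" | "c = Suc n" using o by linarith
  then show ?thesis
  proof cases
    case 1
    then show ?thesis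
      using o by (intro coefficient_zero_inside[OF i, of a c b d]) (auto simp: eq colouring_def separates_def)
  next
    case 2
    then show ?thesis
      using o by (intro coefficient_zero_boundary[OF i, of a c b]) (auto simp: eq colouring_def separates_def)
  next
    case 3
    then show ?thesis
      using o by (intro coefficient_zero_boundary[OF i, of b d a]) (auto simp: eq colouring_def separates_def)
  qed
qed

lemma link_pair_sum:
  assumes "x \<in> {1..n}" "y \<in> {1..n}" "x \<noteq> y"
  shows "(\<Sum>i\<in>link_index n. A i * of_bool (mark_pair i x \<and> mark_pair i y)) = A (min x y, max x y)"
proof -
  have "mark_pair i x \<and> mark_pair i y \<longleftrightarrow> i = (min x y, max x y)" if "i \<in> link_index n" for i
    using that assms by (auto simp: link_index_def mark_pair_def min_def max_def)
  then have "(\<Sum>i\<in>link_index n. A i * of_bool (mark_pair i x \<and> mark_pair i y)) =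
      (\<Sum>i\<in>link_index n. if i = (min x y, max x y) then A i else 0)"
    by (intro sum.cong) simp_all
  moreover have "(min x y, max x y) \<in> link_index n"
    using assms by (auto simp: link_index_def min_def max_def)
  ultimately show ?thesis by (simp add: finite_link_index)
qed

lemma link_triple:
  assumes "x \<in> {1..n}" "y \<in> {1..n}" "z \<in> {1..n}" "x \<noteq> y" "x \<noteq> z" "y \<noteq> z"
  shows "A (min x y, max x y) + A (min x z, max x z) + A (min y z, max y z) = 0"
proof -
  obtain g where g: "g \<in> braid_words n"
    and gc: "\<And>c :: nat \<Rightarrow> bool. prun g c 1 = c x" "\<And>c :: nat \<Rightarrow> bool. prun g c 2 = c y"
      "\<And>c :: nat \<Rightarrow> bool. prun g c 3 = c z"
    by (rule gather_three[OF assms, where 'a = bool]) (rule that)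
  let ?s = "\<lambda>u v. \<Sum>i\<in>link_index n. A i * of_bool (mark_pair i u \<and> mark_pair i v)"
  have split: "q * of_int (4 * (of_bool P + of_bool Q + of_bool R)) =
      4 * (q * of_bool P) + 4 * (q * of_bool Q) + 4 * (q * of_bool R)" for q :: rat and P Q R
    by (cases P; cases Q; cases R) simp_all
  have "(\<Sum>i\<in>dihedral_index n. B i * of_int (dihedral_hom i (conj_twist g))) = 0"
    by (rule sum.neutral) (simp add: dihedral_coefficients_zero)
  then have "0 = (\<Sum>i\<in>link_index n. A i * of_int (link_hom i (conj_twist g)))"
    using rel[OF g] by simp
  also have "\<dots> = 4 * ?s x y + 4 * ?s x z + 4 * ?s y z"
    unfolding link_hom_conj_twist[OF g] gc split sum.distrib sum_distrib_left[symmetric] by (rule HOL.refl)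
  finally have "4 * ?s x y + 4 * ?s x z + 4 * ?s y z = 0" by (rule HOL.sym)
  then show ?thesis
    unfolding link_pair_sum[OF assms(1,2,4)] link_pair_sum[OF assms(1,3,5)] link_pair_sum[OF assms(2,3,6)]
    by linarith
qed

text \<open>The triples inside \<open>{x, p, q, r}\<close> give
  \<open>a x p + a x q + a x r = 0\<close>, and likewise for \<open>y\<close>; adding the three
  triples through \<open>x\<close> and \<open>y\<close> leaves \<open>3 * a x y = 0\<close>.\<close>

lemma link_coefficients_zero:
  assumes "i \<in> link_index n"
  shows "A i = 0"
proof -
  obtain x y where i: "i = (x, y)" by (cases i)
  have xy: "x \<in> {1..n}" "y \<in> {1..n}" "x < y" using assms by (auto simp: i link_index_def)
  obtain p where p: "p \<in> {1..n}" "p \<notin> {x, y}" using ex_other[of "{x, y}" n] xy n by auto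
  obtain q where q: "q \<in> {1..n}" "q \<notin> {x, y, p}" using ex_other[of "{x, y, p}" n] xy p n by auto
  obtain r where r: "r \<in> {1..n}" "r \<notin> {x, y, p, q}" using ex_other[of "{x, y, p, q}" n] xy p q n by auto
  define a where "a u v = A (min u v, max u v)" for u v
  have t: "a u v + a u w + a v w = 0"
    if "u \<in> {1..n}" "v \<in> {1..n}" "w \<in> {1..n}" "u \<noteq> v" "u \<noteq> w" "v \<noteq> w" for u v w
    unfolding a_def by (rule link_triple[OF that])
  have ne: "x \<noteq> y" "x \<noteq> p" "x \<noteq> q" "x \<noteq> r" "y \<noteq> p" "y \<noteq> q" "y \<noteq> r" "p \<noteq> q" "p \<noteq> r" "q \<noteq> r"
    using xy(3) p(2) q(2) r(2) by auto
  note m = xy(1,2) p(1) q(1) r(1)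
  have pqr: "a p q + a p r + a q r = 0"
    by (rule t[OF m(3-5) ne(8-10)])
  have "a x p + a x q + a x r = 0"
    using t[OF m(1,3,4) ne(2,3,8)] t[OF m(1,3,5) ne(2,4,9)] t[OF m(1,4,5) ne(3,4,10)] pqr by linarith
  moreover have "a y p + a y q + a y r = 0"
    using t[OF m(2,3,4) ne(5,6,8)] t[OF m(2,3,5) ne(5,7,9)] t[OF m(2,4,5) ne(6,7,10)] pqr by linarith
  ultimately have axy: "a x y = 0"
    using t[OF m(1,2,3) ne(1,2,5)] t[OF m(1,2,4) ne(1,3,6)] t[OF m(1,2,5) ne(1,4,7)] by linarith
  have mm: "min x y = x" "max x y = y" using xy(3) by simp_all
  have "A (x, y) = 0" using axy unfolding a_def mm .
  then show ?thesis unfolding i .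
qed

end

section \<open>Binomial counts of the index sets\<close>

section \<open>Counting\<close>

definition inc2 :: "nat \<Rightarrow> (nat \<times> nat) set" where
  "inc2 m = {(i, j). 1 \<le> i \<and> i < j \<and> j \<le> m}"

definition inc3 :: "nat \<Rightarrow> (nat \<times> nat \<times> nat) set" where
  "inc3 m = {(i, j, k). 1 \<le> i \<and> i < j \<and> j < k \<and> k \<le> m}"

definition inc4 :: "nat \<Rightarrow> (nat \<times> nat \<times> nat \<times> nat) set" where
  "inc4 m = {(i, j, k, l). 1 \<le> i \<and> i < j \<and> j < k \<and> k < l \<and> l \<le> m}"

lemma finite_inc: "finite (inc2 m)" "finite (inc3 m)" "finite (inc4 m)"
proof -
  show "finite (inc2 m)"
    by (rule finite_subset[of _ "{..m} \<times> {..m}"]) (auto simp: inc2_def)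
  show "finite (inc3 m)"
    by (rule finite_subset[of _ "{..m} \<times> {..m} \<times> {..m}"]) (auto simp: inc3_def)
  show "finite (inc4 m)"
    by (rule finite_subset[of _ "{..m} \<times> {..m} \<times> {..m} \<times> {..m}"]) (auto simp: inc4_def)
qed

lemma card_inc2: "real (card (inc2 m)) = real m * (real m - 1) / 2"
proof (induction m)
  case 0
  have "inc2 0 = {}" by (auto simp: inc2_def)
  then show ?case by simp
next
  case (Suc m)
  have "inc2 (Suc m) = inc2 m \<union> (\<lambda>i. (i, Suc m)) ` {1..m}"
    by (auto simp: inc2_def le_Suc_eq)
  moreover have "inc2 m \<inter> (\<lambda>i. (i, Suc m)) ` {1..m} = {}" by (auto simp: inc2_def)
  moreover have "card ((\<lambda>i. (i, Suc m)) ` {1..m}) = m" by (subst card_image) (auto simp: inj_on_def)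
  ultimately show ?case
    using Suc by (simp add: card_Un_disjoint finite_inc field_simps)
qed

lemma card_inc3: "real (card (inc3 m)) = real m * (real m - 1) * (real m - 2) / 6"
proof (induction m)
  case 0
  have "inc3 0 = {}" by (auto simp: inc3_def)
  then show ?case by simp
next
  case (Suc m)
  let ?f = "\<lambda>(i, j). (i, j, Suc m)"
  have "inc3 (Suc m) = inc3 m \<union> ?f ` inc2 m"
    by (auto simp: inc3_def inc2_def le_Suc_eq image_iff)
  moreover have "inc3 m \<inter> ?f ` inc2 m = {}" by (auto simp: inc3_def)
  moreover have "card (?f ` inc2 m) = card (inc2 m)" by (rule card_image) (auto simp: inj_on_def)
  ultimately have "real (card (inc3 (Suc m))) = real (card (inc3 m)) + real (card (inc2 m))"
    by (simp add: card_Un_disjoint finite_inc)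
  then show ?case
    using Suc by (simp add: card_inc2 field_simps)
qed

lemma card_inc4: "real (card (inc4 m)) = real m * (real m - 1) * (real m - 2) * (real m - 3) / 24"
proof (induction m)
  case 0
  have "inc4 0 = {}" by (auto simp: inc4_def)
  then show ?case by simp
next
  case (Suc m)
  let ?f = "\<lambda>(i, j, k). (i, j, k, Suc m)"
  have "inc4 (Suc m) = inc4 m \<union> ?f ` inc3 m"
    by (auto simp: inc4_def inc3_def le_Suc_eq image_iff)
  moreover have "inc4 m \<inter> ?f ` inc3 m = {}" by (auto simp: inc4_def)
  moreover have "card (?f ` inc3 m) = card (inc3 m)" by (rule card_image) (auto simp: inj_on_def)
  ultimately have "real (card (inc4 (Suc m))) = real (card (inc4 m)) + real (card (inc3 m))"
    by (simp add: card_Un_disjoint finite_inc)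
  then show ?case
    using Suc by (simp add: card_inc3 field_simps)
qed

lemma card_link_index: "real (card (link_index n)) = real n * (real n - 1) / 2"
  using card_inc2[of n] by (simp add: link_index_def inc2_def)

text \<open>The three images are the three ways to split an increasing quadruple into two pairs, the
  pair with the smallest entry first.\<close>

lemma card_dihedral_index: "card (dihedral_index n) \<ge> 3 * card (inc4 (Suc n))"
proof -
  let ?f = "\<lambda>(i, j, k, l). (i, j, k, l) :: nat \<times> nat \<times> nat \<times> nat"
    and ?g = "\<lambda>(i, j, k, l). (i, k, j, l) :: nat \<times> nat \<times> nat \<times> nat"
    and ?h = "\<lambda>(i, j, k, l). (i, l, j, k) :: nat \<times> nat \<times> nat \<times> nat"
  let ?I = "inc4 (Suc n)"
  have card: "card (?f ` ?I) = card ?I" "card (?g ` ?I) = card ?I" "card (?h ` ?I) = card ?I"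
    by (rule card_image, auto simp: inj_on_def)+
  have "?f ` ?I \<inter> ?g ` ?I = {}" "(?f ` ?I \<union> ?g ` ?I) \<inter> ?h ` ?I = {}"
    by (auto simp: inc4_def)
  then have "card (?f ` ?I \<union> ?g ` ?I \<union> ?h ` ?I) = 3 * card ?I"
    using card finite_inc by (simp add: card_Un_disjoint)
  moreover have "?f ` ?I \<union> ?g ` ?I \<union> ?h ` ?I \<subseteq> dihedral_index n"
    by (auto simp: inc4_def dihedral_index_def)
  ultimately show ?thesis using card_mono[OF finite_dihedral_index] by metis
qed

lemma card_Un_five:
  assumes "finite F" "finite G" "finite H" "finite P" "finite Q"
    and "F \<inter> G = {}" "F \<inter> H = {}" "G \<inter> H = {}" "F \<inter> P = {}" "G \<inter> P = {}" "H \<inter> P = {}"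
    and "F \<inter> Q = {}" "G \<inter> Q = {}" "H \<inter> Q = {}" "P \<inter> Q = {}"
  shows "card (F \<union> G \<union> H \<union> P \<union> Q) = card F + card G + card H + card P + card Q"
  using assms by (simp add: card_Un_disjoint Int_Un_distrib2)

lemma card_johnson_index: "card (johnson_index N) \<ge> 3 * card (inc3 N) + 2 * card (inc4 N)"
proof -
  let ?f = "\<lambda>(i, j, k). (i, j, i, k) :: nat \<times> nat \<times> nat \<times> nat"
    and ?g = "\<lambda>(i, j, k). (j, i, j, k) :: nat \<times> nat \<times> nat \<times> nat"
    and ?h = "\<lambda>(i, j, k). (k, i, k, j) :: nat \<times> nat \<times> nat \<times> nat"
    and ?p = "\<lambda>(i, j, k, l). (i, k, j, l) :: nat \<times> nat \<times> nat \<times> nat"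
    and ?q = "\<lambda>(i, j, k, l). (i, j, l, k) :: nat \<times> nat \<times> nat \<times> nat"
  let ?I = "inc3 N" and ?J = "inc4 N"
  have card: "card (?f ` ?I) = card ?I" "card (?g ` ?I) = card ?I" "card (?h ` ?I) = card ?I"
    "card (?p ` ?J) = card ?J" "card (?q ` ?J) = card ?J"
    by (rule card_image, auto simp: inj_on_def)+
  have "card (?f ` ?I \<union> ?g ` ?I \<union> ?h ` ?I \<union> ?p ` ?J \<union> ?q ` ?J) =
      card (?f ` ?I) + card (?g ` ?I) + card (?h ` ?I) + card (?p ` ?J) + card (?q ` ?J)"
    by (rule card_Un_five; (intro finite_imageI finite_inc)?) (auto simp: inc4_def inc3_def)
  then have "card (?f ` ?I \<union> ?g ` ?I \<union> ?h ` ?I \<union> ?p ` ?J \<union> ?q ` ?J) = 3 * card ?I + 2 * card ?J"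
    unfolding card by linarith
  moreover have sub: "?f ` ?I \<union> ?g ` ?I \<union> ?h ` ?I \<union> ?p ` ?J \<union> ?q ` ?J \<subseteq> johnson_index N"
    by (intro Un_least; force simp: inc4_def inc3_def johnson_index_def)
  ultimately show ?thesis using card_mono[OF finite_johnson_index sub] by linarith
qed

section \<open>Linear independence and the final count\<close>

section \<open>The lower bound\<close>

text \<open>The square of the generator is pure but has sign -1 when a red and a blue strand meet;
  the fourth power always has sign 1.\<close>

lemma sigma_power_pure:
  assumes "4 dvd k"
  shows "prun (replicate k (3, True)) x = x" "twist_sgn pstep col_sgn (replicate k (3, True)) c = 1"
proof -
  obtain m where k: "k = 4 * m" using assms by auto
  have four: "replicate (4 * Suc m) (3 :: nat, True) =
      [(3, True), (3, True), (3, True), (3, True)] @ replicate (4 * m) (3, True)" for m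
  proof -
    have "4 * Suc m = Suc (Suc (Suc (Suc (4 * m))))" by simp
    then show ?thesis by (simp only: replicate_Suc append.simps)
  qed
  show p: "prun (replicate k (3, True)) x = x" for x :: "nat \<Rightarrow> 'z"
    unfolding k by (induction m) (simp, auto simp only: four foldr_append, auto simp: fun_eq_iff)
  show "twist_sgn pstep col_sgn (replicate k (3, True)) c = 1"
    unfolding k
  proof (induction m)
    case (Suc m)
    define c' where "c' = prun (replicate (4 * m) (3, True)) c"
    have "twist_sgn pstep col_sgn [(3, True), (3, True), (3, True), (3, True)] c' = 1"
      by (cases "c' 3"; cases "c' 4") (simp_all add: col_sgn_def)
    then show ?case using Suc unfolding four twist_sgn_append c'_def by simp
  qed simp
qed

lemma independence:
  fixes a :: "nat \<times> nat \<Rightarrow> rat" and b c :: "nat \<times> nat \<times> nat \<times> nat \<Rightarrow> rat"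
  assumes n: "5 \<le> n"
    and rel: "\<And>w. w \<in> torelli_words n \<Longrightarrow>
      (\<Sum>i\<in>link_index n. a i * of_int (link_hom i w))
      + (\<Sum>i\<in>dihedral_index n. b i * of_int (dihedral_hom i w))
      + (\<Sum>i\<in>johnson_index (n - 1). c i * of_int (johnson_hom i w)) = 0"
  shows "i \<in> link_index n \<Longrightarrow> a i = 0" "j \<in> dihedral_index n \<Longrightarrow> b j = 0"
    "k \<in> johnson_index (n - 1) \<Longrightarrow> c k = 0"
proof -
  let ?A = "\<lambda>g. \<Sum>i\<in>link_index n. a i * of_int (link_hom i (conj_twist g))"
    and ?B = "\<lambda>g. \<Sum>i\<in>dihedral_index n. b i * of_int (dihedral_hom i (conj_twist g))"
    and ?C = "\<lambda>g. \<Sum>i\<in>johnson_index (n - 1). c i * of_int (curvature (edge g 1) (edge g 2) i)"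
  have n3: "3 \<le> n" using n by simp
  have E: "?A g + ?B g - 2 * ?C g = 0" if g: "g \<in> braid_words n" for g
  proof -
    have "(\<Sum>i\<in>johnson_index (n - 1). c i * of_int (johnson_hom i (conj_twist g))) = - 2 * ?C g"
      unfolding johnson_hom_conj_twist[OF g] by (simp add: sum_distrib_left sum_negf algebra_simps)
    then show ?thesis using rel[OF conj_twist_torelli[OF g n3]] by simp
  qed
  have "curvature_relation n c"
  proof
    show "5 \<le> n" by (rule n)
    fix g and k :: nat assume g: "g \<in> braid_words n" and k: "4 dvd k"
    let ?h = "replicate k (3, True) @ g"
    have h: "?h \<in> braid_words n"
      using g n by (auto simp: braid_words_def)
    have "link_hom i (conj_twist ?h) = link_hom i (conj_twist g)" for i
      unfolding link_hom_conj_twist[OF h] link_hom_conj_twist[OF g] foldr_append sigma_power_pure(1)[OF k] ..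
    then have "?A ?h = ?A g" by simp
    moreover have "dihedral_hom i (conj_twist ?h) = dihedral_hom i (conj_twist g)"
      if "i \<in> dihedral_index n" for i
      unfolding dihedral_hom_conj_twist[OF h dihedral_index_props(1,2)[OF that] n3]
        dihedral_hom_conj_twist[OF g dihedral_index_props(1,2)[OF that] n3]
        foldr_append sigma_power_pure(1)[OF k] twist_sgn_append sigma_power_pure(2)[OF k] by simp
    then have "?B ?h = ?B g" by simp
    ultimately show "?C ?h = ?C g" using E[OF g] E[OF h] by linarith
  qed
  then have c: "\<And>k. k \<in> johnson_index (n - 1) \<Longrightarrow> c k = 0"
    by (rule curvature_relation.coefficients_zero)
  then show "k \<in> johnson_index (n - 1) \<Longrightarrow> c k = 0" .
  interpret dihedral_relation n a b
  proof
    show "5 \<le> n" by (rule n)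
    fix g assume g: "g \<in> braid_words n"
    have "?C g = 0" by (rule sum.neutral) (simp add: c)
    then show "?A g + ?B g = 0" using E[OF g] by simp
  qed
  show "i \<in> link_index n \<Longrightarrow> a i = 0" "j \<in> dihedral_index n \<Longrightarrow> b j = 0"
    by (rule link_coefficients_zero dihedral_coefficients_zero; assumption)+
qed

lemma card_index_le_dim:
  assumes n: "5 \<le> n"
  shows "enat (card (link_index n) + (card (dihedral_index n) + card (johnson_index (n - 1))))
    \<le> extended_dim class_ring (rational_homology 1 (braid_torelli n))"
proof -
  let ?I = "link_index n <+> (dihedral_index n <+> johnson_index (n - 1))"
  define \<phi> :: "nat \<times> nat + (nat \<times> nat \<times> nat \<times> nat) + (nat \<times> nat \<times> nat \<times> nat) \<Rightarrow> braid_word \<Rightarrow> rat" where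
    "\<phi> = case_sum (\<lambda>i w. of_int (link_hom i w))
      (case_sum (\<lambda>i w. of_int (dihedral_hom i w)) (\<lambda>i w. of_int (johnson_hom i w)))"
  have fin: "finite ?I"
    by (intro finite_Plus finite_link_index finite_dihedral_index finite_johnson_index)
  have "enat (card ?I) \<le> extended_dim class_ring (rational_homology 1 (braid_torelli n))"
  proof (rule card_le_dim_homology_braid_torelli[OF fin, of n \<phi>])
    show "\<phi> i u = \<phi> i v" if "i \<in> ?I" "braid_eq n u v" for i u v
      using that link_hom_respects[OF that(2)] johnson_hom_respects[OF that(2)]
        dihedral_hom_respects[OF dihedral_index_props(1) that(2)]
      by (auto simp: \<phi>_def)
    show "\<phi> i (u @ v) = \<phi> i u + \<phi> i v"
      if "i \<in> ?I" "u \<in> torelli_words n" "v \<in> torelli_words n" for i u v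
      using that link_hom_add[OF that(3)] johnson_hom_add[OF that(3)] dihedral_hom_add[OF that(2,3)]
      by (auto simp: \<phi>_def)
    fix q i
    assume q: "\<And>w. w \<in> torelli_words n \<Longrightarrow> (\<Sum>i\<in>?I. q i * \<phi> i w) = 0" and i: "i \<in> ?I"
    have "(\<Sum>i\<in>link_index n. q (Inl i) * of_int (link_hom i w))
      + (\<Sum>i\<in>dihedral_index n. q (Inr (Inl i)) * of_int (dihedral_hom i w))
      + (\<Sum>i\<in>johnson_index (n - 1). q (Inr (Inr i)) * of_int (johnson_hom i w)) = 0"
      if "w \<in> torelli_words n" for w
      using q[OF that]
      by (simp add: sum.Plus finite_link_index finite_dihedral_index finite_johnson_index finite_Plus
          \<phi>_def add.assoc)
    note z = independence[OF n this]
    show "q i = 0" using i by (auto simp: z)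
  qed
  then show ?thesis
    by (simp add: card_Plus finite_link_index finite_dihedral_index finite_johnson_index finite_Plus)
qed

theorem theorem1p11:
  fixes g :: nat
  assumes "g \<ge> 3"
  shows "ereal_of_enat (extended_dim class_ring (rational_homology 1 (braid_torelli (2 * g + 1))))
    \<ge> ereal (1 / 6 * (20 * real g ^ 4 + 12 * real g ^ 3 - 5 * real g ^ 2 + 9 * real g))"
proof -
  let ?n = "2 * g + 1"
  let ?m = "card (link_index ?n) + (card (dihedral_index ?n) + card (johnson_index (?n - 1)))"
  have "1 / 6 * (20 * real g ^ 4 + 12 * real g ^ 3 - 5 * real g ^ 2 + 9 * real g) =
    real (card (link_index ?n)) + (3 * real (card (inc4 (Suc ?n)))
      + (3 * real (card (inc3 (?n - 1))) + 2 * real (card (inc4 (?n - 1)))))"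
    unfolding card_link_index card_inc3 card_inc4
    by (simp add: field_simps power2_eq_square power3_eq_cube power4_eq_xxxx)
  also have "\<dots> \<le> real ?m"
    using card_dihedral_index[of ?n] card_johnson_index[of "?n - 1"] by linarith
  finally have "ereal (1 / 6 * (20 * real g ^ 4 + 12 * real g ^ 3 - 5 * real g ^ 2 + 9 * real g))
      \<le> ereal (real ?m)" by simp
  also have "\<dots> = ereal_of_enat (enat ?m)" by simp
  also have "\<dots> \<le> ereal_of_enat (extended_dim class_ring (rational_homology 1 (braid_torelli ?n)))"
    using assms by (subst ereal_of_enat_le_iff, intro card_index_le_dim) simp
  finally show ?thesis .
qed

end
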